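(* The following inclusions are maximal, in the sense that there is no proper intermediate compact quantum group: (1) $O_N\subset O_N^*$. (2) $B_N\subset B_N^\circ$.
   Context: $C(O_N^+)$ is the universal $C^*$-algebra generated by the entries of an $N\times N$ matrix $u=(u_{ij})$ with $u=\bar u$, $u^t=u^{-1}$, with its standard compact quantum group structure. $O_N$ is the orthogonal group, and $O_N^*\subset O_N^+$ is obtained by imposing $abc=cba$ for all $a,b,c\in\{u_{ij}\}$. $B_N\subset O_N$ is the group of orthogonal matrices having sum $1$ on each row and column, and $B_N^+\subset O_N^+$ is obtained by imposing $u\xi=\xi$, where $\xi$ is the all-one vector. Definition of $B_N^\circ$. Use indices $0,\ldots,N-1$ for $N\times N$ quantum groups and $1,\ldots,N-1$ for $(N-1)\times(N-1)$ ones. For $F\in O_N$ with $Fe_0=\frac1{\sqrt N}\xi$, there is an isomorphism $C(O_{N-1}^+)\to C(B_N^+)$, $w_{ij}\mapsto(F^*uF)_{ij}$, i.e. $B_N^+\simeq O_{N-1}^+$. The intermediate quantum group $B_N\subset B_N^\circ\subset B_N^+$ is the image of $O_{N-1}^*\subset O_{N-1}^+$ under this isomorphism, i.e. it is obtained from $B_N^+$ by imposing $abc=cba$ for all $a,b,c\in\{(F^*uF)_{ij}\,|\,i,j=1,\ldots,N-1\}$; it does not depend on $F$. An inclusion $G\subset H$ of closed subgroups of $O_N^+$ means a quotient map $C(H)\to C(G)$ sending $u_{ij}$ to $u_{ij}$, and intermediate quantum groups are understood as closed subgroups in this sense. *)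

theory Defs
  imports "HOL-Analysis.Analysis" "HOL-Library.Poly_Mapping"
begin

section \<open>Unital C*-algebras\<close>

text \<open>
  Real scaling, the norm and completeness are inherited from \<^class>\<open>banach\<close>. Since
  \<^class>\<open>real_normed_algebra_1\<close> contains \<open>norm 1 = 1\<close>, the zero algebra is excluded.
\<close>

class cstar_algebra = banach + real_normed_algebra_1 +
  fixes scaleC :: "complex \<Rightarrow> 'a \<Rightarrow> 'a"
    and adj :: "'a \<Rightarrow> 'a"
  assumes scaleC_add_right: "scaleC c (x + y) = scaleC c x + scaleC c y"
    and scaleC_add_left: "scaleC (c + d) x = scaleC c x + scaleC d x"
    and scaleC_scaleC: "scaleC c (scaleC d x) = scaleC (c * d) x"
    and scaleC_of_real: "scaleC (complex_of_real r) x = scaleR r x"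
    and mult_scaleC_left: "scaleC c x * y = scaleC c (x * y)"
    and mult_scaleC_right: "x * scaleC c y = scaleC c (x * y)"
    and norm_scaleC: "norm (scaleC c x) = cmod c * norm x"
    and adj_adj: "adj (adj x) = x"
    and adj_add: "adj (x + y) = adj x + adj y"
    and adj_mult: "adj (x * y) = adj y * adj x"
    and adj_scaleC: "adj (scaleC c x) = scaleC (cnj c) (adj x)"
    and norm_adj_mult_self: "norm (adj x * x) = (norm x)\<^sup>2"

lemma scaleC_one: "scaleC 1 x = (x::'a::cstar_algebra)"
  using scaleC_of_real[of 1 x] by simp

global_interpretation complex_vector:
  vector_space "scaleC :: complex \<Rightarrow> 'a \<Rightarrow> 'a::cstar_algebra"
  by unfold_locales
    (simp_all add: scaleC_add_right scaleC_add_left scaleC_scaleC scaleC_one)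

lemma adj_zero: "adj 0 = (0::'a::cstar_algebra)"
  using adj_add[of 0 "0::'a"] by simp

lemma adj_one: "adj 1 = (1::'a::cstar_algebra)"
  by (metis adj_adj adj_mult mult.right_neutral mult.left_neutral)

instantiation complex :: cstar_algebra
begin

definition scaleC_complex :: "complex \<Rightarrow> complex \<Rightarrow> complex" where "scaleC_complex = (*)"

definition adj_complex :: "complex \<Rightarrow> complex" where "adj_complex = cnj"

instance
  by standard
    (auto simp: scaleC_complex_def adj_complex_def algebra_simps norm_mult power2_eq_square
      scaleR_conv_of_real)

end

lemma norm_adj: "norm (adj x) = norm (x::'a::cstar_algebra)"
proof -
  have *: "norm y \<le> norm (adj y)" for y :: 'a
  proof (cases "norm y = 0")
    case False
    have "norm y * norm y \<le> norm (adj y) * norm y"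
      using norm_mult_ineq[of "adj y" y] by (simp add: norm_adj_mult_self power2_eq_square)
    then show ?thesis using False
      by (simp add: mult_le_cancel_right)
  qed simp
  show ?thesis using *[of x] *[of "adj x"] by (simp add: adj_adj)
qed

lemma adj_diff: "adj (x - y) = adj x - adj (y::'a::cstar_algebra)"
  by (metis adj_add add_diff_cancel diff_add_cancel)

lemma continuous_on_adj:
  fixes f :: "'b::metric_space \<Rightarrow> 'a::cstar_algebra"
  assumes "continuous_on S f"
  shows "continuous_on S (\<lambda>x. adj (f x))"
  using assms unfolding continuous_on_iff dist_norm
  by (simp add: adj_diff[symmetric] norm_adj)

lemma continuous_on_scaleC:
  fixes f :: "'b::metric_space \<Rightarrow> 'a::cstar_algebra"
  assumes "continuous_on S f"
  shows "continuous_on S (\<lambda>x. scaleC c (f x))"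
proof -
  have "bounded_linear (scaleC c :: 'a \<Rightarrow> 'a)"
  proof (rule bounded_linear_intro[where K = "cmod c"])
    show "scaleC c (r *\<^sub>R x) = r *\<^sub>R scaleC c x" for r and x :: 'a
      by (simp add: scaleC_of_real[symmetric] scaleC_scaleC mult.commute)
  qed (simp_all add: scaleC_add_right norm_scaleC mult.commute)
  then show ?thesis
    by (rule bounded_linear.continuous_on[OF _ assms])
qed


section \<open>Algebras of continuous functions\<close>

lemma apply_Bcontfun:
  assumes "continuous_on UNIV f" "\<And>x. norm (f x) \<le> B"
  shows "apply_bcontfun (Bcontfun f) = f"
  using assms by (intro Bcontfun_inverse) (auto simp: bcontfun_def bounded_iff)

instantiation bcontfun :: (metric_space, cstar_algebra) cstar_algebra
begin

definition one_bcontfun :: "'a \<Rightarrow>\<^sub>C 'b"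
  where "one_bcontfun = Bcontfun (\<lambda>_. 1)"

definition times_bcontfun :: "('a \<Rightarrow>\<^sub>C 'b) \<Rightarrow> ('a \<Rightarrow>\<^sub>C 'b) \<Rightarrow> 'a \<Rightarrow>\<^sub>C 'b"
  where "times_bcontfun f g = Bcontfun (\<lambda>x. apply_bcontfun f x * apply_bcontfun g x)"

definition scaleC_bcontfun :: "complex \<Rightarrow> ('a \<Rightarrow>\<^sub>C 'b) \<Rightarrow> 'a \<Rightarrow>\<^sub>C 'b"
  where "scaleC_bcontfun c f = Bcontfun (\<lambda>x. scaleC c (apply_bcontfun f x))"

definition adj_bcontfun :: "('a \<Rightarrow>\<^sub>C 'b) \<Rightarrow> 'a \<Rightarrow>\<^sub>C 'b"
  where "adj_bcontfun f = Bcontfun (\<lambda>x. adj (apply_bcontfun f x))"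

lemma apply_one_bcontfun: "apply_bcontfun (1 :: 'a \<Rightarrow>\<^sub>C 'b) x = 1"
  unfolding one_bcontfun_def by (subst apply_Bcontfun[where B = 1]) auto

lemma apply_times_bcontfun:
  "apply_bcontfun (f * g :: 'a \<Rightarrow>\<^sub>C 'b) x = apply_bcontfun f x * apply_bcontfun g x"
  unfolding times_bcontfun_def
proof (subst apply_Bcontfun[where B = "norm f * norm g"])
  show "norm (apply_bcontfun f x * apply_bcontfun g x) \<le> norm f * norm g" for x
    by (rule order_trans[OF norm_mult_ineq]) (intro mult_mono norm_bounded, auto)
qed (auto intro!: continuous_intros)

lemma apply_scaleC_bcontfun:
  "apply_bcontfun (scaleC c f :: 'a \<Rightarrow>\<^sub>C 'b) x = scaleC c (apply_bcontfun f x)"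
  unfolding scaleC_bcontfun_def
  by (subst apply_Bcontfun[where B = "cmod c * norm f"])
    (auto intro!: continuous_on_scaleC mult_left_mono norm_bounded simp: norm_scaleC)

lemma apply_adj_bcontfun:
  "apply_bcontfun (adj f :: 'a \<Rightarrow>\<^sub>C 'b) x = adj (apply_bcontfun f x)"
  unfolding adj_bcontfun_def
  by (subst apply_Bcontfun[where B = "norm f"])
    (auto intro!: continuous_on_adj norm_bounded simp: norm_adj)

lemmas bcontfun_cstar_simps =
  apply_one_bcontfun apply_times_bcontfun apply_scaleC_bcontfun apply_adj_bcontfun

instance
proof
  fix f g h :: "'a \<Rightarrow>\<^sub>C 'b" and c d :: complex and r :: real
  show "norm (f * g) \<le> norm f * norm g"
  proof (rule norm_bound)
    show "norm (apply_bcontfun (f * g) x) \<le> norm f * norm g" for x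
      unfolding apply_times_bcontfun
      by (rule order_trans[OF norm_mult_ineq]) (intro mult_mono norm_bounded, auto)
  qed
  show "norm (1 :: 'a \<Rightarrow>\<^sub>C 'b) = 1"
  proof (rule antisym)
    show "norm (1 :: 'a \<Rightarrow>\<^sub>C 'b) \<le> 1"
      by (rule norm_bound) (simp add: apply_one_bcontfun)
    show "1 \<le> norm (1 :: 'a \<Rightarrow>\<^sub>C 'b)"
      using norm_bounded[of "1 :: 'a \<Rightarrow>\<^sub>C 'b" undefined] by (simp add: apply_one_bcontfun)
  qed
  then show "(0 :: 'a \<Rightarrow>\<^sub>C 'b) \<noteq> 1"
    by (metis norm_zero zero_neq_one)
  show "norm (scaleC c f) = cmod c * norm f"
  proof -
    have le: "norm (scaleC c f) \<le> cmod c * norm f" for c and f :: "'a \<Rightarrow>\<^sub>C 'b"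
      by (rule norm_bound)
        (auto simp: apply_scaleC_bcontfun norm_scaleC intro!: mult_left_mono norm_bounded)
    show ?thesis
    proof (cases "c = 0")
      case True
      then show ?thesis using le[of 0 f] by simp
    next
      case False
      have "scaleC (inverse c) (scaleC c f) = f"
        by (rule bcontfun_eqI)
          (simp add: apply_scaleC_bcontfun scaleC_scaleC False scaleC_one)
      then have "cmod c * norm f \<le> norm (scaleC c f)"
        using le[of "inverse c" "scaleC c f"] False
        by (simp add: norm_divide divide_simps mult.commute)
      with le[of c f] show ?thesis by simp
    qed
  qed
  show "norm (adj f * f) = (norm f)\<^sup>2"
  proof (rule antisym)
    show "norm (adj f * f) \<le> (norm f)\<^sup>2"
      by (rule norm_bound)
        (simp add: bcontfun_cstar_simps norm_adj_mult_self norm_bounded power_mono)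
    have "norm f \<le> sqrt (norm (adj f * f))"
    proof (rule norm_bound)
      show "norm (apply_bcontfun f x) \<le> sqrt (norm (adj f * f))" for x
        using norm_bounded[of "adj f * f" x]
        by (simp add: bcontfun_cstar_simps norm_adj_mult_self real_le_rsqrt)
    qed
    then have "(norm f)\<^sup>2 \<le> (sqrt (norm (adj f * f)))\<^sup>2"
      by (intro power_mono) auto
    then show "(norm f)\<^sup>2 \<le> norm (adj f * f)"
      by simp
  qed
qed (auto intro!: bcontfun_eqI simp: bcontfun_cstar_simps algebra_simps
      scaleC_add_right scaleC_add_left scaleC_scaleC scaleC_of_real mult_scaleC_left
      mult_scaleC_right adj_adj adj_add adj_mult adj_scaleC)

end


section \<open>The groups \<open>O\<^sub>N\<close> and \<open>B\<^sub>N\<close> and their function algebras\<close>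

text \<open>
  The dimension is \<open>N = CARD('n)\<close>. Both groups are compact, so that \<open>\<Rightarrow>\<^sub>C\<close> into \<^typ>\<open>complex\<close>
  is the algebra of all continuous functions on them.
\<close>

typedef 'n orthogonal_group = "{A :: real^'n^'n. orthogonal_matrix A}"
  morphisms orthogonal_entries Orthogonal
  using orthogonal_matrix_id by auto

typedef 'n bistochastic_group =
  "{A :: real^'n^'n. orthogonal_matrix A \<and>
      (\<forall>i. (\<Sum>j\<in>UNIV. A$i$j) = 1) \<and> (\<forall>j. (\<Sum>i\<in>UNIV. A$i$j) = 1)}"
  morphisms bistochastic_entries Bistochastic
  by (rule exI[of _ "mat 1"], simp add: orthogonal_matrix_id, simp add: mat_def)

instantiation orthogonal_group :: (finite) metric_space
begin

definition dist_orthogonal_group :: "'a orthogonal_group \<Rightarrow> 'a orthogonal_group \<Rightarrow> real"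
  where "dist_orthogonal_group A B = dist (orthogonal_entries A) (orthogonal_entries B)"

definition uniformity_orthogonal_group :: "('a orthogonal_group \<times> 'a orthogonal_group) filter"
  where "uniformity_orthogonal_group = (INF e\<in>{0 <..}. principal {(x, y). dist x y < e})"

definition open_orthogonal_group :: "'a orthogonal_group set \<Rightarrow> bool"
  where "open_orthogonal_group S \<longleftrightarrow> (\<forall>x\<in>S. \<forall>\<^sub>F (x', y) in uniformity. x' = x \<longrightarrow> y \<in> S)"

instance
  by standard
    (auto simp: dist_orthogonal_group_def orthogonal_entries_inject dist_triangle2
      uniformity_orthogonal_group_def open_orthogonal_group_def)

end

instantiation bistochastic_group :: (finite) metric_space
begin

definition dist_bistochastic_group :: "'a bistochastic_group \<Rightarrow> 'a bistochastic_group \<Rightarrow> real"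
  where "dist_bistochastic_group A B = dist (bistochastic_entries A) (bistochastic_entries B)"

definition uniformity_bistochastic_group ::
    "('a bistochastic_group \<times> 'a bistochastic_group) filter"
  where "uniformity_bistochastic_group = (INF e\<in>{0 <..}. principal {(x, y). dist x y < e})"

definition open_bistochastic_group :: "'a bistochastic_group set \<Rightarrow> bool"
  where "open_bistochastic_group S \<longleftrightarrow> (\<forall>x\<in>S. \<forall>\<^sub>F (x', y) in uniformity. x' = x \<longrightarrow> y \<in> S)"

instance
  by standard
    (auto simp: dist_bistochastic_group_def bistochastic_entries_inject dist_triangle2
      uniformity_bistochastic_group_def open_bistochastic_group_def)

end

definition O_coords :: "('n::finite orthogonal_group \<Rightarrow>\<^sub>C complex)^'n^'n"
  where "O_coords = (\<chi> i j. Bcontfun (\<lambda>A. complex_of_real (orthogonal_entries A $ i $ j)))"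

definition B_coords :: "('n::finite bistochastic_group \<Rightarrow>\<^sub>C complex)^'n^'n"
  where "B_coords = (\<chi> i j. Bcontfun (\<lambda>A. complex_of_real (bistochastic_entries A $ i $ j)))"

lemma orthogonal_matrix_entry_le_1:
  fixes A :: "real^'n^'n"
  assumes "orthogonal_matrix A"
  shows "\<bar>A $ i $ j\<bar> \<le> 1"
proof -
  have "(\<Sum>k\<in>UNIV. A $ k $ j * A $ k $ j) = (transpose A ** A) $ j $ j"
    by (simp add: matrix_matrix_mult_def transpose_def)
  also have "\<dots> = 1"
    using assms by (simp add: orthogonal_matrix_def mat_def)
  finally have "(\<Sum>k\<in>UNIV. (A $ k $ j)\<^sup>2) = 1"
    by (simp add: power2_eq_square)
  then have "(A $ i $ j)\<^sup>2 \<le> 1"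
    using member_le_sum[of i UNIV "\<lambda>k. (A $ k $ j)\<^sup>2"] by simp
  then show ?thesis
    by (simp add: abs_square_le_1)
qed

lemma apply_O_coords:
  "apply_bcontfun (O_coords $ i $ j) A = complex_of_real (orthogonal_entries A $ i $ j)"
proof -
  have *: "dist (X $ i $ j) (Y $ i $ j) \<le> dist X Y" for X Y :: "real^'a^'a"
    by (meson dist_vec_nth_le order_trans)
  have "continuous_on UNIV (\<lambda>A. orthogonal_entries A $ i $ j)"
    unfolding continuous_on_iff by (metis * dist_orthogonal_group_def le_less_trans)
  then show ?thesis
    unfolding O_coords_def using orthogonal_entries
    by (subst vec_lambda_beta, subst vec_lambda_beta, subst apply_Bcontfun[where B = 1])
      (auto intro!: continuous_intros orthogonal_matrix_entry_le_1)
qed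

lemma apply_B_coords:
  "apply_bcontfun (B_coords $ i $ j) A = complex_of_real (bistochastic_entries A $ i $ j)"
proof -
  have *: "dist (X $ i $ j) (Y $ i $ j) \<le> dist X Y" for X Y :: "real^'a^'a"
    by (meson dist_vec_nth_le order_trans)
  have "continuous_on UNIV (\<lambda>A. bistochastic_entries A $ i $ j)"
    unfolding continuous_on_iff by (metis * dist_bistochastic_group_def le_less_trans)
  then show ?thesis
    unfolding B_coords_def using bistochastic_entries
    by (subst vec_lambda_beta, subst vec_lambda_beta, subst apply_Bcontfun[where B = 1])
      (auto intro!: continuous_intros orthogonal_matrix_entry_le_1)
qed


section \<open>Universal C*-algebras\<close>

text \<open>
  The free unital *-algebra on a set of generators is the monoid algebra of the free monoid on
  the letters \<open>x\<close> and \<open>x\<^sup>*\<close>; the letter \<open>(x, s)\<close> stands for \<open>x\<^sup>*\<close> if \<open>s\<close> is true and for \<open>x\<close>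
  otherwise. The monoid of words is written additively, as \<^theory>\<open>HOL-Library.Poly_Mapping\<close>
  requires for the convolution product.
\<close>

datatype 'x star_word = Word (letters: "('x \<times> bool) list")

instantiation star_word :: (type) monoid_add
begin

definition zero_star_word :: "'a star_word" where "zero_star_word = Word []"

definition plus_star_word :: "'a star_word \<Rightarrow> 'a star_word \<Rightarrow> 'a star_word"
  where "plus_star_word v w = Word (letters v @ letters w)"

instance
  by standard (auto simp: zero_star_word_def plus_star_word_def)

end

type_synonym 'x free_star_algebra = "'x star_word \<Rightarrow>\<^sub>0 complex"

definition gen :: "'x \<Rightarrow> 'x free_star_algebra"
  where "gen x = Poly_Mapping.single (Word [(x, False)]) 1"

definition const :: "complex \<Rightarrow> 'x free_star_algebra"
  where "const c = Poly_Mapping.single 0 c"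

definition word_star :: "'x star_word \<Rightarrow> 'x star_word"
  where "word_star w = Word (rev (map (\<lambda>(x, s). (x, \<not> s)) (letters w)))"

definition free_star :: "'x free_star_algebra \<Rightarrow> 'x free_star_algebra"
  where "free_star p =
    (\<Sum>w\<in>Poly_Mapping.keys p. Poly_Mapping.single (word_star w) (cnj (Poly_Mapping.lookup p w)))"

definition eval_word :: "('x \<Rightarrow> 'a::cstar_algebra) \<Rightarrow> 'x star_word \<Rightarrow> 'a"
  where "eval_word a w = prod_list (map (\<lambda>(x, s). if s then adj (a x) else a x) (letters w))"

definition free_eval :: "('x \<Rightarrow> 'a::cstar_algebra) \<Rightarrow> 'x free_star_algebra \<Rightarrow> 'a"
  where "free_eval a p =
    (\<Sum>w\<in>Poly_Mapping.keys p. scaleC (Poly_Mapping.lookup p w) (eval_word a w))"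

definition cstar_seminorm :: "('x free_star_algebra \<Rightarrow> real) \<Rightarrow> bool"
  where "cstar_seminorm \<rho> \<longleftrightarrow>
    (\<forall>p. 0 \<le> \<rho> p) \<and>
    (\<forall>p q. \<rho> (p + q) \<le> \<rho> p + \<rho> q) \<and>
    (\<forall>c p. \<rho> (const c * p) = cmod c * \<rho> p) \<and>
    (\<forall>p q. \<rho> (p * q) \<le> \<rho> p * \<rho> q) \<and>
    (\<forall>p. \<rho> (free_star p * p) = (\<rho> p)\<^sup>2)"

text \<open>
  \<open>universal_cstar_algebra R a\<close> states that the algebra \<^typ>\<open>'a\<close> together with the family \<open>a\<close> is
  the universal C*-algebra with generators \<open>a x\<close> and relations \<open>r = 0\<close> for \<open>r \<in> R\<close>: the
  Hausdorff completion of the free *-algebra in its largest C*-seminorm that vanishes on \<open>R\<close>.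
  The pair is determined by this up to a unique isomorphism; see \<open>universal_property\<close> below.
\<close>

definition universal_cstar_algebra ::
    "'x free_star_algebra set \<Rightarrow> ('x \<Rightarrow> 'a::cstar_algebra) \<Rightarrow> bool"
  where "universal_cstar_algebra R a \<longleftrightarrow>
    (let S = {\<rho>. cstar_seminorm \<rho> \<and> (\<forall>r\<in>R. \<rho> r = 0)} in
      closure (range (free_eval a)) = UNIV \<and>
      (\<forall>p. bdd_above ((\<lambda>\<rho>. \<rho> p) ` S) \<and> norm (free_eval a p) = (SUP \<rho>\<in>S. \<rho> p)))"

definition cstar_hom :: "('a::cstar_algebra \<Rightarrow> 'b::cstar_algebra) \<Rightarrow> bool"
  where "cstar_hom f \<longleftrightarrow>
    (\<forall>x y. f (x + y) = f x + f y) \<and>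
    (\<forall>c x. f (scaleC c x) = scaleC c (f x)) \<and>
    (\<forall>x y. f (x * y) = f x * f y) \<and>
    (\<forall>x. f (adj x) = adj (f x)) \<and>
    f 1 = 1"

lemma free_eval_superset:
  assumes "finite S" "Poly_Mapping.keys p \<subseteq> S"
  shows "free_eval a p = (\<Sum>w\<in>S. scaleC (Poly_Mapping.lookup p w) (eval_word a w))"
  unfolding free_eval_def using assms
  by (intro sum.mono_neutral_left) (auto simp: in_keys_iff complex_vector.scale_zero_left)

lemma free_eval_single: "free_eval a (Poly_Mapping.single w c) = scaleC c (eval_word a w)"
  by (subst free_eval_superset[of "{w}"]) auto

lemma free_eval_add: "free_eval a (p + q) = free_eval a p + free_eval a q"
  using Poly_Mapping.keys_add[of p q]
  by (subst (1 2 3) free_eval_superset[of "Poly_Mapping.keys p \<union> Poly_Mapping.keys q"])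
    (auto simp: lookup_add scaleC_add_left sum.distrib)

lemma free_eval_zero: "free_eval a 0 = 0"
  by (simp add: free_eval_def)

lemma free_eval_sum: "free_eval a (sum f S) = (\<Sum>x\<in>S. free_eval a (f x))"
  by (induction S rule: infinite_finite_induct) (auto simp: free_eval_zero free_eval_add)

lemma eval_word_plus: "eval_word a (v + w) = eval_word a v * eval_word a w"
  by (simp add: eval_word_def plus_star_word_def)

lemma eval_word_zero: "eval_word a 0 = 1"
  by (simp add: eval_word_def zero_star_word_def)

lemma eval_word_star: "eval_word a (word_star w) = adj (eval_word a w)"
proof -
  have "prod_list (map (\<lambda>(x, s). if s then adj (a x) else a x)
      (rev (map (\<lambda>(x, s). (x, \<not> s)) l))) =
      adj (prod_list (map (\<lambda>(x, s). if s then adj (a x) else a x) l))" for l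
    by (induction l) (auto simp: adj_one adj_mult adj_adj)
  then show ?thesis
    by (simp add: eval_word_def word_star_def)
qed

lemma sum_singles:
  "(\<Sum>w\<in>Poly_Mapping.keys p. Poly_Mapping.single w (Poly_Mapping.lookup p w)) = p"
  by (rule poly_mapping_eqI)
    (simp add: lookup_sum lookup_single when_def sum.delta in_keys_iff)

lemma free_eval_mult: "free_eval a (p * q) = free_eval a p * free_eval a q"
proof -
  let ?s = "\<lambda>p w. Poly_Mapping.single w (Poly_Mapping.lookup p w)"
  let ?k = Poly_Mapping.keys
  have "p * q = (\<Sum>v\<in>?k p. ?s p v) * (\<Sum>w\<in>?k q. ?s q w)"
    by (simp only: sum_singles)
  also have "\<dots> = (\<Sum>v\<in>?k p. \<Sum>w\<in>?k q. ?s p v * ?s q w)"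
    by (simp add: sum_product)
  finally have "free_eval a (p * q) = (\<Sum>v\<in>?k p. \<Sum>w\<in>?k q. free_eval a (?s p v * ?s q w))"
    by (simp add: free_eval_sum)
  also have "\<dots> = free_eval a p * free_eval a q"
    unfolding free_eval_def[of a p] free_eval_def[of a q] sum_product
    by (simp add: mult_single free_eval_single eval_word_plus
        mult_scaleC_left mult_scaleC_right scaleC_scaleC mult.commute)
  finally show ?thesis .
qed

lemma free_eval_const: "free_eval a (const c) = scaleC c 1"
  by (simp add: const_def free_eval_single eval_word_zero)

lemma free_eval_gen: "free_eval a (gen x) = a x"
  by (simp add: gen_def free_eval_single eval_word_def scaleC_one)

lemma adj_sum: "adj (sum f S) = (\<Sum>x\<in>S. adj (f x :: 'a::cstar_algebra))"
  by (induction S rule: infinite_finite_induct) (auto simp: adj_zero adj_add)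

lemma free_eval_star: "free_eval a (free_star p) = adj (free_eval a p)"
  by (simp add: free_star_def free_eval_sum free_eval_single eval_word_star)
    (simp add: free_eval_def adj_sum adj_scaleC)

lemma cstar_seminorm_free_eval: "cstar_seminorm (\<lambda>p. norm (free_eval a p))"
  by (simp add: cstar_seminorm_def free_eval_add free_eval_mult free_eval_const free_eval_star
      norm_triangle_ineq norm_mult_ineq mult_scaleC_left norm_scaleC norm_adj_mult_self)

lemma universal_norm_le:
  assumes "universal_cstar_algebra R a" "\<And>r. r \<in> R \<Longrightarrow> free_eval b r = 0"
  shows "norm (free_eval b p) \<le> norm (free_eval a p)"
proof -
  define S where "S = {\<rho>. cstar_seminorm \<rho> \<and> (\<forall>r\<in>R. \<rho> r = 0)}"
  have "bdd_above ((\<lambda>\<rho>. \<rho> p) ` S)" "norm (free_eval a p) = (SUP \<rho>\<in>S. \<rho> p)"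
    using assms(1) by (auto simp: universal_cstar_algebra_def Let_def S_def)
  moreover have "(\<lambda>p. norm (free_eval b p)) \<in> S"
    using assms(2) by (simp add: S_def cstar_seminorm_free_eval)
  then have "norm (free_eval b p) \<in> (\<lambda>\<rho>. \<rho> p) ` S"
    by (rule rev_image_eqI) simp
  ultimately show ?thesis
    by (simp add: cSup_upper)
qed

lemma universal_relations:
  assumes "universal_cstar_algebra R a" "r \<in> R"
  shows "free_eval a r = 0"
proof -
  define S where "S = {\<rho>. cstar_seminorm \<rho> \<and> (\<forall>r\<in>R. \<rho> r = 0)}"
  have "(\<lambda>_. 0) \<in> S"
    by (simp add: S_def cstar_seminorm_def)
  then have "S \<noteq> {}"
    by blast
  moreover have "(\<lambda>\<rho>. \<rho> r) ` S \<subseteq> {0}"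
    using assms(2) by (auto simp: S_def)
  ultimately have "(\<lambda>\<rho>. \<rho> r) ` S = {0}"
    by (simp add: subset_singleton_iff)
  then have "(SUP \<rho>\<in>S. \<rho> r) = 0"
    by simp
  moreover have "norm (free_eval a r) = (SUP \<rho>\<in>S. \<rho> r)"
    using assms(1) by (simp add: universal_cstar_algebra_def Let_def S_def)
  ultimately show ?thesis
    by simp
qed

theorem universal_property:
  fixes a :: "'x \<Rightarrow> 'a::cstar_algebra" and b :: "'x \<Rightarrow> 'b::cstar_algebra"
  assumes a: "universal_cstar_algebra R a" and b: "\<And>r. r \<in> R \<Longrightarrow> free_eval b r = 0"
  shows "\<exists>\<pi>. cstar_hom \<pi> \<and> (\<forall>x. \<pi> (a x) = b x)"
proof -
  let ?A = "free_eval a" and ?B = "free_eval b"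
  have dense: "closure (range ?A) = UNIV"
    using a by (simp add: universal_cstar_algebra_def Let_def)
  have diff: "free_eval c (p - q) = free_eval c p - free_eval c q" for c :: "'x \<Rightarrow> 'c::cstar_algebra" and p q
    by (metis add_diff_cancel diff_add_cancel free_eval_add)
  have le: "dist (?B p) (?B q) \<le> dist (?A p) (?A q)" for p q
    using universal_norm_le[OF a b, of "p - q"] by (simp add: dist_norm diff)
  define f where "f x = ?B (SOME p. ?A p = x)" for x
  have f: "f (?A p) = ?B p" for p
  proof -
    have "?A (SOME q. ?A q = ?A p) = ?A p" by (rule someI) simp
    then have "dist (f (?A p)) (?B p) \<le> 0" unfolding f_def using le by (metis dist_self)
    then show ?thesis by simp
  qed
  have uc: "uniformly_continuous_on (range ?A) f"
    unfolding uniformly_continuous_on_def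
  proof (intro allI impI)
    fix e :: real assume "0 < e"
    moreover have "dist (f y) (f x) < e"
      if "x \<in> range ?A" "y \<in> range ?A" "dist y x < e" for x y
    proof -
      from that obtain p q where "x = ?A p" "y = ?A q" by blast
      then show ?thesis using le[of q p] that(3) by (simp add: f)
    qed
    ultimately show "\<exists>d>0. \<forall>x\<in>range ?A. \<forall>y\<in>range ?A. dist y x < d \<longrightarrow> dist (f y) (f x) < e"
      by (intro exI[of _ e]) simp
  qed
  have "\<exists>g. uniformly_continuous_on (closure (range ?A)) g \<and> (\<forall>x\<in>range ?A. f x = g x)"
  proof (rule uniformly_continuous_on_extension_on_closure[OF uc])
    fix g
    assume "uniformly_continuous_on (closure (range ?A)) g" "\<And>x. x \<in> range ?A \<Longrightarrow> f x = g x"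
    then show ?thesis by (intro exI[of _ g] conjI ballI)
  qed
  then obtain g where g: "uniformly_continuous_on (closure (range ?A)) g"
    and fg: "\<And>x. x \<in> range ?A \<Longrightarrow> f x = g x"
    by blast
  have gA: "g (?A p) = ?B p" for p
    using f fg by (metis rangeI)
  have cont: "continuous_on UNIV g"
    using g by (simp add: dense uniformly_continuous_imp_continuous)
  have gc: "continuous_on X (\<lambda>x. g (h x))" if "continuous_on X h"
    for h :: "'c::topological_space \<Rightarrow> 'a" and X
    by (rule continuous_on_compose2[OF cont that]) auto
  have ext1: "P x" if "closed {x. P x}" "\<And>p. P (?A p)" for P and x
  proof -
    have "closure (range ?A) \<subseteq> {x. P x}" using that by (intro closure_minimal) auto
    then show ?thesis using dense by auto
  qed
  have ext2: "P x y" if cl: "closed {z. P (fst z) (snd z)}" and P: "\<And>p q. P (?A p) (?A q)"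
    for P and x y
  proof -
    have "closure (range ?A \<times> range ?A) \<subseteq> {z. P (fst z) (snd z)}"
      using that by (intro closure_minimal) auto
    moreover have "(x, y) \<in> closure (range ?A \<times> range ?A)"
      by (simp add: closure_Times dense)
    ultimately have "(x, y) \<in> {z. P (fst z) (snd z)}"
      by (rule subsetD)
    then show ?thesis by simp
  qed
  have add: "g (x + y) = g x + g y" for x y
  proof (rule ext2[of "\<lambda>x y. g (x + y) = g x + g y"])
    show "g (?A p + ?A q) = g (?A p) + g (?A q)" for p q
      by (simp only: gA free_eval_add[symmetric])
  qed (intro closed_Collect_eq gc continuous_intros)
  have mult: "g (x * y) = g x * g y" for x y
  proof (rule ext2[of "\<lambda>x y. g (x * y) = g x * g y"])
    show "g (?A p * ?A q) = g (?A p) * g (?A q)" for p q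
      by (simp only: gA free_eval_mult[symmetric])
  qed (intro closed_Collect_eq gc continuous_intros)
  have star: "g (adj x) = adj (g x)" for x
  proof (rule ext1)
    show "g (adj (?A p)) = adj (g (?A p))" for p
      by (simp only: gA free_eval_star[symmetric])
  qed (intro closed_Collect_eq gc continuous_on_adj continuous_on_id)
  have scale: "g (scaleC c x) = scaleC c (g x)" for c x
  proof (rule ext1)
    have s: "scaleC c (free_eval d p) = free_eval d (const c * p)"
      for d :: "'x \<Rightarrow> 'c::cstar_algebra" and p
      by (simp add: free_eval_mult free_eval_const mult_scaleC_left)
    show "g (scaleC c (?A p)) = scaleC c (g (?A p))" for p
      by (simp only: s gA)
  qed (intro closed_Collect_eq gc continuous_on_scaleC continuous_on_id)
  have one: "g 1 = 1"
    using gA[of "const 1"] by (simp add: free_eval_const scaleC_one)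
  have gen: "g (a x) = b x" for x
    using gA[of "gen x"] by (simp add: free_eval_gen)
  have "cstar_hom g"
    unfolding cstar_hom_def by (intro conjI allI add mult star scale one)
  with gen show ?thesis
    by blast
qed


section \<open>Compact quantum groups\<close>

text \<open>
  The minimal tensor product. The complex span of the products \<open>\<iota>\<^sub>1 a * \<iota>\<^sub>2 b\<close> is a copy of the
  algebraic tensor product of the two algebras: the injectivity of the canonical map from the
  latter is the clause on finite linearly independent sets. It is dense, and the norm is the
  smallest C*-norm on it.
\<close>

definition elementary_tensors ::
    "('a::cstar_algebra \<Rightarrow> 't::cstar_algebra) \<Rightarrow> ('b::cstar_algebra \<Rightarrow> 't) \<Rightarrow> 't set"
  where "elementary_tensors \<iota>\<^sub>1 \<iota>\<^sub>2 = {\<iota>\<^sub>1 a * \<iota>\<^sub>2 b | a b. True}"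

definition cstar_norm_on :: "'t::cstar_algebra set \<Rightarrow> ('t \<Rightarrow> real) \<Rightarrow> bool"
  where "cstar_norm_on D \<nu> \<longleftrightarrow>
    (\<forall>x\<in>D. 0 \<le> \<nu> x \<and> (\<nu> x = 0 \<longleftrightarrow> x = 0)) \<and>
    (\<forall>x\<in>D. \<forall>y\<in>D. \<nu> (x + y) \<le> \<nu> x + \<nu> y) \<and>
    (\<forall>c. \<forall>x\<in>D. \<nu> (scaleC c x) = cmod c * \<nu> x) \<and>
    (\<forall>x\<in>D. \<forall>y\<in>D. \<nu> (x * y) \<le> \<nu> x * \<nu> y) \<and>
    (\<forall>x\<in>D. \<nu> (adj x * x) = (\<nu> x)\<^sup>2)"

definition min_tensor_product ::
    "('a::cstar_algebra \<Rightarrow> 't::cstar_algebra) \<Rightarrow> ('b::cstar_algebra \<Rightarrow> 't) \<Rightarrow> bool"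
  where "min_tensor_product \<iota>\<^sub>1 \<iota>\<^sub>2 \<longleftrightarrow>
    cstar_hom \<iota>\<^sub>1 \<and> cstar_hom \<iota>\<^sub>2 \<and>
    (\<forall>a b. \<iota>\<^sub>1 a * \<iota>\<^sub>2 b = \<iota>\<^sub>2 b * \<iota>\<^sub>1 a) \<and>
    (\<forall>S f. finite S \<and> complex_vector.independent S \<and> (\<Sum>a\<in>S. \<iota>\<^sub>1 a * \<iota>\<^sub>2 (f a)) = 0
        \<longrightarrow> (\<forall>a\<in>S. f a = 0)) \<and>
    closure (complex_vector.span (elementary_tensors \<iota>\<^sub>1 \<iota>\<^sub>2)) = UNIV \<and>
    (\<forall>\<nu>. cstar_norm_on (complex_vector.span (elementary_tensors \<iota>\<^sub>1 \<iota>\<^sub>2)) \<nu> \<longrightarrow>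
        (\<forall>x\<in>complex_vector.span (elementary_tensors \<iota>\<^sub>1 \<iota>\<^sub>2). norm x \<le> \<nu> x))"

definition entry :: "'a^'n^'n \<Rightarrow> 'n \<times> 'n \<Rightarrow> 'a"
  where "entry u = (\<lambda>(i, j). u $ i $ j)"

text \<open>
  A closed subgroup \<open>G\<close> of \<open>O\<^sub>N\<^sup>+\<close>: the algebra \<^typ>\<open>'a\<close> is \<open>C(G)\<close>, \<open>u\<close> is the fundamental
  corepresentation and \<open>\<Delta>\<close> is the comultiplication, with values in the minimal tensor product
  of \<^typ>\<open>'a\<close> with itself. Counit and antipode are not listed: as the entries of \<open>u\<close> are self-adjoint
  and \<open>u\<close> is orthogonal, they exist automatically on the dense *-subalgebra generated by the
  entries. The algebra may be any C*-completion of the latter, not necessarily the full one.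
\<close>

definition quantum_subgroup_O_plus ::
    "'a::cstar_algebra^'n^'n \<Rightarrow> ('a \<Rightarrow> 't::cstar_algebra) \<Rightarrow> ('a \<Rightarrow> 't) \<Rightarrow> ('a \<Rightarrow> 't) \<Rightarrow> bool"
  where "quantum_subgroup_O_plus u \<iota>\<^sub>1 \<iota>\<^sub>2 \<Delta> \<longleftrightarrow>
    (\<forall>i j. adj (u $ i $ j) = u $ i $ j) \<and>
    orthogonal_matrix u \<and>
    closure (range (free_eval (entry u))) = UNIV \<and>
    min_tensor_product \<iota>\<^sub>1 \<iota>\<^sub>2 \<and>
    cstar_hom \<Delta> \<and>
    (\<forall>i j. \<Delta> (u $ i $ j) = (\<Sum>k\<in>UNIV. \<iota>\<^sub>1 (u $ i $ k) * \<iota>\<^sub>2 (u $ k $ j)))"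

text \<open>Inclusion \<open>G \<subset> H\<close> and equality \<open>G = H\<close>, where \<open>u\<close> and \<open>v\<close> are the fundamental
  corepresentations of \<open>G\<close> and \<open>H\<close>.\<close>

definition qincl :: "'a::cstar_algebra^'n^'n \<Rightarrow> 'b::cstar_algebra^'n^'n \<Rightarrow> bool"
  where "qincl u v \<longleftrightarrow> (\<exists>\<pi>. cstar_hom \<pi> \<and> surj \<pi> \<and> (\<forall>i j. \<pi> (v $ i $ j) = u $ i $ j))"

definition qequal :: "'a::cstar_algebra^'n^'n \<Rightarrow> 'b::cstar_algebra^'n^'n \<Rightarrow> bool"
  where "qequal u v \<longleftrightarrow> (\<exists>\<pi>. cstar_hom \<pi> \<and> bij \<pi> \<and> (\<forall>i j. \<pi> (v $ i $ j) = u $ i $ j))"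

text \<open>
  \<open>v\<close> and \<open>w\<close> are the fundamental corepresentations of the smaller and of the larger quantum
  group. The type \<^typ>\<open>'g\<close> carries \<open>C(G)\<close> and \<^typ>\<open>'t\<close> its tensor square; for the maximality of
  an inclusion both have to be left arbitrary.
\<close>

definition no_proper_intermediate ::
    "'g::cstar_algebra itself \<Rightarrow> 't::cstar_algebra itself \<Rightarrow>
      'k::cstar_algebra^'n^'n \<Rightarrow> 'h::cstar_algebra^'n^'n \<Rightarrow> bool"
  where "no_proper_intermediate _ _ v w \<longleftrightarrow>
    (\<forall>(u :: 'g^'n^'n) (\<iota>\<^sub>1 :: 'g \<Rightarrow> 't) \<iota>\<^sub>2 \<Delta>.
      quantum_subgroup_O_plus u \<iota>\<^sub>1 \<iota>\<^sub>2 \<Delta> \<and> qincl v u \<and> qincl u w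
        \<longrightarrow> qequal u v \<or> qequal u w)"


section \<open>The quantum groups \<open>O\<^sub>N\<^sup>*\<close> and \<open>B\<^sub>N\<^sup>\<circ>\<close>\<close>

definition gen_matrix :: "('n::finite \<times> 'n) free_star_algebra^'n^'n"
  where "gen_matrix = (\<chi> i j. gen (i, j))"

definition entries :: "'a^'n^'n \<Rightarrow> 'a set"
  where "entries A = {A $ i $ j | i j. True}"

definition O_plus_relations :: "('n::finite \<times> 'n) free_star_algebra set"
  where "O_plus_relations =
    {free_star x - x | x. x \<in> entries gen_matrix} \<union>
    entries (gen_matrix ** transpose gen_matrix - mat 1) \<union>
    entries (transpose gen_matrix ** gen_matrix - mat 1)"

lemma O_plus_relations_iff:
  fixes u :: "'a::cstar_algebra^'n^'n"
  shows "(\<forall>r\<in>O_plus_relations. free_eval (entry u) r = 0) \<longleftrightarrow>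
    (\<forall>i j. adj (u $ i $ j) = u $ i $ j) \<and> orthogonal_matrix u"
proof -
  have diff: "free_eval (entry u) (p - q) = free_eval (entry u) p - free_eval (entry u) q" for p q
    by (metis add_diff_cancel diff_add_cancel free_eval_add)
  have one: "free_eval (entry u) 1 = 1"
    using free_eval_const[of "entry u" 1] by (simp add: const_def scaleC_one single_one)
  have mat: "free_eval (entry u) (mat 1 $ i $ j) = mat 1 $ i $ j" for i j
    by (simp add: mat_def one free_eval_zero)
  have gen: "free_eval (entry u) (gen_matrix $ i $ j) = u $ i $ j" for i j
    by (simp add: gen_matrix_def free_eval_gen entry_def)
  have 1: "free_eval (entry u) ((gen_matrix ** transpose gen_matrix) $ i $ j) =
      (u ** transpose u) $ i $ j" for i j
    by (simp add: matrix_matrix_mult_def transpose_def free_eval_sum free_eval_mult gen)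
  have 2: "free_eval (entry u) ((transpose gen_matrix ** gen_matrix) $ i $ j) =
      (transpose u ** u) $ i $ j" for i j
    by (simp add: matrix_matrix_mult_def transpose_def free_eval_sum free_eval_mult gen)
  have "(\<forall>r\<in>O_plus_relations. free_eval (entry u) r = 0) \<longleftrightarrow>
    (\<forall>i j. free_eval (entry u) (free_star (gen_matrix $ i $ j) - gen_matrix $ i $ j) = 0) \<and>
    (\<forall>i j. free_eval (entry u) ((gen_matrix ** transpose gen_matrix - mat 1) $ i $ j) = 0) \<and>
    (\<forall>i j. free_eval (entry u) ((transpose gen_matrix ** gen_matrix - mat 1) $ i $ j) = 0)"
    unfolding O_plus_relations_def entries_def by blast
  also have "\<dots> \<longleftrightarrow> (\<forall>i j. adj (u $ i $ j) = u $ i $ j) \<and>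
      u ** transpose u = mat 1 \<and> transpose u ** u = mat 1"
    by (simp add: diff free_eval_star gen 1 2 mat vec_eq_iff)
  finally show ?thesis
    by (auto simp: orthogonal_matrix_def)
qed

definition B_plus_relations :: "('n::finite \<times> 'n) free_star_algebra set"
  where "B_plus_relations = O_plus_relations \<union> {(gen_matrix *v (\<chi> i. 1)) $ i - 1 | i. True}"

definition half_commutation :: "'x free_star_algebra set \<Rightarrow> 'x free_star_algebra set"
  where "half_commutation E = {a * b * c - c * b * a | a b c. a \<in> E \<and> b \<in> E \<and> c \<in> E}"

definition O_star_relations :: "('n::finite \<times> 'n) free_star_algebra set"
  where "O_star_relations = O_plus_relations \<union> half_commutation (entries gen_matrix)"

definition const_matrix :: "real^'n^'n \<Rightarrow> ('n::finite \<times> 'n) free_star_algebra^'n^'n"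
  where "const_matrix F = (\<chi> i j. const (complex_of_real (F $ i $ j)))"

text \<open>The index \<open>z\<close> plays the role of the index \<open>0\<close>.\<close>

definition B_circ_relations :: "'n \<Rightarrow> real^'n^'n \<Rightarrow> ('n::finite \<times> 'n) free_star_algebra set"
  where "B_circ_relations z F = B_plus_relations \<union>
    half_commutation {(const_matrix (transpose F) ** gen_matrix ** const_matrix F) $ i $ j | i j.
      i \<noteq> z \<and> j \<noteq> z}"

definition is_C_O_star :: "'a::cstar_algebra^'n^'n \<Rightarrow> bool"
  where "is_C_O_star w \<longleftrightarrow> universal_cstar_algebra O_star_relations (entry w)"

definition is_C_B_circ :: "'n \<Rightarrow> real^'n^'n \<Rightarrow> 'a::cstar_algebra^'n^'n \<Rightarrow> bool"
  where "is_C_B_circ z F w \<longleftrightarrow> universal_cstar_algebra (B_circ_relations z F) (entry w)"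

end

theory Submission
  imports Defs
begin

text \<open>
  The theorem says that a quantum group strictly between the classical and the half-liberated one
  does not exist. Both cases have one proof, carried out for self-adjoint elements \<open>v i j\<close> that
  half-commute (\<open>a b c = c b a\<close>) and form an orthogonal matrix whose indices run over a set \<open>I\<close>.
  For the orthogonal groups \<open>v\<close> is the fundamental corepresentation \<open>u\<close>. For the bistochastic
  groups \<open>F\<^sup>t u F\<close> fixes a basis vector, and \<open>v\<close> is the complementary corner.

  Half-commutation makes all products \<open>v a * v b\<close> commute. A character of the commutative algebra
  that they generate has the form \<open>v a * v b \<mapsto> z a * cnj (z b)\<close> for a unitary matrix \<open>z\<close>, which
  is unique up to a phase. The set of these matrices, the spectrum, is closed and determines the
  norms of all even polynomials. It is a group of a very special kind:
  \<^item> it contains the real orthogonal matrices, because the classical group is contained in the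
    quantum group;
  \<^item> it is stable under complex conjugation, because \<open>x \<mapsto> (\<Sum>k. v i k * x * v i k)\<close> reverses the
    two factors of every product \<open>v a * v b\<close>;
  \<^item> it is stable under products, because of the comultiplication. This needs that any two points
    \<open>z\<close>, \<open>z'\<close> of the spectrum come from one character of the tensor square, which is shown in
    \<open>joint_spectrum_full\<close> from the injectivity of the algebraic tensor product.

  A closed group of this kind consists of real matrices up to phases or is the whole unitary group
  (\<open>nonreal_imp_full\<close>). The proof is infinitesimal: a group element that is not real up to a phase
  conjugates some plane rotation into a nonreal tangent direction, from which permutations, sign
  changes and plane rotations produce all diagonal directions.

  In the first case the \<open>v i j\<close> commute, so that the norm of a polynomial in them is its maximum over
  orthogonal matrices, and the quantum group is the classical one. In the second case no half-commuting
  family can have larger norms on even polynomials. To pass to all polynomials, an element of the even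
  part that peaks at a nonreal point \<open>z\<close>, but not at its conjugate, is used to cut off odd parts
  (\<open>even_part_le\<close>). This bounds every norm in the universal algebra by a constant times the norm in
  the intermediate one. The constant disappears upon applying the bound to high powers of \<open>p\<^sup>* p\<close>
  (\<open>norm_le_by_power_trick\<close>). Hence the quotient map from the universal algebra is isometric and
  the quantum group is the half-liberated one.

  The only general theory behind this is that of commutative C*-algebras, in the form that every
  element attains its norm at some character (\<open>character_attains_norm\<close>).
\<close>

section \<open>Characters of commutative C*-algebras\<close>

lemma adj_power: "adj (x ^ n) = adj (x :: 'a::cstar_algebra) ^ n"
  by (induction n) (auto simp: adj_one adj_mult power_commutes)

locale commutative_star_subalgebra =
  fixes B :: "'a::cstar_algebra set"
  assumes one_mem: "1 \<in> B"
    and add_mem: "x \<in> B \<Longrightarrow> y \<in> B \<Longrightarrow> x + y \<in> B"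
    and mult_mem: "x \<in> B \<Longrightarrow> y \<in> B \<Longrightarrow> x * y \<in> B"
    and scaleC_mem: "x \<in> B \<Longrightarrow> scaleC c x \<in> B"
    and adj_mem: "x \<in> B \<Longrightarrow> adj x \<in> B"
    and commute: "x \<in> B \<Longrightarrow> y \<in> B \<Longrightarrow> x * y = y * x"
begin

definition character :: "('a \<Rightarrow> complex) \<Rightarrow> bool"
  where "character \<phi> \<longleftrightarrow>
    (\<forall>x\<in>B. \<forall>y\<in>B. \<phi> (x + y) = \<phi> x + \<phi> y) \<and>
    (\<forall>c. \<forall>x\<in>B. \<phi> (scaleC c x) = c * \<phi> x) \<and>
    (\<forall>x\<in>B. \<forall>y\<in>B. \<phi> (x * y) = \<phi> x * \<phi> y) \<and>
    (\<forall>x\<in>B. \<phi> (adj x) = cnj (\<phi> x)) \<and>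
    \<phi> 1 = 1 \<and>
    (\<forall>x\<in>B. cmod (\<phi> x) \<le> norm x)"

lemma
  assumes "character \<phi>"
  shows character_add: "x \<in> B \<Longrightarrow> y \<in> B \<Longrightarrow> \<phi> (x + y) = \<phi> x + \<phi> y"
    and character_scaleC: "x \<in> B \<Longrightarrow> \<phi> (scaleC c x) = c * \<phi> x"
    and character_mult: "x \<in> B \<Longrightarrow> y \<in> B \<Longrightarrow> \<phi> (x * y) = \<phi> x * \<phi> y"
    and character_adj: "x \<in> B \<Longrightarrow> \<phi> (adj x) = cnj (\<phi> x)"
    and character_one: "\<phi> 1 = 1"
    and character_le_norm: "x \<in> B \<Longrightarrow> cmod (\<phi> x) \<le> norm x"
  using assms unfolding character_def by blast+

definition cstar_seminorm_on :: "('a \<Rightarrow> real) \<Rightarrow> bool"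
  where "cstar_seminorm_on \<rho> \<longleftrightarrow>
    (\<forall>x. 0 \<le> \<rho> x) \<and>
    (\<forall>x\<in>B. \<rho> x \<le> norm x) \<and>
    (\<forall>x\<in>B. \<forall>y\<in>B. \<rho> (x + y) \<le> \<rho> x + \<rho> y) \<and>
    (\<forall>c. \<forall>x\<in>B. \<rho> (scaleC c x) = cmod c * \<rho> x) \<and>
    (\<forall>x\<in>B. \<forall>y\<in>B. \<rho> (x * y) \<le> \<rho> x * \<rho> y) \<and>
    (\<forall>x\<in>B. \<rho> (adj x * x) = (\<rho> x)\<^sup>2) \<and>
    \<rho> 1 = 1"

lemma
  assumes "cstar_seminorm_on \<rho>"
  shows seminorm_nonneg: "0 \<le> \<rho> x"
    and seminorm_le_norm: "x \<in> B \<Longrightarrow> \<rho> x \<le> norm x"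
    and seminorm_add: "x \<in> B \<Longrightarrow> y \<in> B \<Longrightarrow> \<rho> (x + y) \<le> \<rho> x + \<rho> y"
    and seminorm_scaleC: "x \<in> B \<Longrightarrow> \<rho> (scaleC c x) = cmod c * \<rho> x"
    and seminorm_mult: "x \<in> B \<Longrightarrow> y \<in> B \<Longrightarrow> \<rho> (x * y) \<le> \<rho> x * \<rho> y"
    and seminorm_square: "x \<in> B \<Longrightarrow> \<rho> (adj x * x) = (\<rho> x)\<^sup>2"
    and seminorm_one: "\<rho> 1 = 1"
  using assms unfolding cstar_seminorm_on_def by blast+

lemma cstar_seminorm_onI:
  assumes "\<And>x. 0 \<le> \<rho> x" "\<And>x. x \<in> B \<Longrightarrow> \<rho> x \<le> norm x"
    "\<And>x y. x \<in> B \<Longrightarrow> y \<in> B \<Longrightarrow> \<rho> (x + y) \<le> \<rho> x + \<rho> y"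
    "\<And>c x. x \<in> B \<Longrightarrow> \<rho> (scaleC c x) = cmod c * \<rho> x"
    "\<And>x y. x \<in> B \<Longrightarrow> y \<in> B \<Longrightarrow> \<rho> (x * y) \<le> \<rho> x * \<rho> y"
    "\<And>x. x \<in> B \<Longrightarrow> \<rho> (adj x * x) = (\<rho> x)\<^sup>2"
    "\<rho> 1 = 1"
  shows "cstar_seminorm_on \<rho>"
  using assms unfolding cstar_seminorm_on_def by blast

lemma power_mem: "x \<in> B \<Longrightarrow> x ^ n \<in> B"
  by (induction n) (auto simp: one_mem mult_mem)

lemma diff_mem: "x \<in> B \<Longrightarrow> y \<in> B \<Longrightarrow> x - y \<in> B"
  using add_mem[of x "scaleC (-1) y"] scaleC_mem[of y "-1"]
  by (metis complex_vector.scale_minus_left scaleC_one diff_conv_add_uminus)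

lemma adj_mult_self_mult:
  assumes "x \<in> B" "y \<in> B"
  shows "adj (x * y) * (x * y) = (adj x * x) * (adj y * y)"
proof -
  have "adj (x * y) * (x * y) = (adj y * (adj x * x)) * y"
    by (simp add: adj_mult mult.assoc)
  also have "adj y * (adj x * x) = (adj x * x) * adj y"
    by (intro commute adj_mem mult_mem assms)
  finally show ?thesis
    by (simp only: mult.assoc)
qed

lemma cstar_seminorm_on_norm: "cstar_seminorm_on norm"
  by (rule cstar_seminorm_onI)
    (auto simp: norm_triangle_ineq norm_scaleC norm_mult_ineq norm_adj_mult_self)

lemma seminorm_power_two_power:
  assumes \<rho>: "cstar_seminorm_on \<rho>" and b: "b \<in> B" "adj b = b"
  shows "\<rho> (b ^ (2 ^ k)) = \<rho> b ^ (2 ^ k)"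
proof (induction k)
  case (Suc k)
  have "\<rho> (b ^ (2 ^ Suc k)) = \<rho> (adj (b ^ (2 ^ k)) * b ^ (2 ^ k))"
    by (simp add: adj_power b mult_2 power_add)
  also have "\<dots> = (\<rho> (b ^ (2 ^ k)))\<^sup>2"
    using seminorm_square[OF \<rho>] power_mem b by blast
  finally show ?case
    by (simp add: Suc mult_2 power_add power2_eq_square)
qed simp

text \<open>
  For a supremum norm over some space, the limit is the supremum over the subset on which \<open>\<bar>b\<bar>\<close>
  is maximal. This shrinks the space without speaking of points.
\<close>

lemma localise_seminorm:
  assumes \<rho>: "cstar_seminorm_on \<rho>" and b: "b \<in> B" "adj b = b" and pos: "\<rho> b > 0"
  obtains \<sigma> where "cstar_seminorm_on \<sigma>" "\<And>x. \<sigma> x \<le> \<rho> x"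
    "\<And>x. x \<in> B \<Longrightarrow> (\<lambda>n. \<rho> (b ^ n * x) / \<rho> b ^ n) \<longlonglongrightarrow> \<sigma> x"
proof -
  define r where "r x n = \<rho> (b ^ n * x) / \<rho> b ^ n" for x n
  define \<sigma> where "\<sigma> x = (if x \<in> B then lim (r x) else \<rho> x)" for x
  have r0: "0 \<le> r x n" for x n
    using seminorm_nonneg[OF \<rho>] pos by (simp add: r_def)
  have dec: "decseq (r x)" if "x \<in> B" for x
  proof (rule decseq_SucI)
    fix n
    have "\<rho> (b ^ Suc n * x) \<le> \<rho> b * \<rho> (b ^ n * x)"
      using seminorm_mult[OF \<rho>, of b "b ^ n * x"] that b power_mem mult_mem
      by (simp add: mult.assoc)
    then show "r x (Suc n) \<le> r x n"
      using pos by (simp add: r_def field_simps)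
  qed
  have lim: "r x \<longlonglongrightarrow> \<sigma> x" if "x \<in> B" for x
  proof -
    have "convergent (r x)"
      using dec[OF that] r0 by (metis decseq_convergent convergentI)
    then show ?thesis using that by (simp add: \<sigma>_def convergent_LIMSEQ_iff)
  qed
  have lim2: "(\<lambda>n. r x (2 * n)) \<longlonglongrightarrow> \<sigma> x" if "x \<in> B" for x
    using LIMSEQ_subseq_LIMSEQ[OF lim[OF that], of "\<lambda>n. 2 * n"]
    by (simp add: strict_mono_def o_def)
  have le: "\<sigma> x \<le> \<rho> x" for x
  proof (cases "x \<in> B")
    case True
    have "\<sigma> x \<le> r x 0" using decseq_ge[OF dec lim] True by blast
    then show ?thesis by (simp add: r_def)
  qed (simp add: \<sigma>_def)
  have "cstar_seminorm_on \<sigma>"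
  proof (rule cstar_seminorm_onI)
    show "0 \<le> \<sigma> x" for x
      using LIMSEQ_le_const[OF lim, of x 0] r0 seminorm_nonneg[OF \<rho>]
      by (cases "x \<in> B") (auto simp: \<sigma>_def)
    show "\<sigma> x \<le> norm x" if "x \<in> B" for x
      using le[of x] seminorm_le_norm[OF \<rho> that] by linarith
    show "\<sigma> (x + y) \<le> \<sigma> x + \<sigma> y" if "x \<in> B" "y \<in> B" for x y
    proof (rule LIMSEQ_le[OF lim tendsto_add[OF lim lim]])
      show "\<exists>N. \<forall>n\<ge>N. r (x + y) n \<le> r x n + r y n"
        using seminorm_add[OF \<rho>] that b power_mem mult_mem pos
        by (auto simp: r_def distrib_left divide_right_mono simp flip: add_divide_distrib)
    qed (use that add_mem in auto)
    show "\<sigma> (scaleC c x) = cmod c * \<sigma> x" if "x \<in> B" for c x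
    proof (rule LIMSEQ_unique[OF lim])
      have "r (scaleC c x) = (\<lambda>n. cmod c * r x n)"
        using seminorm_scaleC[OF \<rho>] that b power_mem mult_mem
        by (auto simp: r_def mult_scaleC_right)
      then show "r (scaleC c x) \<longlonglongrightarrow> cmod c * \<sigma> x"
        using tendsto_mult_left[OF lim[OF that]] by simp
    qed (use that scaleC_mem in auto)
    show "\<sigma> (x * y) \<le> \<sigma> x * \<sigma> y" if xy: "x \<in> B" "y \<in> B" for x y
    proof (rule LIMSEQ_le[OF lim2 tendsto_mult[OF lim lim]])
      have "r (x * y) (2 * n) \<le> r x n * r y n" for n
      proof -
        have "b ^ (2 * n) * (x * y) = (b ^ n * x) * (b ^ n * y)"
          using commute[OF power_mem[OF b(1), of n] xy(1)] by (simp add: mult_2 power_add mult.assoc)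
             (simp flip: mult.assoc)
        then have "\<rho> (b ^ (2 * n) * (x * y)) \<le> \<rho> (b ^ n * x) * \<rho> (b ^ n * y)"
          using seminorm_mult[OF \<rho>] mult_mem power_mem b xy by simp
        then show ?thesis
          using pos by (simp add: r_def mult_2 power_add divide_right_mono)
      qed
      then show "\<exists>N. \<forall>n\<ge>N. r (x * y) (2 * n) \<le> r x n * r y n" by blast
    qed (use that mult_mem in auto)
    show "\<sigma> (adj x * x) = (\<sigma> x)\<^sup>2" if x: "x \<in> B" for x
    proof (rule LIMSEQ_unique[OF lim2])
      have "r (adj x * x) (2 * n) = (r x n)\<^sup>2" for n
      proof -
        have "b ^ (2 * n) * (adj x * x) = adj (b ^ n * x) * (b ^ n * x)"
          using commute[OF power_mem[OF b(1), of "n + n"] adj_mem[OF x]]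
          by (simp add: mult_2 power_add mult.assoc adj_mult adj_power b)
             (simp flip: mult.assoc)
        then show ?thesis
          using seminorm_square[OF \<rho>, of "b ^ n * x"] mult_mem power_mem b x
          by (simp add: r_def power_divide mult_2 power_add power2_eq_square)
      qed
      then show "(\<lambda>n. r (adj x * x) (2 * n)) \<longlonglongrightarrow> (\<sigma> x)\<^sup>2"
        using tendsto_power[OF lim[OF x], of 2] by simp
    qed (use that mult_mem adj_mem in auto)
    \<comment> \<open>\<open>\<rho> (b ^ n) = \<rho> b ^ n\<close> is only at hand for powers of two; a subsequence determines the limit\<close>
    show "\<sigma> 1 = 1"
    proof (rule LIMSEQ_unique)
      show "(\<lambda>k. r 1 (2 ^ k)) \<longlonglongrightarrow> \<sigma> 1"
        using LIMSEQ_subseq_LIMSEQ[OF lim[OF one_mem], of "\<lambda>k. 2 ^ k"]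
        by (simp add: strict_mono_def o_def)
      have "(\<lambda>k. r 1 (2 ^ k)) = (\<lambda>k. 1)"
        using seminorm_power_two_power[OF \<rho> b] pos by (simp add: r_def)
      then show "(\<lambda>k. r 1 (2 ^ k)) \<longlonglongrightarrow> 1" by simp
    qed
  qed
  with le lim that show thesis
    unfolding r_def[abs_def] by blast
qed

text \<open>
  The seminorm lives on points at which \<open>x\<close> attains its norm. Unlike the equation
  \<open>\<rho> x = norm x\<close>, the condition survives a further localisation.
\<close>

definition localised_at :: "'a \<Rightarrow> ('a \<Rightarrow> real) \<Rightarrow> bool"
  where "localised_at x \<rho> \<longleftrightarrow> cstar_seminorm_on \<rho> \<and> (\<forall>y\<in>B. \<rho> (x * y) = norm x * \<rho> y)"

lemma localised_at_exists:
  assumes x: "x \<in> B" and "x \<noteq> 0"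
  shows "\<exists>\<rho>. localised_at x \<rho>"
proof -
  let ?b = "adj x * x"
  have b: "?b \<in> B" "adj ?b = ?b" "norm ?b > 0"
    using assms by (auto simp: adj_mem mult_mem adj_mult adj_adj norm_adj_mult_self)
  obtain \<sigma> where \<sigma>: "cstar_seminorm_on \<sigma>"
    "\<And>y. y \<in> B \<Longrightarrow> (\<lambda>n. norm (?b ^ n * y) / norm ?b ^ n) \<longlonglongrightarrow> \<sigma> y"
    using localise_seminorm[OF cstar_seminorm_on_norm b] by metis
  have eq: "\<sigma> (?b * y) = norm ?b * \<sigma> y" if y: "y \<in> B" for y
  proof (rule LIMSEQ_unique[OF \<sigma>(2)])
    have "norm (?b ^ n * (?b * y)) / norm ?b ^ n
        = norm ?b * (norm (?b ^ Suc n * y) / norm ?b ^ Suc n)" for n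
      using b(3) by (simp add: power_Suc2 mult.assoc del: power_Suc)
    then show "(\<lambda>n. norm (?b ^ n * (?b * y)) / norm ?b ^ n) \<longlonglongrightarrow> norm ?b * \<sigma> y"
      by (simp only:) (rule tendsto_mult_left[OF LIMSEQ_Suc[OF \<sigma>(2)[OF y]]])
  qed (use b y mult_mem in auto)
  have "\<sigma> (x * y) = norm x * \<sigma> y" if y: "y \<in> B" for y
  proof -
    have "adj (x * y) * (x * y) = ?b * (adj y * y)"
      by (rule adj_mult_self_mult[OF x y])
    then have "(\<sigma> (x * y))\<^sup>2 = norm ?b * \<sigma> (adj y * y)"
      using eq[of "adj y * y"] seminorm_square[OF \<sigma>(1), of "x * y"] x y mult_mem adj_mem by simp
    also have "\<dots> = (norm x * \<sigma> y)\<^sup>2"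
      using y by (simp add: seminorm_square[OF \<sigma>(1)] norm_adj_mult_self power_mult_distrib)
    finally show ?thesis
      using seminorm_nonneg[OF \<sigma>(1)] by (simp add: power2_eq_iff_nonneg)
  qed
  with \<sigma>(1) show ?thesis
    unfolding localised_at_def by blast
qed

text \<open>
  Zorn's lemma. The pointwise infimum of a chain inherits all conditions, because along a chain the
  infima at any two points are limits along one common sequence.
\<close>

lemma minimal_localised_exists:
  assumes x: "x \<in> B" and "x \<noteq> 0"
  obtains \<rho> where "localised_at x \<rho>" "\<And>\<sigma>. localised_at x \<sigma> \<Longrightarrow> \<sigma> \<le> \<rho> \<Longrightarrow> \<sigma> = \<rho>"
proof -
  let ?A = "{\<rho>. localised_at x \<rho>}"
  let ?P = "\<lambda>\<rho> \<sigma> :: 'a \<Rightarrow> real. \<sigma> \<le> \<rho>"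
  have "\<exists>m\<in>?A. \<forall>a\<in>?A. ?P m a \<longrightarrow> a = m"
  proof (rule predicate_Zorn)
    show "partial_order_on ?A (relation_of ?P ?A)"
      by (rule partial_order_on_relation_ofI) auto
  next
    fix C assume C: "C \<in> Chains (relation_of ?P ?A)"
    show "\<exists>u\<in>?A. \<forall>a\<in>C. ?P a u"
    proof (cases "C = {}")
      case True
      then show ?thesis using localised_at_exists[OF assms] by auto
    next
      case False
      have CA: "localised_at x \<rho>" if "\<rho> \<in> C" for \<rho>
        using C that by (auto simp: Chains_def relation_of_def)
      have chain: "\<rho> \<le> \<sigma> \<or> \<sigma> \<le> \<rho>" if "\<rho> \<in> C" "\<sigma> \<in> C" for \<rho> \<sigma>
        using C that by (auto simp: Chains_def relation_of_def)
      have CS: "cstar_seminorm_on \<rho>" if "\<rho> \<in> C" for \<rho>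
        using CA[OF that] by (simp add: localised_at_def)
      define u where "u y = (INF \<rho>\<in>C. \<rho> y)" for y
      have bdd: "bdd_below ((\<lambda>\<rho>. \<rho> y) ` C)" for y
        using seminorm_nonneg[OF CS] by (auto intro!: bdd_belowI[of _ 0])
      have u_le: "u y \<le> \<rho> y" if "\<rho> \<in> C" for \<rho> y
        unfolding u_def using bdd that by (rule cINF_lower)
      have u_ge: "c \<le> u y" if "\<And>\<rho>. \<rho> \<in> C \<Longrightarrow> c \<le> \<rho> y" for c y
        unfolding u_def using False that by (rule cINF_greatest)
      have u0: "0 \<le> u y" for y
        using u_ge seminorm_nonneg[OF CS] by blast
      \<comment> \<open>along a chain the infima at two points are approached simultaneously\<close>
      have approx: "\<exists>\<rho>\<in>C. \<rho> y < u y + e \<and> \<rho> z < u z + e" if "e > 0" for y z e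
      proof -
        have "\<exists>\<rho>\<in>C. \<rho> y < u y + e" for y
          using that cINF_less_iff[OF False bdd, of y "u y + e"] by (simp add: u_def)
        then obtain \<rho> \<sigma> where "\<rho> \<in> C" "\<rho> y < u y + e" "\<sigma> \<in> C" "\<sigma> z < u z + e"
          by meson
        with chain[of \<rho> \<sigma>] show ?thesis
          by (metis le_fun_def order_le_less_trans)
      qed
      have lim_ex: "\<exists>s. (\<forall>n. s n \<in> C) \<and> (\<lambda>n. s n y) \<longlonglongrightarrow> u y \<and> (\<lambda>n. s n z) \<longlonglongrightarrow> u z" for y z
      proof -
        have "\<forall>n. \<exists>\<rho>. \<rho> \<in> C \<and> \<rho> y < u y + inverse (real (Suc n)) \<and> \<rho> z < u z + inverse (real (Suc n))"
          using approx[of "inverse (real (Suc _))" y z] by (metis inverse_positive_iff_positive of_nat_0_less_iff zero_less_Suc)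
        then obtain s where s: "\<And>n. s n \<in> C"
          "\<And>n. s n y < u y + inverse (real (Suc n))" "\<And>n. s n z < u z + inverse (real (Suc n))"
          by metis
        have "(\<lambda>n. s n v) \<longlonglongrightarrow> u v" if "\<And>n. s n v < u v + inverse (real (Suc n))" for v
        proof (rule tendsto_sandwich[of "\<lambda>n. u v" _ _ "\<lambda>n. u v + inverse (real (Suc n))"])
          show "(\<lambda>n. u v + inverse (real (Suc n))) \<longlonglongrightarrow> u v"
            using LIMSEQ_inverse_real_of_nat_add by blast
          show "\<forall>\<^sub>F n in sequentially. s n v \<le> u v + inverse (real (Suc n))"
            using that less_imp_le by (intro always_eventually allI) blast
        qed (use u_le s(1) in auto)
        with s show ?thesis by blast
      qed
      have "cstar_seminorm_on u"
      proof (rule cstar_seminorm_onI)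
        show "0 \<le> u y" for y by (rule u0)
        show "u y \<le> norm y" if "y \<in> B" for y
          using False u_le[of _ y] seminorm_le_norm[OF CS _] that
          by (meson all_not_in_conv order_trans)
        show "u (y + z) \<le> u y + u z" if "y \<in> B" "z \<in> B" for y z
        proof -
          obtain s where s: "\<And>n. s n \<in> C" "(\<lambda>n. s n y) \<longlonglongrightarrow> u y" "(\<lambda>n. s n z) \<longlonglongrightarrow> u z"
            using lim_ex by blast
          have "u (y + z) \<le> s n y + s n z" for n
            by (rule order_trans[OF u_le[OF s(1)] seminorm_add[OF CS[OF s(1)] that]])
          then show ?thesis
            by (intro LIMSEQ_le_const[OF tendsto_add[OF s(2,3)]]) blast
        qed
        show "u (y * z) \<le> u y * u z" if "y \<in> B" "z \<in> B" for y z
        proof -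
          obtain s where s: "\<And>n. s n \<in> C" "(\<lambda>n. s n y) \<longlonglongrightarrow> u y" "(\<lambda>n. s n z) \<longlonglongrightarrow> u z"
            using lim_ex by blast
          have "u (y * z) \<le> s n y * s n z" for n
            by (rule order_trans[OF u_le[OF s(1)] seminorm_mult[OF CS[OF s(1)] that]])
          then show ?thesis
            by (intro LIMSEQ_le_const[OF tendsto_mult[OF s(2,3)]]) blast
        qed
        show "u (scaleC c y) = cmod c * u y" if "y \<in> B" for c y
        proof -
          obtain s where s: "\<And>n. s n \<in> C" "(\<lambda>n. s n y) \<longlonglongrightarrow> u y"
            "(\<lambda>n. s n (scaleC c y)) \<longlonglongrightarrow> u (scaleC c y)"
            using lim_ex by blast
          have "(\<lambda>n. s n (scaleC c y)) = (\<lambda>n. cmod c * s n y)"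
            using seminorm_scaleC[OF CS[OF s(1)] that] by blast
          then show ?thesis
            using LIMSEQ_unique[OF s(3)] tendsto_mult_left[OF s(2), of "cmod c"] by simp
        qed
        show "u (adj y * y) = (u y)\<^sup>2" if "y \<in> B" for y
        proof -
          obtain s where s: "\<And>n. s n \<in> C" "(\<lambda>n. s n y) \<longlonglongrightarrow> u y"
            "(\<lambda>n. s n (adj y * y)) \<longlonglongrightarrow> u (adj y * y)"
            using lim_ex by blast
          have "(\<lambda>n. s n (adj y * y)) = (\<lambda>n. (s n y)\<^sup>2)"
            using seminorm_square[OF CS[OF s(1)] that] by blast
          then show ?thesis
            using LIMSEQ_unique[OF s(3)] tendsto_power[OF s(2), of 2] by simp
        qed
        obtain s where s: "\<And>n. s n \<in> C" "(\<lambda>n. s n 1) \<longlonglongrightarrow> u 1"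
          using lim_ex by blast
        then show "u 1 = 1"
          using seminorm_one[OF CS[OF s(1)]] by (simp add: LIMSEQ_const_iff)
      qed
      moreover have "u (x * y) = norm x * u y" if "y \<in> B" for y
      proof -
        obtain s where s: "\<And>n. s n \<in> C" "(\<lambda>n. s n y) \<longlonglongrightarrow> u y"
          "(\<lambda>n. s n (x * y)) \<longlonglongrightarrow> u (x * y)"
          using lim_ex by blast
        have "(\<lambda>n. s n (x * y)) = (\<lambda>n. norm x * s n y)"
          using CA[OF s(1)] that by (simp add: localised_at_def)
        then show ?thesis
          using LIMSEQ_unique[OF s(3)] tendsto_mult_left[OF s(2), of "norm x"] by simp
      qed
      ultimately have "localised_at x u"
        by (simp add: localised_at_def)
      then show ?thesis
        using u_le by (auto simp: le_fun_def)
    qed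
  qed
  then show thesis using that by blast
qed

text \<open>
  By minimality a localisation at \<open>b\<close> changes nothing, and it is multiplicative with respect to
  \<open>b\<close> by construction. The general case follows from \<open>b = adj y * y\<close>.
\<close>

lemma minimal_seminorm_mult:
  assumes loc: "localised_at x \<rho>" and min: "\<And>\<sigma>. localised_at x \<sigma> \<Longrightarrow> \<sigma> \<le> \<rho> \<Longrightarrow> \<sigma> = \<rho>"
    and x: "x \<in> B" and yz: "y \<in> B" "z \<in> B"
  shows "\<rho> (y * z) = \<rho> y * \<rho> z"
proof -
  have \<rho>: "cstar_seminorm_on \<rho>"
    using loc by (simp add: localised_at_def)
  have sq: "\<rho> (b * z) = \<rho> b * \<rho> z" if b: "b \<in> B" "adj b = b" and z: "z \<in> B" for b z
  proof (cases "\<rho> b = 0")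
    case True
    then show ?thesis
      using seminorm_mult[OF \<rho> b(1) z] seminorm_nonneg[OF \<rho>, of "b * z"] by simp
  next
    case False
    then have pos: "\<rho> b > 0" using seminorm_nonneg[OF \<rho>, of b] by simp
    obtain \<sigma> where \<sigma>: "cstar_seminorm_on \<sigma>" "\<And>x. \<sigma> x \<le> \<rho> x"
      "\<And>x. x \<in> B \<Longrightarrow> (\<lambda>n. \<rho> (b ^ n * x) / \<rho> b ^ n) \<longlonglongrightarrow> \<sigma> x"
      using localise_seminorm[OF \<rho> b pos] by metis
    have "\<sigma> (x * y) = norm x * \<sigma> y" if y: "y \<in> B" for y
    proof (rule LIMSEQ_unique[OF \<sigma>(3)])
      have "\<rho> (b ^ n * (x * y)) / \<rho> b ^ n = norm x * (\<rho> (b ^ n * y) / \<rho> b ^ n)" for n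
      proof -
        have "b ^ n * (x * y) = x * (b ^ n * y)"
          using commute[OF power_mem[OF b(1), of n] x] by (metis mult.assoc)
        then show ?thesis
          using loc y b power_mem mult_mem by (simp add: localised_at_def)
      qed
      then show "(\<lambda>n. \<rho> (b ^ n * (x * y)) / \<rho> b ^ n) \<longlonglongrightarrow> norm x * \<sigma> y"
        by (simp only:) (rule tendsto_mult_left[OF \<sigma>(3)[OF y]])
    qed (use x y mult_mem in auto)
    then have "\<sigma> = \<rho>"
      using \<sigma> min by (auto simp: localised_at_def le_fun_def)
    have "\<rho> (b * z) = \<rho> b * \<rho> z"
    proof (rule LIMSEQ_unique[OF \<sigma>(3)[unfolded \<open>\<sigma> = \<rho>\<close>]])
      have "\<rho> (b ^ n * (b * z)) / \<rho> b ^ n = \<rho> b * (\<rho> (b ^ Suc n * z) / \<rho> b ^ Suc n)" for n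
        using pos by (simp add: power_Suc2 mult.assoc del: power_Suc)
      then show "(\<lambda>n. \<rho> (b ^ n * (b * z)) / \<rho> b ^ n) \<longlonglongrightarrow> \<rho> b * \<rho> z"
        by (simp only:) (rule tendsto_mult_left[OF LIMSEQ_Suc[OF \<sigma>(3)[OF z, unfolded \<open>\<sigma> = \<rho>\<close>]]])
    qed (use b z mult_mem in auto)
    then show ?thesis .
  qed
  have "adj (y * z) * (y * z) = (adj y * y) * (adj z * z)"
    by (rule adj_mult_self_mult[OF yz])
  then have "(\<rho> (y * z))\<^sup>2 = \<rho> (adj y * y) * \<rho> (adj z * z)"
    using sq[of "adj y * y" "adj z * z"] seminorm_square[OF \<rho>, of "y * z"] yz mult_mem adj_mem
    by (simp add: adj_mult adj_adj)
  also have "\<dots> = (\<rho> y * \<rho> z)\<^sup>2"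
    using yz by (simp add: seminorm_square[OF \<rho>] power_mult_distrib)
  finally show ?thesis
    using seminorm_nonneg[OF \<rho>] by (simp add: power2_eq_iff_nonneg)
qed

text \<open>
  The elementary proof of the theorem of Gelfand and Mazur for a multiplicative norm. The distance of
  \<open>x\<close> from the scalar \<open>c\<close> attains a minimum \<open>m\<close>. If \<open>m\<close> were positive, the distance would be \<open>m\<close>
  on whole discs, and hence along a ray, but it grows.
\<close>

lemma minimal_seminorm_scalar:
  assumes \<rho>: "cstar_seminorm_on \<rho>"
    and mult: "\<And>y z. y \<in> B \<Longrightarrow> z \<in> B \<Longrightarrow> \<rho> (y * z) = \<rho> y * \<rho> z"
    and x: "x \<in> B"
  shows "\<exists>c. \<rho> (x - scaleC c 1) = 0"
proof -
  define f where "f c = \<rho> (x - scaleC c 1)" for c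
  have cmem: "scaleC c 1 \<in> B" for c
    by (simp add: one_mem scaleC_mem)
  have const: "\<rho> (scaleC c 1) = cmod c" for c
    using seminorm_scaleC[OF \<rho> one_mem] seminorm_one[OF \<rho>] by simp
  have f_step: "f c \<le> f d + cmod (d - c)" for c d
  proof -
    have "x - scaleC c 1 = (x - scaleC d 1) + scaleC (d - c) 1"
      by (simp add: complex_vector.scale_left_diff_distrib)
    then have "f c \<le> f d + \<rho> (scaleC (d - c) 1)"
      unfolding f_def using seminorm_add[OF \<rho>] x cmem diff_mem by metis
    then show ?thesis by (simp add: const)
  qed
  have f_large: "cmod c \<le> f c + \<rho> x" for c
  proof -
    have "scaleC c 1 = scaleC (-1) (x - scaleC c 1) + x"
      by (simp add: complex_vector.scale_minus_left scaleC_one)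
    then have "\<rho> (scaleC c 1) \<le> \<rho> (scaleC (-1) (x - scaleC c 1)) + \<rho> x"
      using seminorm_add[OF \<rho>] scaleC_mem diff_mem cmem x by metis
    then show ?thesis
      using seminorm_scaleC[OF \<rho> diff_mem[OF x cmem], of "-1" c] const by (simp add: f_def)
  qed
  have f0: "0 \<le> f c" for c
    by (simp add: f_def seminorm_nonneg[OF \<rho>])
  have "continuous_on UNIV f"
    unfolding continuous_on_iff
  proof (intro ballI allI impI)
    fix c e :: "complex" and \<epsilon> :: real assume "0 < \<epsilon>"
    moreover have "dist (f c') (f c) \<le> dist c' c" for c'
      using f_step[of c' c] f_step[of c c'] by (simp add: dist_norm norm_minus_commute abs_le_iff)
    ultimately show "\<exists>d>0. \<forall>c'\<in>UNIV. dist c' c < d \<longrightarrow> dist (f c') (f c) < \<epsilon>"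
      using le_less_trans by blast
  qed
  then have "continuous_on (cball 0 (2 * \<rho> x)) f"
    using continuous_on_subset by blast
  then obtain c0 where c0: "c0 \<in> cball 0 (2 * \<rho> x)" "\<And>c. c \<in> cball 0 (2 * \<rho> x) \<Longrightarrow> f c0 \<le> f c"
    using continuous_attains_inf[of "cball 0 (2 * \<rho> x)" f] seminorm_nonneg[OF \<rho>, of x] by auto
  have min: "f c0 \<le> f c" for c
  proof (cases "c \<in> cball 0 (2 * \<rho> x)")
    case False
    then have "\<rho> x \<le> f c" using f_large[of c] by simp
    moreover have "f c0 \<le> f 0" using c0(2)[of 0] seminorm_nonneg[OF \<rho>, of x] by simp
    ultimately show ?thesis by (simp add: f_def)
  qed (use c0 in auto)
  define m where "m = f c0"
  have "m = 0"
  proof (rule ccontr)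
    assume "m \<noteq> 0"
    then have m: "m > 0" using f0[of c0] by (simp add: m_def)
    \<comment> \<open>Any minimum spreads to the disc of radius \<open>m\<close>: with \<open>n = 2 ^ k\<close>, the factors of
      \<open>y ^ n - d ^ n\<close> other than \<open>y - d\<close> contribute at least \<open>m ^ (n - 1)\<close>.\<close>
    have step: "f (c + d) = m" if c: "f c = m" and d: "cmod d < m" for c d
    proof -
      define y where "y = x - scaleC c 1"
      have y: "y \<in> B" "\<rho> y = m"
        using c x cmem diff_mem by (auto simp: y_def f_def)
      have y_min: "m \<le> \<rho> (y - scaleC a 1)" for a
        using min[of "c + a"] by (simp add: m_def f_def y_def scaleC_add_left algebra_simps)
      have pw: "\<rho> (y ^ n) = m ^ n" for n
        using y mult power_mem seminorm_one[OF \<rho>] by (induction n) auto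
      have fac: "y ^ (2 * n) - scaleC (a\<^sup>2) 1 = (y ^ n - scaleC a 1) * (y ^ n - scaleC (- a) 1)" for n a
        by (simp add: algebra_simps mult_scaleC_left mult_scaleC_right scaleC_scaleC
            power_mult power2_eq_square mult_2 power_add)
      have fac': "\<rho> (y ^ (2 * n) - scaleC (a\<^sup>2) 1) =
          \<rho> (y ^ n - scaleC a 1) * \<rho> (y ^ n - scaleC (- a) 1)" for n a
        unfolding fac by (intro mult diff_mem power_mem y cmem)
      have lower: "m ^ (2 ^ k) \<le> \<rho> (y ^ (2 ^ k) - scaleC a 1)" for k a
      proof (induction k arbitrary: a)
        case 0
        then show ?case using y_min by simp
      next
        case (Suc k)
        have "\<rho> (y ^ (2 ^ Suc k) - scaleC a 1) =
            \<rho> (y ^ (2 ^ k) - scaleC (csqrt a) 1) * \<rho> (y ^ (2 ^ k) - scaleC (- csqrt a) 1)"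
          using fac'[of "2 ^ k" "csqrt a"] by simp
        also have "\<dots> \<ge> m ^ (2 ^ k) * m ^ (2 ^ k)"
          using mult_mono[OF Suc[of "csqrt a"] Suc[of "- csqrt a"]] m seminorm_nonneg[OF \<rho>] by simp
        finally show ?case by (simp add: mult_2 power_add)
      qed
      have upper: "\<rho> (y - scaleC d 1) * m ^ (2 ^ k) \<le> m * \<rho> (y ^ (2 ^ k) - scaleC (d ^ (2 ^ k)) 1)" for k
      proof (induction k)
        case (Suc k)
        have "\<rho> (y - scaleC d 1) * m ^ (2 ^ Suc k) = (\<rho> (y - scaleC d 1) * m ^ (2 ^ k)) * m ^ (2 ^ k)"
          by (simp add: mult_2 power_add)
        also have "\<dots> \<le> (m * \<rho> (y ^ (2 ^ k) - scaleC (d ^ (2 ^ k)) 1)) * \<rho> (y ^ (2 ^ k) - scaleC (- (d ^ (2 ^ k))) 1)"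
          using mult_mono[OF Suc lower[of k "- (d ^ (2 ^ k))"]] m seminorm_nonneg[OF \<rho>] by simp
        also have "\<dots> = m * \<rho> (y ^ (2 ^ Suc k) - scaleC (d ^ (2 ^ Suc k)) 1)"
          using fac'[of "2 ^ k" "d ^ (2 ^ k)"]
          by (simp add: power_mult[symmetric] mult.commute)
        finally show ?case .
      qed (use m in simp)
      have "f (c + d) \<le> m * (1 + (cmod d / m) ^ (2 ^ k))" for k
      proof -
        have "y ^ (2 ^ k) - scaleC (d ^ (2 ^ k)) 1 = y ^ (2 ^ k) + scaleC (- (d ^ (2 ^ k))) 1"
          by (simp add: complex_vector.scale_minus_left)
        then have "\<rho> (y ^ (2 ^ k) - scaleC (d ^ (2 ^ k)) 1) \<le> m ^ (2 ^ k) + cmod d ^ (2 ^ k)"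
          using seminorm_add[OF \<rho> power_mem[OF y(1)] cmem] pw const
          by (metis norm_minus_cancel norm_power)
        then have "f (c + d) * m ^ (2 ^ k) \<le> m * (m ^ (2 ^ k) + cmod d ^ (2 ^ k))"
          using upper[of k] m by (smt (verit) f_def y_def mult_left_mono diff_diff_eq scaleC_add_left)
        then show ?thesis
          using m by (simp add: power_divide field_simps)
      qed
      moreover have "(\<lambda>k. m * (1 + (cmod d / m) ^ (2 ^ k))) \<longlonglongrightarrow> m * (1 + 0)"
        using d m LIMSEQ_subseq_LIMSEQ[OF LIMSEQ_power_zero[of "cmod d / m"], of "\<lambda>k. 2 ^ k"]
        by (intro tendsto_intros) (simp add: strict_mono_def o_def)
      ultimately have "f (c + d) \<le> m"
        using LIMSEQ_le_const[of _ m] by (metis (lifting) mult_cancel_left1 add_cancel_left_right mult.right_neutral)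
      then show ?thesis using min[of "c + d"] by (simp add: m_def)
    qed
    have "f (c0 + of_nat k * of_real (m / 2)) = m" for k
    proof (induction k)
      case (Suc k)
      have "c0 + of_nat (Suc k) * of_real (m / 2) = (c0 + of_nat k * of_real (m / 2)) + of_real (m / 2)"
        by (simp only: of_nat_Suc distrib_right) simp
      then show ?case
        using step[OF Suc, of "of_real (m / 2)"] m by (simp only:) simp
    qed (simp add: m_def)
    then have *: "cmod (c0 + of_nat k * of_real (m / 2)) \<le> m + \<rho> x" for k
      using f_large by metis
    obtain k where k: "m + \<rho> x + cmod c0 < of_nat k * (m / 2)"
      using reals_Archimedean3[OF half_gt_zero[OF m]] by blast
    have "of_nat k * (m / 2) = cmod (of_nat k * of_real (m / 2))"
      using m by (simp add: norm_mult)
    also have "\<dots> \<le> cmod (c0 + of_nat k * of_real (m / 2)) + cmod c0"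
      by (metis add_diff_cancel_left' norm_triangle_ineq4)
    finally show False using *[of k] k by simp
  qed
  then show ?thesis by (auto simp: m_def f_def)
qed

text \<open>
  The Gelfand representation theorem. Among the C*-seminorms that are as large as possible at \<open>x\<close>
  there is a minimal one. Minimality makes it multiplicative, and an algebra with a multiplicative
  norm is the field of complex numbers, so that the seminorm is the absolute value of a character.
\<close>

theorem character_attains_norm:
  assumes x: "x \<in> B"
  obtains \<phi> where "character \<phi>" "cmod (\<phi> x) = norm x"
proof -
  define x' where "x' = (if x = 0 then 1 else x)"
  have x': "x' \<in> B" "x' \<noteq> 0" using x one_mem by (auto simp: x'_def)
  obtain \<rho> where loc: "localised_at x' \<rho>" and min: "\<And>\<sigma>. localised_at x' \<sigma> \<Longrightarrow> \<sigma> \<le> \<rho> \<Longrightarrow> \<sigma> = \<rho>"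
    using minimal_localised_exists[OF x'] by blast
  have \<rho>: "cstar_seminorm_on \<rho>"
    using loc by (simp add: localised_at_def)
  have mult: "\<rho> (y * z) = \<rho> y * \<rho> z" if "y \<in> B" "z \<in> B" for y z
    by (rule minimal_seminorm_mult[OF loc _ x'(1) that]) (rule min)
  have cmem: "scaleC c 1 \<in> B" for c
    by (simp add: one_mem scaleC_mem)
  have const: "\<rho> (scaleC c 1) = cmod c" for c
    using seminorm_scaleC[OF \<rho> one_mem] seminorm_one[OF \<rho>] by simp
  define \<phi> where "\<phi> y = (SOME c. \<rho> (y - scaleC c 1) = 0)" for y
  have \<phi>: "\<rho> (y - scaleC (\<phi> y) 1) = 0" if "y \<in> B" for y
    unfolding \<phi>_def by (rule someI_ex) (rule minimal_seminorm_scalar[OF \<rho> mult that])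
  have add0: "\<rho> (y + z) = 0" if "y \<in> B" "z \<in> B" "\<rho> y = 0" "\<rho> z = 0" for y z
    using seminorm_add[OF \<rho> that(1,2)] seminorm_nonneg[OF \<rho>, of "y + z"] that by simp
  have diff0: "\<rho> (y - z) = 0" if "y \<in> B" "z \<in> B" "\<rho> y = 0" "\<rho> z = 0" for y z
  proof -
    have "y - z = y + scaleC (-1) z"
      by (simp add: complex_vector.scale_minus_left scaleC_one)
    moreover have "\<rho> (scaleC (-1) z) = 0"
      using seminorm_scaleC[OF \<rho> that(2), of "-1"] that by simp
    ultimately show ?thesis
      using add0[OF that(1) scaleC_mem[OF that(2)] that(3)] by metis
  qed
  have unique: "\<phi> y = c" if "y \<in> B" "\<rho> (y - scaleC c 1) = 0" for y c
  proof -
    have "\<rho> ((y - scaleC c 1) - (y - scaleC (\<phi> y) 1)) = 0"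
      by (rule diff0[OF diff_mem[OF that(1) cmem] diff_mem[OF that(1) cmem] that(2) \<phi>[OF that(1)]])
    moreover have "(y - scaleC c 1) - (y - scaleC (\<phi> y) 1) = scaleC (\<phi> y - c) 1"
      by (simp add: complex_vector.scale_left_diff_distrib)
    ultimately have "cmod (\<phi> y - c) = 0"
      using const by metis
    then show ?thesis by simp
  qed
  have mod: "cmod (\<phi> y) = \<rho> y" if y: "y \<in> B" for y
  proof (rule antisym)
    have "scaleC (\<phi> y) 1 = y + scaleC (-1) (y - scaleC (\<phi> y) 1)"
      by (simp add: complex_vector.scale_minus_left scaleC_one)
    then have "\<rho> (scaleC (\<phi> y) 1) \<le> \<rho> y + \<rho> (scaleC (-1) (y - scaleC (\<phi> y) 1))"
      using seminorm_add[OF \<rho>] y scaleC_mem diff_mem cmem by metis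
    moreover have "\<rho> (scaleC (-1) (y - scaleC (\<phi> y) 1)) = 0"
      by (subst seminorm_scaleC[OF \<rho> diff_mem[OF y cmem]]) (simp add: \<phi>[OF y])
    ultimately show "cmod (\<phi> y) \<le> \<rho> y"
      using const[of "\<phi> y"] by linarith
    show "\<rho> y \<le> cmod (\<phi> y)"
      using seminorm_add[OF \<rho> diff_mem[OF y cmem] cmem, of "\<phi> y" "\<phi> y"] \<phi>[OF y] const by simp
  qed
  have "character \<phi>"
    unfolding character_def
  proof (intro conjI allI ballI)
    show "\<phi> (y + z) = \<phi> y + \<phi> z" if "y \<in> B" "z \<in> B" for y z
    proof (rule unique)
      have "y + z - scaleC (\<phi> y + \<phi> z) 1 = (y - scaleC (\<phi> y) 1) + (z - scaleC (\<phi> z) 1)"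
        by (simp add: scaleC_add_left)
      then show "\<rho> (y + z - scaleC (\<phi> y + \<phi> z) 1) = 0"
        by (simp only:) (intro add0 diff_mem cmem \<phi> that)
    qed (use that add_mem in auto)
    show "\<phi> (scaleC c y) = c * \<phi> y" if "y \<in> B" for c y
    proof (rule unique)
      have "scaleC c y - scaleC (c * \<phi> y) 1 = scaleC c (y - scaleC (\<phi> y) 1)"
        by (simp add: complex_vector.scale_right_diff_distrib scaleC_scaleC)
      then show "\<rho> (scaleC c y - scaleC (c * \<phi> y) 1) = 0"
        using that \<phi> diff_mem cmem seminorm_scaleC[OF \<rho>] by simp
    qed (use that scaleC_mem in auto)
    show "\<phi> (y * z) = \<phi> y * \<phi> z" if "y \<in> B" "z \<in> B" for y z
    proof (rule unique)
      have "y * z - scaleC (\<phi> y * \<phi> z) 1 =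
          (y - scaleC (\<phi> y) 1) * z + scaleC (\<phi> y) (z - scaleC (\<phi> z) 1)"
        by (simp add: complex_vector.scale_right_diff_distrib scaleC_scaleC left_diff_distrib mult_scaleC_left)
      moreover have "\<rho> ((y - scaleC (\<phi> y) 1) * z) = 0"
        using mult[OF diff_mem[OF that(1) cmem] that(2)] \<phi> that by simp
      moreover have "\<rho> (scaleC (\<phi> y) (z - scaleC (\<phi> z) 1)) = 0"
        using seminorm_scaleC[OF \<rho> diff_mem[OF that(2) cmem]] \<phi> that by simp
      ultimately show "\<rho> (y * z - scaleC (\<phi> y * \<phi> z) 1) = 0"
        by (simp only:) (intro add0 diff_mem cmem mult_mem scaleC_mem that)
    qed (use that mult_mem in auto)
    show "\<phi> (adj y) = cnj (\<phi> y)" if "y \<in> B" for y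
    proof (rule unique)
      let ?d = "y - scaleC (\<phi> y) 1"
      have d: "?d \<in> B" using that diff_mem cmem by blast
      have "(\<rho> (adj ?d))\<^sup>2 = \<rho> (?d * adj ?d)"
        using seminorm_square[OF \<rho> adj_mem[OF d]] by (simp add: adj_adj)
      also have "\<dots> = 0" using mult[OF d adj_mem[OF d]] \<phi>[OF that] by simp
      finally have "\<rho> (adj ?d) = 0" by simp
      then show "\<rho> (adj y - scaleC (cnj (\<phi> y)) 1) = 0"
        by (simp add: adj_diff adj_scaleC adj_one)
    qed (use that adj_mem in auto)
    show "\<phi> 1 = 1"
      by (rule unique) (use one_mem add0[of "1 - 1"] const[of 0] in \<open>auto simp: scaleC_one\<close>)
    show "cmod (\<phi> y) \<le> norm y" if "y \<in> B" for y
      using mod that seminorm_le_norm[OF \<rho>] by simp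
  qed
  moreover have "cmod (\<phi> x) = norm x"
  proof (cases "x = 0")
    case True
    then show ?thesis using mod[OF x] seminorm_le_norm[OF \<rho> x] seminorm_nonneg[OF \<rho>, of x] by simp
  next
    case False
    then show ?thesis
      using mod[OF x] loc one_mem seminorm_one[OF \<rho>] by (auto simp: localised_at_def x'_def dest: bspec[of _ _ 1])
  qed
  ultimately show thesis by (rule that)
qed

end

section \<open>*-homomorphisms are contractive\<close>

lemma neumann_inverse:
  fixes a :: "'a::{banach,real_normed_algebra_1}"
  assumes "norm a < 1"
  obtains k where "(1 - a) * k = 1" "k * (1 - a) = 1"
proof -
  have s: "summable (\<lambda>n. a ^ n)"
    using complete_algebra_summable_geometric[OF assms] .
  have split: "suminf (\<lambda>n. a ^ n) = 1 + suminf (\<lambda>n. a ^ Suc n)"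
    using suminf_split_head[OF s] by simp
  have "a * suminf (\<lambda>n. a ^ n) = suminf (\<lambda>n. a ^ Suc n)"
    using suminf_mult[OF s, of a] by simp
  moreover have "suminf (\<lambda>n. a ^ n) * a = suminf (\<lambda>n. a ^ Suc n)"
    using suminf_mult2[OF s, of a] by (simp add: power_commutes)
  ultimately show thesis
    using split by (intro that[of "suminf (\<lambda>n. a ^ n)"]) (simp_all add: algebra_simps)
qed

lemma
  assumes "cstar_hom f"
  shows cstar_hom_add: "f (x + y) = f x + f y"
    and cstar_hom_scaleC: "f (scaleC c x) = scaleC c (f x)"
    and cstar_hom_mult: "f (x * y) = f x * f y"
    and cstar_hom_adj: "f (adj x) = adj (f x)"
    and cstar_hom_one: "f 1 = 1"
  using assms by (auto simp: cstar_hom_def)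

lemma cstar_hom_zero: "cstar_hom f \<Longrightarrow> f 0 = 0"
  using cstar_hom_add[of f 0 0] by simp

lemma cstar_hom_diff: "cstar_hom f \<Longrightarrow> f (x - y) = f x - f y"
  using cstar_hom_add[of f "x - y" y] by simp

lemma cstar_hom_sum: "cstar_hom f \<Longrightarrow> f (sum g S) = (\<Sum>x\<in>S. f (g x))"
  by (induction S rule: infinite_finite_induct) (auto simp: cstar_hom_zero cstar_hom_add)

lemma commutes_mult:
  fixes z :: "'a::semigroup_mult"
  assumes "z * x = x * z" "z * y = y * z"
  shows "z * (x * y) = (x * y) * z"
  by (metis assms mult.assoc)

text \<open>
  For self-adjoint \<open>h\<close>, a character of the image of the bicommutant of \<open>h\<close> cannot map \<open>f h\<close> to a
  number \<open>c\<close> with \<open>cmod c > norm h\<close>, because \<open>h - c\<close> has an inverse in the bicommutant.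
\<close>

theorem cstar_hom_contractive:
  fixes f :: "'a::cstar_algebra \<Rightarrow> 'b::cstar_algebra"
  assumes f: "cstar_hom f"
  shows "norm (f x) \<le> norm x"
proof -
  have selfadj: "norm (f h) \<le> norm h" if h: "adj h = h" for h
  proof -
    \<comment> \<open>the bicommutant of \<open>h\<close>: it is commutative and closed under inverses\<close>
    define C where "C = {x. \<forall>y. y * h = h * y \<longrightarrow> x * y = y * x}"
    have Ch: "x * h = h * x" if "x \<in> C" for x
      using that by (auto simp: C_def)
    interpret commutative_star_subalgebra "f ` C"
    proof
      show "1 \<in> f ` C"
        using cstar_hom_one[OF f] by (intro image_eqI[of _ _ 1]) (auto simp: C_def)
      fix x y c assume "x \<in> f ` C"
      then obtain x' where x': "x = f x'" "x' \<in> C" by blast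
      show "scaleC c x \<in> f ` C"
        using x' by (intro image_eqI[of _ _ "scaleC c x'"])
          (auto simp: C_def cstar_hom_scaleC[OF f] mult_scaleC_left mult_scaleC_right)
      show "adj x \<in> f ` C"
      proof (intro image_eqI[of _ _ "adj x'"])
        have "adj x' * y = y * adj x'" if "y * h = h * y" for y
        proof -
          have "adj y * h = h * adj y"
            using arg_cong[OF that, of adj] h by (simp add: adj_mult)
          then have "x' * adj y = adj y * x'" using x' by (auto simp: C_def)
          then have "adj (x' * adj y) = adj (adj y * x')" by (rule arg_cong)
          then show ?thesis by (simp add: adj_mult adj_adj)
        qed
        then show "adj x' \<in> C" by (simp add: C_def)
      qed (simp add: x' cstar_hom_adj[OF f])
      assume "y \<in> f ` C"
      then obtain y' where y': "y = f y'" "y' \<in> C" by blast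
      show "x + y \<in> f ` C"
        using x' y' by (intro image_eqI[of _ _ "x' + y'"])
          (auto simp: C_def cstar_hom_add[OF f] algebra_simps)
      show "x * y \<in> f ` C"
      proof (intro image_eqI[of _ _ "x' * y'"])
        show "x' * y' \<in> C"
          unfolding C_def
        proof (intro CollectI allI impI)
          fix v assume "v * h = h * v"
          then have "v * x' = x' * v" "v * y' = y' * v"
            using x'(2) y'(2) by (auto simp: C_def)
          then show "(x' * y') * v = v * (x' * y')"
            by (rule commutes_mult[symmetric])
        qed
      qed (simp add: x' y' cstar_hom_mult[OF f])
      have "x' * y' = y' * x'"
        using x'(2) Ch[OF y'(2)] by (simp add: C_def)
      then show "x * y = y * x"
        using x' y' by (metis cstar_hom_mult[OF f])
    qed
    have "h \<in> C" by (simp add: C_def)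
    then obtain \<phi> where \<phi>: "character \<phi>" "cmod (\<phi> (f h)) = norm (f h)"
      using character_attains_norm by blast
    show ?thesis
    proof (rule ccontr)
      define c where "c = \<phi> (f h)"
      assume "\<not> norm (f h) \<le> norm h"
      then have c: "norm h < cmod c" by (simp add: c_def \<phi>)
      then have c0: "c \<noteq> 0" by auto
      have "norm (scaleC (inverse c) h) < 1"
        using c c0 by (simp add: norm_scaleC norm_inverse inverse_eq_divide[of "cmod c"])
      then obtain k where k: "(1 - scaleC (inverse c) h) * k = 1" "k * (1 - scaleC (inverse c) h) = 1"
        by (rule neumann_inverse)
      have kC: "k \<in> C"
        unfolding C_def
      proof (intro CollectI allI impI)
        fix y assume "y * h = h * y"
        then have *: "y * (1 - scaleC (inverse c) h) = (1 - scaleC (inverse c) h) * y"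
          by (simp add: algebra_simps mult_scaleC_left mult_scaleC_right)
        have "k * y = k * (y * (1 - scaleC (inverse c) h)) * k"
          using k by (simp add: mult.assoc)
        also have "\<dots> = y * k"
          unfolding * using k by (metis mult.assoc mult.left_neutral)
        finally show "k * y = y * k" .
      qed
      have mem: "1 - scaleC (inverse c) h \<in> C"
        using \<open>h \<in> C\<close> by (auto simp: C_def algebra_simps mult_scaleC_left mult_scaleC_right)
      have "\<phi> (f (1 - scaleC (inverse c) h)) = 0"
      proof -
        have "f (1 - scaleC (inverse c) h) = 1 + scaleC (- inverse c) (f h)"
          by (simp add: cstar_hom_diff[OF f] cstar_hom_one[OF f] cstar_hom_scaleC[OF f]
              complex_vector.scale_minus_left)
        then have "\<phi> (f (1 - scaleC (inverse c) h)) = \<phi> 1 + \<phi> (scaleC (- inverse c) (f h))"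
          using character_add[OF \<phi>(1) one_mem scaleC_mem] \<open>h \<in> C\<close> by (metis imageI)
        also have "\<dots> = 0"
          using character_scaleC[OF \<phi>(1), of "f h" "- inverse c"] \<open>h \<in> C\<close> c0
          by (simp add: character_one[OF \<phi>(1)] c_def)
        finally show ?thesis .
      qed
      then have "\<phi> (f (1 - scaleC (inverse c) h) * f k) = 0"
        using \<phi>(1) mem kC by (simp add: character_def)
      then have "\<phi> 1 = 0"
        using k cstar_hom_mult[OF f] cstar_hom_one[OF f] by metis
      then show False using \<phi>(1) by (simp add: character_def)
    qed
  qed
  have "(norm (f x))\<^sup>2 = norm (f (adj x * x))"
    by (simp add: cstar_hom_mult[OF f] cstar_hom_adj[OF f] norm_adj_mult_self)
  also have "\<dots> \<le> (norm x)\<^sup>2"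
    using selfadj[of "adj x * x"] by (simp add: adj_mult adj_adj norm_adj_mult_self)
  finally show ?thesis
    using power2_le_imp_le norm_ge_zero by blast
qed

lemma cstar_hom_continuous:
  assumes "cstar_hom h"
  shows "continuous_on UNIV h"
  unfolding continuous_on_iff
proof (intro ballI allI impI)
  fix x e assume "(0::real) < e"
  moreover have "dist (h y) (h x) \<le> dist y x" for y
    using cstar_hom_contractive[OF assms, of "y - x"] by (simp add: dist_norm cstar_hom_diff[OF assms])
  ultimately show "\<exists>d>0. \<forall>y\<in>UNIV. dist y x < d \<longrightarrow> dist (h y) (h x) < e"
    using le_less_trans by blast
qed

lemma cstar_hom_tendsto:
  assumes "cstar_hom h" and x: "(\<lambda>n :: nat. x n) \<longlonglongrightarrow> l"
  shows "(\<lambda>n. h (x n)) \<longlonglongrightarrow> h l"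
proof -
  have "(\<lambda>n. norm (x n - l)) \<longlonglongrightarrow> 0"
    using tendsto_norm[OF tendsto_diff[OF x tendsto_const[of l]]] by simp
  then have "(\<lambda>n. h (x n) - h l) \<longlonglongrightarrow> 0"
    by (rule Lim_null_comparison[rotated])
      (simp add: cstar_hom_diff[OF assms(1), symmetric] cstar_hom_contractive[OF assms(1)])
  then show ?thesis by (rule LIM_zero_cancel)
qed

section \<open>Evaluation of free polynomials\<close>

lemma free_eval_diff: "free_eval a (p - q) = free_eval a p - free_eval a q"
  by (metis add_diff_cancel diff_add_cancel free_eval_add)

lemma free_eval_one: "free_eval a 1 = 1"
  using free_eval_const[of a 1] by (simp add: const_def scaleC_one single_one)

lemma free_eval_const_mult: "free_eval a (const c * p) = scaleC c (free_eval a p)"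
  by (simp add: free_eval_mult free_eval_const mult_scaleC_left)

lemma free_eval_power: "free_eval a (p ^ n) = free_eval a p ^ n"
  by (induction n) (auto simp: free_eval_one free_eval_mult)

lemma free_eval_prod_list: "free_eval a (prod_list l) = prod_list (map (free_eval a) l)"
  by (induction l) (auto simp: free_eval_one free_eval_mult)

lemma cstar_hom_prod_list: "cstar_hom f \<Longrightarrow> f (prod_list l) = prod_list (map f l)"
  by (induction l) (auto simp: cstar_hom_one cstar_hom_mult)

lemma cstar_hom_free_eval:
  assumes "cstar_hom f"
  shows "f (free_eval a p) = free_eval (\<lambda>x. f (a x)) p"
proof -
  have "f (eval_word a w) = eval_word (\<lambda>x. f (a x)) w" for w
    by (simp add: eval_word_def cstar_hom_prod_list[OF assms] o_def case_prod_unfold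
        if_distrib[of f] cstar_hom_adj[OF assms] cong: if_cong)
  then show ?thesis
    by (simp add: free_eval_def cstar_hom_sum[OF assms] cstar_hom_scaleC[OF assms])
qed

text \<open>
  The homomorphism of free *-algebras with given values on the generators. It allows one family to be
  expressed by polynomials in another one, simultaneously in all algebras.
\<close>

definition substitute :: "('x \<Rightarrow> 'y free_star_algebra) \<Rightarrow> 'x free_star_algebra \<Rightarrow> 'y free_star_algebra"
  where "substitute \<sigma> p = (\<Sum>w\<in>Poly_Mapping.keys p. const (Poly_Mapping.lookup p w) *
    prod_list (map (\<lambda>(x, s). if s then free_star (\<sigma> x) else \<sigma> x) (letters w)))"

lemma free_eval_substitute: "free_eval a (substitute \<sigma> p) = free_eval (\<lambda>x. free_eval a (\<sigma> x)) p"
  by (simp add: substitute_def free_eval_sum free_eval_const_mult free_eval_prod_list o_def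
      case_prod_unfold if_distrib[of "free_eval a"] free_eval_star cong: if_cong)
    (simp add: free_eval_def[of "\<lambda>x. free_eval a (\<sigma> x)"] eval_word_def case_prod_unfold)

text \<open>
  Every polynomial is a sum of words, and words grow at their left end by a letter or its adjoint.
\<close>

lemma free_eval_induct [case_names scalar add gen]:
  assumes scalar: "\<And>c. P (const c)"
    and add: "\<And>p q. P p \<Longrightarrow> P q \<Longrightarrow> P (p + q)"
    and gen: "\<And>x p. P p \<Longrightarrow> P (gen x * p) \<and> P (free_star (gen x) * p)"
  shows "P p"
proof -
  have star_gen: "free_star (gen x) = Poly_Mapping.single (Word [(x, True)]) 1" for x
    by (simp add: free_star_def gen_def word_star_def)
  have "P (Poly_Mapping.single (Word l) c)" for l c
  proof (induction l)
    case Nil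
    then show ?case using scalar[of c] by (simp add: const_def zero_star_word_def)
  next
    case (Cons y l)
    obtain x s where y: "y = (x, s)" by (cases y)
    have "Poly_Mapping.single (Word (y # l)) c =
        (if s then free_star (gen x) else gen x) * Poly_Mapping.single (Word l) c"
      by (simp add: star_gen) (simp add: gen_def mult_single plus_star_word_def y)
    then show ?case using gen[OF Cons, of x] by (cases s) auto
  qed
  then have "P (Poly_Mapping.single w c)" for w c
    by (cases w) auto
  moreover have "P 0" using scalar[of 0] by (simp add: const_def)
  ultimately have "P (\<Sum>w\<in>S. Poly_Mapping.single w (Poly_Mapping.lookup p w))" for S
    by (induction S rule: infinite_finite_induct) (auto intro: add)
  then show ?thesis by (metis sum_singles)
qed

lemma norm_selfadj_power_two_power:
  fixes b :: "'a::cstar_algebra"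
  assumes "adj b = b"
  shows "norm (b ^ (2 ^ k)) = norm b ^ (2 ^ k)"
proof (induction k)
  case (Suc k)
  have "adj (b ^ n) = b ^ n" for n
    by (simp add: adj_power assms)
  then have "norm (b ^ (2 ^ Suc k)) = (norm (b ^ (2 ^ k)))\<^sup>2"
    using norm_adj_mult_self[of "b ^ (2 ^ k)"] by (simp add: mult_2 power_add)
  then show ?case by (simp add: Suc mult_2 power_add power2_eq_square)
qed simp

text \<open>
  In a C*-algebra \<open>norm (h ^ n) = norm h ^ n\<close> for \<open>h = adj x * x\<close> and \<open>n = 2 ^ k\<close>. The constant
  applies once to \<open>h ^ n\<close>, and its \<open>n\<close>-th root tends to one.
\<close>

theorem norm_le_by_power_trick:
  fixes a :: "'x \<Rightarrow> 'a::cstar_algebra" and b :: "'x \<Rightarrow> 'b::cstar_algebra"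
  assumes "\<And>p. norm (free_eval b p) \<le> C * norm (free_eval a p)"
  shows "norm (free_eval b p) \<le> norm (free_eval a p)"
proof (rule ccontr)
  define s t where "s = (norm (free_eval b p))\<^sup>2" and "t = (norm (free_eval a p))\<^sup>2"
  assume "\<not> norm (free_eval b p) \<le> norm (free_eval a p)"
  then have st: "t < s" "0 \<le> t"
    by (auto simp: s_def t_def power_strict_mono)
  let ?h = "free_star p * p"
  have pw: "norm (free_eval c (?h ^ (2 ^ k))) = ((norm (free_eval c p))\<^sup>2) ^ (2 ^ k)"
    for c :: "'x \<Rightarrow> 'c::cstar_algebra" and k
    by (simp add: free_eval_power norm_selfadj_power_two_power free_eval_mult free_eval_star
        adj_mult adj_adj norm_adj_mult_self)
  have le: "s ^ (2 ^ k) \<le> C * t ^ (2 ^ k)" for k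
    using assms[of "?h ^ (2 ^ k)"] by (simp add: pw s_def t_def)
  show False
  proof (cases "t = 0")
    case True
    then show False using le[of 0] st by simp
  next
    case False
    then have t: "t > 0" using st by simp
    have "(s / t) ^ (2 ^ k) \<le> C" for k
      using le[of k] t by (simp add: power_divide field_simps)
    moreover obtain n where "C < (s / t) ^ n"
      using real_arch_pow[of "s / t" C] st t by auto
    moreover have "(s / t) ^ n \<le> (s / t) ^ (2 ^ n)"
      using st t by (intro power_increasing) (auto intro: less_imp_le)
    ultimately show False by (meson not_less order_trans)
  qed
qed

lemma commutative_star_subalgebra_range:
  fixes a :: "'x \<Rightarrow> 'a::cstar_algebra"
  assumes comm: "\<And>x y. a x * a y = a y * a x" and comm_adj: "\<And>x y. a x * adj (a y) = adj (a y) * a x"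
  shows "commutative_star_subalgebra (range (free_eval a))"
proof
  have adj_adj_comm: "adj (a x) * adj (a y) = adj (a y) * adj (a x)" for x y
    using comm by (metis adj_mult)
  have letter: "z * free_eval a p = free_eval a p * z"
    if z: "\<And>x. z * a x = a x * z" "\<And>x. z * adj (a x) = adj (a x) * z" for z p
  proof (induction p rule: free_eval_induct)
    case (gen x p)
    then show ?case
      unfolding free_eval_mult free_eval_gen free_eval_star by (intro conjI commutes_mult z)
  qed (auto simp: free_eval_const mult_scaleC_left mult_scaleC_right free_eval_add algebra_simps)
  fix x y c
  assume "x \<in> range (free_eval a)"
  then obtain p where p: "x = free_eval a p" by blast
  show "scaleC c x \<in> range (free_eval a)"
    by (metis p free_eval_const_mult rangeI)
  show "adj x \<in> range (free_eval a)"
    by (metis p free_eval_star rangeI)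
  assume "y \<in> range (free_eval a)"
  then obtain q where q: "y = free_eval a q" by blast
  show "x + y \<in> range (free_eval a)"
    by (metis p q free_eval_add rangeI)
  show "x * y \<in> range (free_eval a)"
    by (metis p q free_eval_mult rangeI)
  have "a u * free_eval a q = free_eval a q * a u" for u
    by (rule letter) (use comm comm_adj in auto)
  moreover have "adj (a u) * free_eval a q = free_eval a q * adj (a u)" for u
    by (rule letter) (use adj_adj_comm comm_adj in auto)
  ultimately show "x * y = y * x"
    unfolding p q using letter[of "free_eval a q" p] by simp
next
  show "1 \<in> range (free_eval a)"
    by (metis free_eval_one rangeI)
qed

lemma (in commutative_star_subalgebra) character_free_eval:
  fixes \<phi> :: "'a \<Rightarrow> complex"
  assumes \<phi>: "character \<phi>" and a: "\<And>x. a x \<in> B"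
  shows "\<phi> (free_eval a p) = free_eval (\<lambda>x. \<phi> (a x)) p" "free_eval a p \<in> B"
proof -
  have "free_eval a p \<in> B \<and> \<phi> (free_eval a p) = free_eval (\<lambda>x. \<phi> (a x)) p"
  proof (induction p rule: free_eval_induct)
    case (scalar c)
    then show ?case
      using \<phi> one_mem scaleC_mem by (simp add: free_eval_const character_def scaleC_complex_def)
  next
    case (add p q)
    then show ?case
      using \<phi> add_mem by (simp add: free_eval_add character_def)
  next
    case (gen x p)
    then show ?case
      using \<phi> mult_mem a adj_mem
      by (simp add: free_eval_mult free_eval_gen free_eval_star character_def adj_complex_def)
  qed
  then show "\<phi> (free_eval a p) = free_eval (\<lambda>x. \<phi> (a x)) p" "free_eval a p \<in> B" by auto
qed

section \<open>Unitary matrices supported on a set of indices\<close>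

text \<open>
  The unit of the algebra of matrices supported on \<open>I\<close>. Matrices over a proper subset of the index
  type are represented by matrices that vanish outside of it, so that one type serves both the
  orthogonal and the bistochastic case.
\<close>

definition proj :: "'n set \<Rightarrow> 'a::zero_neq_one^'n^'n"
  where "proj I = (\<chi> i j. if i = j \<and> i \<in> I then 1 else 0)"

definition cadj :: "complex^'n^'n \<Rightarrow> complex^'n^'n"
  where "cadj z = (\<chi> i j. cnj (z $ j $ i))"

definition conj_mat :: "complex^'n^'n \<Rightarrow> complex^'n^'n"
  where "conj_mat z = (\<chi> i j. cnj (z $ i $ j))"

definition cmat :: "real^'n^'n \<Rightarrow> complex^'n^'n"
  where "cmat g = (\<chi> i j. complex_of_real (g $ i $ j))"

definition cscale :: "complex \<Rightarrow> complex^'n^'n \<Rightarrow> complex^'n^'n"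
  where "cscale c z = (\<chi> i j. c * z $ i $ j)"

definition unitary_on :: "'n set \<Rightarrow> (complex^'n^'n) set"
  where "unitary_on I = {z. z ** cadj z = proj I \<and> cadj z ** z = proj I}"

definition orthogonal_on :: "'n set \<Rightarrow> (real^'n^'n) set"
  where "orthogonal_on I = {g. g ** transpose g = proj I \<and> transpose g ** g = proj I}"

lemmas mat_entries = matrix_matrix_mult_def proj_def cadj_def conj_mat_def cmat_def cscale_def
  transpose_def

lemma matrix_eqI: "(\<And>i j. A $ i $ j = B $ i $ j) \<Longrightarrow> A = (B :: 'a^'n^'m)"
  by (simp add: vec_eq_iff)

lemma proj_mult_nth: "(proj I ** A) $ i $ j = (if i \<in> I then A $ i $ j else (0::'a::semiring_1))"
proof -
  have "(proj I ** A) $ i $ j = (\<Sum>k\<in>UNIV. if k = i then if i \<in> I then A $ i $ j else 0 else 0)"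
    unfolding matrix_matrix_mult_def proj_def
    by (simp only: vec_lambda_beta, intro sum.cong) auto
  then show ?thesis by simp
qed

lemma mult_proj_nth: "(A ** proj I) $ i $ j = (if j \<in> I then A $ i $ j else (0::'a::semiring_1))"
proof -
  have "(A ** proj I) $ i $ j = (\<Sum>k\<in>UNIV. if k = j then if j \<in> I then A $ i $ j else 0 else 0)"
    unfolding matrix_matrix_mult_def proj_def
    by (simp only: vec_lambda_beta, intro sum.cong) auto
  then show ?thesis by simp
qed

lemma cadj_cadj [simp]: "cadj (cadj z) = z"
  by (rule matrix_eqI) (simp add: cadj_def)

lemma cadj_mult: "cadj (y ** z) = cadj z ** cadj y"
  by (rule matrix_eqI) (simp add: mat_entries mult.commute)

lemma cadj_proj [simp]: "cadj (proj I) = proj I"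
  by (rule matrix_eqI) (auto simp: mat_entries)

lemma proj_proj [simp]: "proj I ** proj I = (proj I :: 'a::semiring_1^'n^'n)"
  by (rule matrix_eqI) (simp add: proj_mult_nth, simp add: proj_def)

lemma unitary_onD:
  assumes "z \<in> unitary_on I"
  shows "z ** cadj z = proj I" "cadj z ** z = proj I"
  using assms by (auto simp: unitary_on_def)

lemma cadj_unitary: "z \<in> unitary_on I \<Longrightarrow> cadj z \<in> unitary_on I"
  by (simp add: unitary_on_def)

lemma unitary_row_zero:
  assumes "z \<in> unitary_on I" "i \<notin> I"
  shows "z $ i $ j = 0"
proof -
  have "(\<Sum>k\<in>UNIV. z $ i $ k * cnj (z $ i $ k)) = (z ** cadj z) $ i $ i"
    by (simp add: mat_entries)
  also have "\<dots> = 0" using assms by (simp add: unitary_onD proj_def)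
  finally have "complex_of_real (\<Sum>k\<in>UNIV. (cmod (z $ i $ k))\<^sup>2) = 0"
    by (simp add: complex_norm_square del: of_real_power)
  then have "(\<Sum>k\<in>UNIV. (cmod (z $ i $ k))\<^sup>2) = 0"
    by (simp only: of_real_eq_0_iff)
  then show ?thesis by (simp add: sum_nonneg_eq_0_iff)
qed

lemma unitary_col_zero:
  assumes "z \<in> unitary_on I" "j \<notin> I"
  shows "z $ i $ j = 0"
  using unitary_row_zero[OF cadj_unitary[OF assms(1)] assms(2), of i] by (simp add: cadj_def)

lemma unitary_proj:
  assumes "z \<in> unitary_on I"
  shows "proj I ** z = z" "z ** proj I = z"
  using unitary_row_zero[OF assms] unitary_col_zero[OF assms]
  by (auto intro!: matrix_eqI simp: proj_mult_nth mult_proj_nth)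

lemma unitary_mult:
  assumes "y \<in> unitary_on I" "z \<in> unitary_on I"
  shows "y ** z \<in> unitary_on I"
proof -
  have "(y ** z) ** cadj (y ** z) = y ** (z ** cadj z) ** cadj y"
    "cadj (y ** z) ** (y ** z) = cadj z ** (cadj y ** y) ** z"
    by (simp_all add: cadj_mult matrix_mul_assoc)
  then show ?thesis
    using assms by (simp add: unitary_on_def unitary_proj unitary_proj[OF cadj_unitary])
qed

lemma conj_mat_mult: "conj_mat (y ** z) = conj_mat y ** conj_mat z"
  by (rule matrix_eqI) (simp add: mat_entries)

lemma cmat_mult: "cmat (g ** h) = cmat g ** cmat h"
  by (rule matrix_eqI) (simp add: mat_entries)

lemma cmat_proj: "cmat (proj I) = proj I"
  by (rule matrix_eqI) (auto simp: mat_entries)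

lemma cadj_cmat: "cadj (cmat g) = cmat (transpose g)"
  by (rule matrix_eqI) (simp add: mat_entries)

lemma cmat_unitary: "g \<in> orthogonal_on I \<Longrightarrow> cmat g \<in> unitary_on I"
  by (simp add: unitary_on_def orthogonal_on_def cadj_cmat cmat_mult[symmetric] cmat_proj)

lemma proj_orthogonal: "proj I \<in> orthogonal_on (I :: 'n::finite set)"
proof -
  have "transpose (proj I) = (proj I :: real^'n^'n)"
    by (rule matrix_eqI) (auto simp: mat_entries)
  then show ?thesis by (simp add: orthogonal_on_def)
qed

lemma norm_matrix_square: "(norm (A :: complex^'n^'m))\<^sup>2 = (\<Sum>i\<in>UNIV. \<Sum>j\<in>UNIV. (cmod (A $ i $ j))\<^sup>2)"
  by (simp add: norm_vec_def L2_set_def sum_nonneg)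

lemma norm_cadj: "norm (cadj z) = norm z"
proof -
  have "(norm (cadj z))\<^sup>2 = (norm z)\<^sup>2"
    unfolding norm_matrix_square by (subst sum.swap) (simp add: cadj_def)
  then show ?thesis by simp
qed

lemma norm_unitary_mult:
  fixes z A :: "complex^'n^'n"
  assumes z: "z \<in> unitary_on I" and A: "proj I ** A = A"
  shows "norm (z ** A) = norm A"
proof -
  have sq: "complex_of_real ((norm A)\<^sup>2) = trace (cadj A ** A)" for A :: "complex^'n^'n"
    unfolding norm_matrix_square trace_def
    by (subst sum.swap) (simp add: mat_entries complex_norm_square mult.commute del: of_real_power)
  have "cadj (z ** A) ** (z ** A) = cadj A ** (cadj z ** z) ** A"
    by (simp add: cadj_mult matrix_mul_assoc)
  also have "\<dots> = cadj A ** A"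
    using A by (simp add: unitary_onD[OF z] matrix_mul_assoc[symmetric])
  finally have "complex_of_real ((norm (z ** A))\<^sup>2) = complex_of_real ((norm A)\<^sup>2)"
    by (simp only: sq)
  then have "(norm (z ** A))\<^sup>2 = (norm A)\<^sup>2"
    by (simp only: of_real_eq_iff)
  then show ?thesis by simp
qed

lemma norm_mult_unitary:
  fixes z A :: "complex^'n^'n"
  assumes z: "z \<in> unitary_on I" and A: "A ** proj I = A"
  shows "norm (A ** z) = norm A"
proof -
  have "proj I ** cadj A = cadj A"
    using A by (metis cadj_mult cadj_proj)
  then show ?thesis
    using norm_unitary_mult[OF cadj_unitary[OF z], of "cadj A"] by (metis cadj_mult norm_cadj)
qed

lemma matrix_mult_diff:
  fixes A B C :: "'a::ring_1^'n^'n"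
  shows "A ** (B - C) = A ** B - A ** C" "(B - C) ** A = B ** A - C ** A"
  by (auto intro!: matrix_eqI simp: mat_entries algebra_simps sum_subtractf)

lemma tendsto_matrixI:
  fixes A :: "'b \<Rightarrow> 'a::topological_space^'n^'m"
  assumes "\<And>i j. ((\<lambda>x. A x $ i $ j) \<longlongrightarrow> L $ i $ j) F"
  shows "(A \<longlongrightarrow> L) F"
  by (intro vec_tendstoI assms)

lemma tendsto_entry:
  "(A \<longlongrightarrow> L) F \<Longrightarrow> ((\<lambda>x. A x $ i $ j) \<longlongrightarrow> L $ i $ j) F"
  by (intro tendsto_vec_nth)

lemma tendsto_matrix_mult:
  fixes A B :: "'b \<Rightarrow> complex^'n^'n"
  assumes "(A \<longlongrightarrow> L) F" "(B \<longlongrightarrow> M) F"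
  shows "((\<lambda>x. A x ** B x) \<longlongrightarrow> L ** M) F"
  by (rule tendsto_matrixI) (simp add: matrix_matrix_mult_def, intro tendsto_intros tendsto_entry assms)

lemma tendsto_cadj:
  "(A \<longlongrightarrow> L) F \<Longrightarrow> ((\<lambda>x. cadj (A x)) \<longlongrightarrow> cadj L) F"
  by (rule tendsto_matrixI) (simp add: cadj_def, intro tendsto_intros tendsto_entry)

lemma tendsto_conj_mat:
  "(A \<longlongrightarrow> L) F \<Longrightarrow> ((\<lambda>x. conj_mat (A x)) \<longlongrightarrow> conj_mat L) F"
  by (rule tendsto_matrixI) (simp add: conj_mat_def, intro tendsto_intros tendsto_entry)

lemma bounded_unitary: "bounded (unitary_on (I :: 'n::finite set))"
proof -
  have "norm z \<le> norm (proj I :: complex^'n^'n)" if "z \<in> unitary_on I" for z :: "complex^'n^'n"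
    using norm_unitary_mult[OF that, of "proj I"] unitary_proj[OF that] by simp
  then show ?thesis unfolding bounded_iff by blast
qed

primrec mpow :: "'n set \<Rightarrow> complex^'n^'n \<Rightarrow> nat \<Rightarrow> complex^'n^'n"
  where "mpow I z 0 = proj I" | "mpow I z (Suc n) = z ** mpow I z n"

lemma mpow_add:
  assumes "z \<in> unitary_on I"
  shows "mpow I z (m + n) = mpow I z m ** mpow I z n"
proof (induction m)
  case 0
  have "proj I ** mpow I z n = mpow I z n"
    by (cases n) (simp_all add: matrix_mul_assoc unitary_proj[OF assms])
  then show ?case by simp
qed (simp add: matrix_mul_assoc)

lemma mpow_unitary:
  assumes "z \<in> unitary_on I"
  shows "mpow I z n \<in> unitary_on I"
  by (induction n) (simp_all add: unitary_mult assms, simp add: unitary_on_def)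

text \<open>
  The norm is the Frobenius norm, for which multiplication by unitary matrices is isometric.
\<close>

lemma norm_mpow_diff:
  assumes y: "y \<in> unitary_on I" and z: "z \<in> unitary_on I"
  shows "norm (mpow I y n - mpow I z n) \<le> real n * norm (y - z)"
proof (induction n)
  case (Suc n)
  have "mpow I y (Suc n) - mpow I z (Suc n) =
      y ** (mpow I y n - mpow I z n) + (y - z) ** mpow I z n"
    by (simp add: matrix_mult_diff)
  then have "norm (mpow I y (Suc n) - mpow I z (Suc n)) \<le>
      norm (y ** (mpow I y n - mpow I z n)) + norm ((y - z) ** mpow I z n)"
    using norm_triangle_ineq by metis
  also have "norm (y ** (mpow I y n - mpow I z n)) = norm (mpow I y n - mpow I z n)"
    using mpow_unitary y z
    by (intro norm_unitary_mult[OF y]) (simp add: matrix_mult_diff unitary_proj[OF mpow_unitary])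
  also have "norm ((y - z) ** mpow I z n) = norm (y - z)"
    by (intro norm_mult_unitary[OF mpow_unitary[OF z]]) (simp add: matrix_mult_diff unitary_proj y z)
  finally show ?case using Suc by (simp add: algebra_simps)
qed simp

text \<open>
  The matrix with rows \<open>(a, b)\<close> and \<open>(c, d)\<close> on the coordinates \<open>i\<close>, \<open>j\<close>, and the unit on the other
  coordinates from \<open>I\<close>. Rotations, transpositions and changes of sign all have this form.
\<close>

definition plane :: "'n set \<Rightarrow> 'n \<Rightarrow> 'n \<Rightarrow> 'a \<Rightarrow> 'a \<Rightarrow> 'a \<Rightarrow> 'a \<Rightarrow> 'a::zero_neq_one^'n^'n"
  where "plane I i j a b c d = (\<chi> k l. if k = i \<and> l = i then a else if k = i \<and> l = j then b
    else if k = j \<and> l = i then c else if k = j \<and> l = j then d else if k = l \<and> k \<in> I then 1 else 0)"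

lemma plane_mult_nth:
  fixes M :: "'a::semiring_1^'n^'n"
  assumes ij: "i \<in> I" "j \<in> I" "i \<noteq> j"
  shows "(plane I i j a b c d ** M) $ k $ l =
    (if k = i then a * M $ i $ l + b * M $ j $ l
     else if k = j then c * M $ i $ l + d * M $ j $ l
     else if k \<in> I then M $ k $ l else 0)"
proof -
  have "(plane I i j a b c d ** M) $ k $ l = (\<Sum>m\<in>UNIV.
      (if m = i then (if k = i then a else if k = j then c else 0) * M $ i $ l else 0) +
      (if m = j then (if k = i then b else if k = j then d else 0) * M $ j $ l else 0) +
      (if m = k then (if k \<noteq> i \<and> k \<noteq> j \<and> k \<in> I then M $ k $ l else 0) else 0))"
    unfolding matrix_matrix_mult_def plane_def using ij
    by (simp only: vec_lambda_beta, intro sum.cong) auto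
  also have "\<dots> = (if k = i then a else if k = j then c else 0) * M $ i $ l +
      (if k = i then b else if k = j then d else 0) * M $ j $ l +
      (if k \<noteq> i \<and> k \<noteq> j \<and> k \<in> I then M $ k $ l else 0)"
    by (simp only: sum.distrib sum.delta finite_UNIV) simp
  also have "\<dots> = (if k = i then a * M $ i $ l + b * M $ j $ l
     else if k = j then c * M $ i $ l + d * M $ j $ l
     else if k \<in> I then M $ k $ l else 0)"
    using ij by (cases "k = i"; cases "k = j") simp_all
  finally show ?thesis .
qed

lemma transpose_plane:
  assumes "i \<noteq> j"
  shows "transpose (plane I i j a b c d) = plane I i j a c b d"
proof (rule matrix_eqI)
  fix k l
  show "transpose (plane I i j a b c d) $ k $ l = plane I i j a c b d $ k $ l"
    unfolding transpose_def plane_def vec_lambda_beta using assms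
    by (cases "k = l"; cases "k = i"; cases "k = j"; cases "l = i"; cases "l = j") simp_all
qed

lemma cmat_plane: "cmat (plane I i j a b c d) = plane I i j a b c d"
  unfolding cmat_def plane_def by (rule matrix_eqI) (simp only: vec_lambda_beta if_distrib[of complex_of_real] of_real_0 of_real_1)

lemma mult_plane_nth:
  fixes M :: "'a::comm_semiring_1^'n^'n"
  assumes ij: "i \<in> I" "j \<in> I" "i \<noteq> j"
  shows "(M ** plane I i j a b c d) $ k $ l =
    (if l = i then M $ k $ i * a + M $ k $ j * c
     else if l = j then M $ k $ i * b + M $ k $ j * d
     else if l \<in> I then M $ k $ l else 0)"
proof -
  have "M ** plane I i j a b c d = transpose (plane I i j a c b d ** transpose M)"
    using ij by (simp add: matrix_transpose_mul transpose_plane transpose_transpose)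
  then show ?thesis
    by (simp add: transpose_def plane_mult_nth[OF ij] mult.commute)
qed

lemma plane_orthogonal:
  fixes a b c d :: real
  assumes ij: "i \<in> I" "j \<in> I" "i \<noteq> j"
    and "a * a + b * b = 1" "c * c + d * d = 1" "a * c + b * d = 0"
      "a * a + c * c = 1" "b * b + d * d = 1" "a * b + c * d = 0"
  shows "plane I i j a b c d \<in> orthogonal_on I"
proof -
  have facts: "a * c + b * d = 0" "c * a + d * b = 0" "a * b + c * d = 0" "b * a + d * c = 0"
    using assms(6,9) by (simp_all only: mult.commute[of c a] mult.commute[of d b]
        mult.commute[of b a] mult.commute[of d c])
  have 1: "(plane I i j a b c d ** plane I i j a c b d) $ k $ l = proj I $ k $ l" for k l
    using ij unfolding plane_mult_nth[OF ij] unfolding plane_def proj_def vec_lambda_beta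
    by (cases "k = l"; cases "k = i"; cases "k = j"; cases "l = i"; cases "l = j")
      (simp_all add: facts assms(4,5,7,8))
  have 2: "(plane I i j a c b d ** plane I i j a b c d) $ k $ l = proj I $ k $ l" for k l
    using ij unfolding plane_mult_nth[OF ij] unfolding plane_def proj_def vec_lambda_beta
    by (cases "k = l"; cases "k = i"; cases "k = j"; cases "l = i"; cases "l = j")
      (simp_all add: facts assms(4,5,7,8))
  show ?thesis
    by (simp add: orthogonal_on_def transpose_plane[OF ij(3)] matrix_eqI[OF 1] matrix_eqI[OF 2])
qed

lemma derivative_along_inverses:
  fixes f :: "'a::real_normed_field \<Rightarrow> 'a"
  assumes "(f has_field_derivative D) (at 0)"
  shows "(\<lambda>n. of_nat n * (f (inverse (of_nat n)) - f 0)) \<longlonglongrightarrow> D"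
proof -
  have "((\<lambda>h. (f (0 + h) - f 0) / h) \<longlongrightarrow> D) (at 0)"
    using assms by (simp add: has_field_derivative_iff)
  moreover have "filterlim (\<lambda>n. inverse (of_nat n) :: 'a) (at 0) sequentially"
    by (rule filterlim_atI[OF lim_inverse_n])
      (auto intro: eventually_mono[OF eventually_gt_at_top[of "0::nat"]])
  ultimately have "((\<lambda>n. (f (0 + inverse (of_nat n)) - f 0) / inverse (of_nat n)) \<longlongrightarrow> D) sequentially"
    by (rule filterlim_compose)
  then show ?thesis by (simp add: divide_inverse mult.commute)
qed

section \<open>Closed conjugation-invariant groups of unitary matrices\<close>

definition diag :: "('n \<Rightarrow> 'a::zero) \<Rightarrow> 'a^'n^'n"
  where "diag d = (\<chi> k l. if k = l then d k else 0)"

lemma diag_mult_nth: "(diag d ** M) $ k $ l = d k * (M $ k $ l :: 'a::semiring_1)"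
proof -
  have "(diag d ** M) $ k $ l = (\<Sum>m\<in>UNIV. if m = k then d k * M $ k $ l else 0)"
    unfolding matrix_matrix_mult_def diag_def by (simp only: vec_lambda_beta, intro sum.cong) auto
  then show ?thesis by simp
qed

lemma mult_diag_nth: "(M ** diag d) $ k $ l = (M $ k $ l :: 'a::semiring_1) * d l"
proof -
  have "(M ** diag d) $ k $ l = (\<Sum>m\<in>UNIV. if m = l then M $ k $ l * d l else 0)"
    unfolding matrix_matrix_mult_def diag_def by (simp only: vec_lambda_beta, intro sum.cong) auto
  then show ?thesis by simp
qed

lemma matrix_mult_scaleR:
  fixes A B :: "complex^'n^'n"
  shows "A ** (r *\<^sub>R B) = r *\<^sub>R (A ** B)" "(r *\<^sub>R A) ** B = r *\<^sub>R (A ** B)"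
  by (auto intro!: matrix_eqI simp: matrix_matrix_mult_def scaleR_sum_right)

definition imat :: "real^'n^'n \<Rightarrow> complex^'n^'n"
  where "imat Y = cscale \<i> (cmat Y)"

definition phase_at :: "'n set \<Rightarrow> 'n \<Rightarrow> real \<Rightarrow> complex^'n^'n"
  where "phase_at I i \<theta> = diag (\<lambda>k. if k \<in> I then if k = i then cis \<theta> else 1 else 0)"

lemma phase_at_mult: "phase_at I i \<theta> ** phase_at I i \<theta>' = phase_at I i (\<theta> + \<theta>')"
proof (rule matrix_eqI)
  show "(phase_at I i \<theta> ** phase_at I i \<theta>') $ k $ l = phase_at I i (\<theta> + \<theta>') $ k $ l" for k l
    unfolding phase_at_def diag_mult_nth by (simp add: diag_def cis_mult)
qed

lemma phase_at_zero: "phase_at I i 0 = proj I"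
  by (rule matrix_eqI) (simp add: phase_at_def diag_def proj_def)

lemma cadj_phase_at: "cadj (phase_at I i \<theta>) = phase_at I i (- \<theta>)"
  by (rule matrix_eqI) (auto simp: phase_at_def diag_def cadj_def cis_cnj)

lemma phase_at_unitary: "phase_at I i \<theta> \<in> unitary_on I"
  by (simp add: unitary_on_def cadj_phase_at phase_at_mult phase_at_zero)

lemma mpow_phase_at: "mpow I (phase_at I i \<theta>) n = phase_at I i (real n * \<theta>)"
  by (induction n) (simp_all add: phase_at_zero phase_at_mult algebra_simps)

definition matrix_unit :: "'n \<Rightarrow> real^'n^'n"
  where "matrix_unit i = diag (\<lambda>k. if k = i then 1 else 0)"

text \<open>
  The first-order condition for a function on a group that is maximal at the unit, along a rotation.
\<close>

lemma sine_term_zero_at_max: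
  assumes "\<And>\<theta>. a * (cos \<theta> - 1) + b * sin \<theta> \<le> (0::real)"
  shows "b = 0"
proof (rule DERIV_local_max)
  show "((\<lambda>\<theta>. a * (cos \<theta> - 1) + b * sin \<theta>) has_field_derivative b) (at 0)"
    by (auto intro!: derivative_eq_intros)
  show "\<forall>y. \<bar>0 - y\<bar> < (1::real) \<longrightarrow> a * (cos y - 1) + b * sin y \<le> a * (cos 0 - 1) + b * sin 0"
    using assms by simp
qed simp

text \<open>
  Suppose that \<open>z J z\<^sup>*\<close> is real for all elementary antisymmetric matrices \<open>J\<close>. Then the symmetric
  unitary matrix \<open>s = z\<^sup>t z\<close> commutes with all of them and is therefore a scalar, which means that
  \<open>z\<close> is a scalar multiple of its complex conjugate.
\<close>

lemma nonreal_entry_exists: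
  fixes z :: "complex^'n::finite^'n"
  assumes z: "z \<in> unitary_on I" and nonreal: "z $ a $ b * cnj (z $ c $ d) \<noteq> z $ c $ d * cnj (z $ a $ b)"
  shows "\<exists>i\<in>I. \<exists>j\<in>I. i \<noteq> j \<and> (\<exists>k l. Im (z $ k $ j * cnj (z $ l $ i) - z $ k $ i * cnj (z $ l $ j)) \<noteq> 0)"
proof (rule ccontr)
  assume "\<not> ?thesis"
  then have real: "Im (z $ k $ j * cnj (z $ l $ i) - z $ k $ i * cnj (z $ l $ j)) = 0"
    if "i \<in> I" "j \<in> I" "i \<noteq> j" for i j k l
    using that by blast
  define s where "s p q = (\<Sum>k\<in>UNIV. z $ k $ p * z $ k $ q)" for p q
  have s_sym: "s p q = s q p" for p q
    by (simp add: s_def mult.commute)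
  have orth: "(\<Sum>k\<in>UNIV. cnj (z $ k $ p) * z $ k $ q) = (if p = q \<and> p \<in> I then 1 else 0)" for p q
  proof -
    have "(\<Sum>k\<in>UNIV. cnj (z $ k $ p) * z $ k $ q) = (cadj z ** z) $ p $ q"
      by (simp add: mat_entries)
    then show ?thesis by (simp add: unitary_onD[OF z] proj_def)
  qed
  have key: "s p j * cnj (z $ l $ i) - s p i * cnj (z $ l $ j) =
      (if p = j then z $ l $ i else 0) - (if p = i then z $ l $ j else 0)"
    if ij: "i \<in> I" "j \<in> I" "i \<noteq> j" for i j p l
  proof -
    have "z $ k $ j * cnj (z $ l $ i) - z $ k $ i * cnj (z $ l $ j) =
        cnj (z $ k $ j) * z $ l $ i - cnj (z $ k $ i) * z $ l $ j" for k
      using real[OF ij, of k l] by (simp add: complex_eq_iff algebra_simps)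
    then have "(\<Sum>k\<in>UNIV. z $ k $ p * (z $ k $ j * cnj (z $ l $ i) - z $ k $ i * cnj (z $ l $ j))) =
        (\<Sum>k\<in>UNIV. z $ k $ p * (cnj (z $ k $ j) * z $ l $ i - cnj (z $ k $ i) * z $ l $ j))"
      by simp
    also have "(\<Sum>k\<in>UNIV. z $ k $ p * (z $ k $ j * cnj (z $ l $ i) - z $ k $ i * cnj (z $ l $ j))) =
        s p j * cnj (z $ l $ i) - s p i * cnj (z $ l $ j)"
      by (simp add: s_def sum_subtractf sum_distrib_right right_diff_distrib mult.assoc)
    also have "(\<Sum>k\<in>UNIV. z $ k $ p * (cnj (z $ k $ j) * z $ l $ i - cnj (z $ k $ i) * z $ l $ j)) =
        (\<Sum>k\<in>UNIV. cnj (z $ k $ j) * z $ k $ p) * z $ l $ i - (\<Sum>k\<in>UNIV. cnj (z $ k $ i) * z $ k $ p) * z $ l $ j"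
      by (simp add: sum_subtractf sum_distrib_left sum_distrib_right right_diff_distrib mult_ac)
    finally show ?thesis
      using ij by (simp add: orth eq_commute[of p])
  qed
  have off: "s i j = 0" if ij: "i \<in> I" "j \<in> I" "i \<noteq> j" for i j
  proof -
    have "(\<Sum>l\<in>UNIV. (s i j * cnj (z $ l $ i) - s i i * cnj (z $ l $ j)) * z $ l $ i) = (\<Sum>l\<in>UNIV. - (z $ l $ j) * z $ l $ i)"
      using key[OF ij, of i] ij by simp
    also have "\<dots> = - s j i"
      by (simp add: s_def sum_negf)
    also have "(\<Sum>l\<in>UNIV. (s i j * cnj (z $ l $ i) - s i i * cnj (z $ l $ j)) * z $ l $ i) =
        s i j * (\<Sum>l\<in>UNIV. cnj (z $ l $ i) * z $ l $ i) - s i i * (\<Sum>l\<in>UNIV. cnj (z $ l $ j) * z $ l $ i)"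
      by (simp add: sum_subtractf sum_distrib_left left_diff_distrib mult.assoc)
    finally have "s i j = - s j i" using ij by (simp add: orth)
    then show ?thesis using s_sym[of i j] by simp
  qed
  have diag: "s i i * cnj (z $ l $ j) = z $ l $ j" if ij: "i \<in> I" "j \<in> I" "i \<noteq> j" for i j l
    using key[OF ij, of i l] off[OF ij] ij by simp
  have same: "s i i = s j j" if ij: "i \<in> I" "j \<in> I" "i \<noteq> j" for i j
  proof -
    have "s j j = (\<Sum>l\<in>UNIV. s i i * cnj (z $ l $ j) * z $ l $ j)"
      unfolding s_def[of j j] diag[OF ij] ..
    also have "\<dots> = s i i * (\<Sum>l\<in>UNIV. cnj (z $ l $ j) * z $ l $ j)"
      by (simp add: sum_distrib_left mult.assoc)
    finally show ?thesis using ij by (simp add: orth)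
  qed
  have "z $ a $ b \<noteq> 0" "z $ c $ d \<noteq> 0" using nonreal by auto
  then have mem: "a \<in> I" "b \<in> I" "c \<in> I" "d \<in> I"
    using unitary_row_zero[OF z] unitary_col_zero[OF z] by blast+
  obtain t where "t * cnj (z $ a $ b) = z $ a $ b" "t * cnj (z $ c $ d) = z $ c $ d"
  proof (cases "b = d")
    case False
    then show thesis
      using that[of "s b b"] diag[of d b a] diag[of b d c] same[of b d] mem by auto
  next
    case True
    have "\<exists>e\<in>I. e \<noteq> b"
    proof (rule ccontr)
      assume "\<not> ?thesis"
      then have "a = b" "c = b" "d = b" using mem by blast+
      then show False using nonreal by simp
    qed
    then obtain e where "e \<in> I" "e \<noteq> b" by blast
    then show thesis
      using that[of "s e e"] diag[of e b a] diag[of e b c] mem True by auto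
  qed
  then have "z $ a $ b * cnj (z $ c $ d) = z $ c $ d * cnj (z $ a $ b)"
    by (metis mult.assoc mult.commute)
  then show False using nonreal by simp
qed

lemma tangent_imp_tendsto_proj:
  assumes "(\<lambda>n. real n *\<^sub>R (h n - proj I)) \<longlonglongrightarrow> (x :: complex^'n^'n)"
  shows "(\<lambda>n. h n - proj I) \<longlonglongrightarrow> 0"
proof -
  have "(\<lambda>n. inverse (real n) *\<^sub>R (real n *\<^sub>R (h n - proj I))) \<longlonglongrightarrow> 0 *\<^sub>R x"
    by (intro tendsto_scaleR lim_inverse_n assms)
  then have "(\<lambda>n. inverse (real n) *\<^sub>R (real n *\<^sub>R (h n - proj I))) \<longlonglongrightarrow> 0"
    by simp
  moreover have "\<forall>\<^sub>F n in sequentially. inverse (real n) *\<^sub>R (real n *\<^sub>R (h n - proj I)) = h n - proj I"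
    using eventually_gt_at_top[of "0::nat"] by eventually_elim simp
  ultimately show ?thesis
    by (rule Lim_transform_eventually)
qed

lemma matrix_unit_diff_diag: "c *\<^sub>R (matrix_unit i - matrix_unit j) = diag (\<lambda>k. c * ((if k = i then 1 else 0) - (if k = j then 1 else 0)))"
  by (rule matrix_eqI) (simp add: matrix_unit_def diag_def)

text \<open>
  Inverses are not listed, because a closed semigroup of unitary matrices is a group (\<open>cadj_mem\<close>).
\<close>

locale conjugation_invariant_group =
  fixes I :: "'n::finite set" and H :: "(complex^'n^'n) set"
  assumes unitary: "z \<in> H \<Longrightarrow> z \<in> unitary_on I"
    and closed: "closed H"
    and mult: "y \<in> H \<Longrightarrow> z \<in> H \<Longrightarrow> y ** z \<in> H"
    and conj: "z \<in> H \<Longrightarrow> conj_mat z \<in> H"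
    and orthogonal: "g \<in> orthogonal_on I \<Longrightarrow> cmat g \<in> H"
    and phase: "cmod c = 1 \<Longrightarrow> z \<in> H \<Longrightarrow> cscale c z \<in> H"
begin

lemma compact: "compact H"
  using closed bounded_subset[OF bounded_unitary, of H] unitary by (auto simp: compact_eq_bounded_closed)

lemma proj_mem: "proj I \<in> H"
  using orthogonal[OF proj_orthogonal] by (simp add: cmat_proj)

lemma mpow_mem: "z \<in> H \<Longrightarrow> mpow I z n \<in> H"
  by (induction n) (auto simp: proj_mem mult)

text \<open>
  By compactness \<open>z ^ (n + 1)\<close> comes arbitrarily close to the unit, hence \<open>z ^ n\<close> to the inverse.
\<close>

lemma cadj_mem:
  assumes z: "z \<in> H"
  shows "cadj z \<in> H"
proof -
  have U: "z \<in> unitary_on I" by (rule unitary[OF z])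
  have "seq_compact H" using compact by (simp add: compact_eq_seq_compact_metric)
  then obtain l r where r: "strict_mono r" "((\<lambda>n. mpow I z n) \<circ> r) \<longlonglongrightarrow> l"
    using mpow_mem[OF z] unfolding seq_compact_def by metis
  then have C: "Cauchy ((\<lambda>n. mpow I z n) \<circ> r)"
    using LIMSEQ_imp_Cauchy by blast
  have "cadj z \<in> closure H"
    unfolding closure_approachable
  proof (intro allI impI)
    fix e :: real assume "e > 0"
    then obtain N where N: "\<And>m n. m \<ge> N \<Longrightarrow> n \<ge> N \<Longrightarrow> dist (mpow I z (r m)) (mpow I z (r n)) < e"
      using C unfolding Cauchy_def by (metis o_apply)
    have lt: "r N < r (Suc N)" using r(1) by (simp add: strict_mono_Suc_iff)
    then obtain k where k: "r (Suc N) = r N + Suc k"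
      using less_imp_Suc_add by auto
    have "norm (mpow I z k - cadj z) = norm (z ** (mpow I z k - cadj z))"
      by (rule norm_unitary_mult[OF U, symmetric])
        (simp add: matrix_mult_diff unitary_proj[OF mpow_unitary[OF U]] unitary_proj[OF cadj_unitary[OF U]])
    also have "z ** (mpow I z k - cadj z) = mpow I z (Suc k) - proj I"
      by (simp add: matrix_mult_diff unitary_onD[OF U])
    also have "norm \<dots> = norm (mpow I z (r N) ** (mpow I z (Suc k) - proj I))"
      by (rule norm_unitary_mult[OF mpow_unitary[OF U], symmetric])
        (simp only: matrix_mult_diff unitary_proj[OF mpow_unitary[OF U]] proj_proj)
    also have "\<dots> = norm (mpow I z (r (Suc N)) - mpow I z (r N))"
      by (simp only: matrix_mult_diff unitary_proj[OF mpow_unitary[OF U]] k mpow_add[OF U])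
    also have "\<dots> < e" using N[of "Suc N" N] by (simp add: dist_norm)
    finally show "\<exists>y\<in>H. dist y (cadj z) < e"
      using mpow_mem[OF z, of k] by (auto simp: dist_norm)
  qed
  then show ?thesis using closed by (simp add: closure_closed)
qed

text \<open>
  A substitute for the Lie algebra. The sequence \<open>h\<close> replaces \<open>exp (x / n)\<close>; closure under sums is
  then immediate, without a product formula for exponentials.
\<close>

definition tangent :: "(complex^'n^'n) set"
  where "tangent = {x. \<exists>h. (\<forall>n. h n \<in> H) \<and> (\<lambda>n. real n *\<^sub>R (h n - proj I)) \<longlonglongrightarrow> x}"

lemma tangent_add:
  assumes "x \<in> tangent" "y \<in> tangent"
  shows "x + y \<in> tangent"
proof -
  obtain h k where h: "\<And>n. h n \<in> H" "(\<lambda>n. real n *\<^sub>R (h n - proj I)) \<longlonglongrightarrow> x"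
    and k: "\<And>n. k n \<in> H" "(\<lambda>n. real n *\<^sub>R (k n - proj I)) \<longlonglongrightarrow> y"
    using assms by (auto simp: tangent_def)
  have "real n *\<^sub>R (h n ** k n - proj I) =
      (h n - proj I) ** (real n *\<^sub>R (k n - proj I)) + real n *\<^sub>R (h n - proj I) + real n *\<^sub>R (k n - proj I)" for n
    by (simp add: matrix_mult_scaleR matrix_mult_diff unitary_proj[OF unitary[OF h(1)]]
        unitary_proj[OF unitary[OF k(1)]] algebra_simps)
  moreover have "(\<lambda>n. (h n - proj I) ** (real n *\<^sub>R (k n - proj I)) + real n *\<^sub>R (h n - proj I) + real n *\<^sub>R (k n - proj I))
      \<longlonglongrightarrow> 0 ** y + x + y"
    by (intro tendsto_add tendsto_matrix_mult tangent_imp_tendsto_proj[OF h(2)] h k)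
  moreover have "0 ** y + x + y = x + y"
    by (rule matrix_eqI) (simp add: matrix_matrix_mult_def)
  ultimately show ?thesis
    using mult[OF h(1) k(1)] unfolding tangent_def by (auto intro!: exI[of _ "\<lambda>n. h n ** k n"])
qed

lemma tangent_cadj:
  assumes "x \<in> tangent"
  shows "cadj x \<in> tangent"
proof -
  obtain h where h: "\<And>n. h n \<in> H" "(\<lambda>n. real n *\<^sub>R (h n - proj I)) \<longlonglongrightarrow> x"
    using assms by (auto simp: tangent_def)
  have "cadj (real n *\<^sub>R (h n - proj I)) = real n *\<^sub>R (cadj (h n) - proj I)" for n
    by (rule matrix_eqI) (auto simp: cadj_def proj_def)
  then show ?thesis
    using tendsto_cadj[OF h(2)] cadj_mem[OF h(1)] unfolding tangent_def
    by (auto intro!: exI[of _ "\<lambda>n. cadj (h n)"])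
qed

lemma tangent_conj:
  assumes "x \<in> tangent"
  shows "conj_mat x \<in> tangent"
proof -
  obtain h where h: "\<And>n. h n \<in> H" "(\<lambda>n. real n *\<^sub>R (h n - proj I)) \<longlonglongrightarrow> x"
    using assms by (auto simp: tangent_def)
  have "conj_mat (real n *\<^sub>R (h n - proj I)) = real n *\<^sub>R (conj_mat (h n) - proj I)" for n
    by (rule matrix_eqI) (auto simp: conj_mat_def proj_def)
  then show ?thesis
    using tendsto_conj_mat[OF h(2)] conj[OF h(1)] unfolding tangent_def
    by (auto intro!: exI[of _ "\<lambda>n. conj_mat (h n)"])
qed

lemma tangent_Ad:
  assumes "x \<in> tangent" and z: "z \<in> H"
  shows "z ** x ** cadj z \<in> tangent"
proof -
  obtain h where h: "\<And>n. h n \<in> H" "(\<lambda>n. real n *\<^sub>R (h n - proj I)) \<longlonglongrightarrow> x"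
    using assms by (auto simp: tangent_def)
  have "z ** (real n *\<^sub>R (h n - proj I)) ** cadj z = real n *\<^sub>R (z ** h n ** cadj z - proj I)" for n
    by (simp add: matrix_mult_scaleR matrix_mult_diff unitary_proj[OF unitary[OF z]] unitary_onD[OF unitary[OF z]])
  moreover have "(\<lambda>n. z ** (real n *\<^sub>R (h n - proj I)) ** cadj z) \<longlonglongrightarrow> z ** x ** cadj z"
    by (intro tendsto_matrix_mult tendsto_const h)
  ultimately show ?thesis
    using mult[OF mult[OF z h(1)] cadj_mem[OF z]] unfolding tangent_def
    by (auto intro!: exI[of _ "\<lambda>n. z ** h n ** cadj z"])
qed

lemma rotation_orthogonal:
  assumes "i \<in> I" "j \<in> I" "i \<noteq> j"
  shows "plane I i j (cos \<theta>) (- sin \<theta>) (sin \<theta>) (cos \<theta>) \<in> orthogonal_on I"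
  using assms by (intro plane_orthogonal) (auto simp: power2_eq_square[symmetric])

lemma tangent_rotation:
  assumes ij: "i \<in> I" "j \<in> I" "i \<noteq> j"
  shows "plane I i j 0 (-1) 1 0 - plane I i j 0 0 0 0 \<in> tangent"
proof -
  define h where "h n = cmat (plane I i j (cos (inverse (real n))) (- sin (inverse (real n)))
    (sin (inverse (real n))) (cos (inverse (real n))))" for n
  have h: "h n \<in> H" for n
    unfolding h_def by (intro orthogonal rotation_orthogonal ij)
  have c: "(\<lambda>n. real n * (cos (inverse (real n)) - cos 0)) \<longlonglongrightarrow> - sin 0"
    by (rule derivative_along_inverses[where f = cos, simplified of_nat_id]) (auto intro!: derivative_eq_intros)
  have s: "(\<lambda>n. real n * (sin (inverse (real n)) - sin 0)) \<longlonglongrightarrow> cos 0"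
    by (rule derivative_along_inverses[where f = sin, simplified of_nat_id]) (auto intro!: derivative_eq_intros)
  have c': "(\<lambda>n. of_real (real n * (cos (inverse (real n)) - 1)) :: complex) \<longlonglongrightarrow> 0"
    using tendsto_of_real[OF c, where ?'a = complex] by simp
  have s': "(\<lambda>n. of_real (real n * sin (inverse (real n))) :: complex) \<longlonglongrightarrow> 1"
    using tendsto_of_real[OF s, where ?'a = complex] by simp
  have s'': "(\<lambda>n. - of_real (real n * sin (inverse (real n))) :: complex) \<longlonglongrightarrow> - 1"
    by (rule tendsto_minus[OF s'])
  have "(\<lambda>n. real n *\<^sub>R (h n - proj I)) \<longlonglongrightarrow> plane I i j 0 (-1) 1 0 - plane I i j 0 0 0 0"
  proof (rule tendsto_matrixI)
    fix k l
    have e: "(real n *\<^sub>R (h n - proj I)) $ k $ l =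
      (if k = i \<and> l = i \<or> k = j \<and> l = j then of_real (real n * (cos (inverse (real n)) - 1))
       else if k = i \<and> l = j then - of_real (real n * sin (inverse (real n)))
       else if k = j \<and> l = i then of_real (real n * sin (inverse (real n))) else 0)" for n
      unfolding h_def cmat_def plane_def proj_def vector_scaleR_component vector_minus_component vec_lambda_beta
      using ij by (cases "k = l"; cases "k = i"; cases "k = j"; cases "l = i"; cases "l = j")
        (simp_all add: scaleR_conv_of_real)
    have l: "(plane I i j 0 (-1) 1 0 - plane I i j 0 0 0 0) $ k $ l =
      (if k = i \<and> l = i \<or> k = j \<and> l = j then 0
       else if k = i \<and> l = j then - 1
       else if k = j \<and> l = i then 1 else (0::complex))"
      unfolding plane_def vector_minus_component vec_lambda_beta
      using ij by (cases "k = i"; cases "k = j"; cases "l = i"; cases "l = j") simp_all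
    show "(\<lambda>n. (real n *\<^sub>R (h n - proj I)) $ k $ l) \<longlonglongrightarrow> (plane I i j 0 (-1) 1 0 - plane I i j 0 0 0 0) $ k $ l"
      unfolding e l using c' s' s'' ij
      by (cases "k = i"; cases "k = j"; cases "l = i"; cases "l = j") (simp_all del: of_real_mult)
  qed
  then show ?thesis using h by (auto simp: tangent_def)
qed

text \<open>
  The symmetric part of the Lie algebra, which measures how far the group exceeds the orthogonal one.
\<close>

definition imaginary_tangent :: "(real^'n^'n) set"
  where "imaginary_tangent = {Y. transpose Y = Y \<and> (\<forall>k l. k \<notin> I \<longrightarrow> Y $ k $ l = 0) \<and> imat Y \<in> tangent}"

lemma imaginary_tangentD:
  assumes "Y \<in> imaginary_tangent"
  shows "Y $ k $ l = Y $ l $ k" "k \<notin> I \<Longrightarrow> Y $ k $ l = 0" "l \<notin> I \<Longrightarrow> Y $ k $ l = 0" "imat Y \<in> tangent"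
proof -
  show sym: "Y $ k $ l = Y $ l $ k" for k l
    using assms unfolding imaginary_tangent_def transpose_def by (metis (mono_tags, lifting) mem_Collect_eq vec_lambda_beta)
  show "k \<notin> I \<Longrightarrow> Y $ k $ l = 0" "imat Y \<in> tangent"
    using assms by (auto simp: imaginary_tangent_def)
  show "l \<notin> I \<Longrightarrow> Y $ k $ l = 0"
    using assms sym by (auto simp: imaginary_tangent_def)
qed

lemma imaginary_tangentI:
  assumes "\<And>k l. Y $ k $ l = Y $ l $ k" "\<And>k l. k \<notin> I \<Longrightarrow> Y $ k $ l = 0" "imat Y \<in> tangent"
  shows "Y \<in> imaginary_tangent"
  using assms by (auto simp: imaginary_tangent_def transpose_def vec_eq_iff)

lemma imaginary_tangent_add:
  assumes "X \<in> imaginary_tangent" "Y \<in> imaginary_tangent"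
  shows "X + Y \<in> imaginary_tangent"
proof (rule imaginary_tangentI)
  have "imat (X + Y) = imat X + imat Y"
    by (rule matrix_eqI) (simp add: imat_def cscale_def cmat_def algebra_simps)
  then show "imat (X + Y) \<in> tangent"
    using assms by (simp add: tangent_add imaginary_tangentD)
qed (use imaginary_tangentD[OF assms(1)] imaginary_tangentD[OF assms(2)] in auto)

lemma imaginary_tangent_uminus:
  assumes "Y \<in> imaginary_tangent"
  shows "- Y \<in> imaginary_tangent"
proof (rule imaginary_tangentI)
  have "imat (- Y) = cadj (imat Y)"
    using imaginary_tangentD(1)[OF assms] by (auto intro!: matrix_eqI simp: imat_def cscale_def cmat_def cadj_def)
  then show "imat (- Y) \<in> tangent"
    using assms by (simp add: tangent_cadj imaginary_tangentD)
qed (use imaginary_tangentD[OF assms] in auto)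

lemma orthogonal_row_zero:
  assumes "g \<in> orthogonal_on I" "k \<notin> I"
  shows "g $ k $ l = 0"
  using unitary_row_zero[OF cmat_unitary[OF assms(1)] assms(2), of l] by (simp add: cmat_def)

lemma imaginary_tangent_Ad:
  assumes Y: "Y \<in> imaginary_tangent" and g: "g \<in> orthogonal_on I"
  shows "g ** Y ** transpose g \<in> imaginary_tangent"
proof -
  have "imat (g ** Y ** transpose g) = cmat g ** imat Y ** cadj (cmat g)"
    by (rule matrix_eqI) (simp add: imat_def mat_entries sum_distrib_left sum_distrib_right mult_ac)
  then have "imat (g ** Y ** transpose g) \<in> tangent"
    using tangent_Ad[OF imaginary_tangentD(4)[OF Y] orthogonal[OF g]] by simp
  moreover have "transpose (g ** Y ** transpose g) = g ** Y ** transpose g"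
    using Y by (simp add: matrix_transpose_mul transpose_transpose matrix_mul_assoc imaginary_tangent_def)
  moreover have "(g ** Y ** transpose g) $ k $ l = 0" if "k \<notin> I" for k l
    using orthogonal_row_zero[OF g that] by (simp add: matrix_matrix_mult_def)
  ultimately show ?thesis by (simp add: imaginary_tangent_def)
qed

lemma imaginary_tangent_plane_Ad:
  assumes Y: "Y \<in> imaginary_tangent" and ij: "i \<in> I" "j \<in> I" "i \<noteq> j"
    and "plane I i j a b c d \<in> orthogonal_on I"
  shows "plane I i j a b c d ** Y ** plane I i j a c b d \<in> imaginary_tangent"
  using imaginary_tangent_Ad[OF Y assms(5)] ij(3) by (simp add: transpose_plane)

lemma imaginary_tangent_proj: "c *\<^sub>R proj I \<in> imaginary_tangent"
proof (rule imaginary_tangentI)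
  define h where "h n = cscale (cis (c * inverse (real n))) (proj I)" for n
  have h: "h n \<in> H" for n
    unfolding h_def by (intro phase proj_mem) simp
  have "((\<lambda>z. exp (\<i> * of_real c * z)) has_field_derivative \<i> * of_real c) (at 0)"
    by (auto intro!: derivative_eq_intros)
  note d = derivative_along_inverses[OF this]
  then have d: "(\<lambda>n. of_nat n * (cis (c * inverse (real n)) - 1)) \<longlonglongrightarrow> \<i> * of_real c"
    by (simp add: cis_conv_exp mult.assoc)
  have "(\<lambda>n. real n *\<^sub>R (h n - proj I)) \<longlonglongrightarrow> imat (c *\<^sub>R proj I)"
  proof (rule tendsto_matrixI)
    fix k l
    show "(\<lambda>n. (real n *\<^sub>R (h n - proj I)) $ k $ l) \<longlonglongrightarrow> imat (c *\<^sub>R proj I) $ k $ l"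
      unfolding h_def cscale_def proj_def imat_def cmat_def vector_scaleR_component
        vector_minus_component vec_lambda_beta
      using d by (cases "k = l"; cases "k \<in> I") (simp_all add: scaleR_conv_of_real)
  qed
  then show "imat (c *\<^sub>R proj I) \<in> tangent"
    using h by (auto simp: tangent_def)
qed (auto simp: proj_def)

text \<open>
  The tangent vector \<open>z J z\<^sup>*\<close> has a nonzero imaginary part for some \<open>J\<close>. It is symmetric with trace
  zero, so it is no multiple of the unit.
\<close>

lemma imaginary_tangent_nonscalar:
  assumes z: "z \<in> H" and nonreal: "z $ a $ b * cnj (z $ c $ d) \<noteq> z $ c $ d * cnj (z $ a $ b)"
  shows "\<exists>Y\<in>imaginary_tangent. \<exists>i\<in>I. \<exists>j\<in>I. Y $ i $ i \<noteq> Y $ j $ j"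
proof -
  have U: "z \<in> unitary_on I" by (rule unitary[OF z])
  obtain i j k0 l0 where ij: "i \<in> I" "j \<in> I" "i \<noteq> j"
    and nz: "Im (z $ k0 $ j * cnj (z $ l0 $ i) - z $ k0 $ i * cnj (z $ l0 $ j)) \<noteq> 0"
    using nonreal_entry_exists[OF U nonreal] by blast
  \<comment> \<open>with \<open>x = X + \<i> Y\<close>, \<open>X\<close> antisymmetric and \<open>Y\<close> symmetric, \<open>x\<close> plus its transpose is \<open>2 \<i> Y\<close>\<close>
  define J :: "complex^'n^'n" where "J = plane I i j 0 (-1) 1 0 - plane I i j 0 0 0 0"
  define x where "x = z ** J ** cadj z"
  define Y where "Y = (\<chi> k l. 2 * Im (z $ k $ j * cnj (z $ l $ i) - z $ k $ i * cnj (z $ l $ j)))"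
  have "x \<in> tangent"
    unfolding x_def J_def by (intro tangent_Ad tangent_rotation ij z)
  have zJ: "(z ** J) $ k $ l = (if l = i then z $ k $ j else 0) - (if l = j then z $ k $ i else 0)" for k l
    unfolding J_def matrix_mult_diff vector_minus_component mult_plane_nth[OF ij] using ij by simp
  have x: "x $ k $ l = z $ k $ j * cnj (z $ l $ i) - z $ k $ i * cnj (z $ l $ j)" for k l
  proof -
    have "x $ k $ l = (\<Sum>p\<in>UNIV. (z ** J) $ k $ p * cnj (z $ l $ p))"
      by (simp add: x_def matrix_matrix_mult_def[of "z ** J"] cadj_def)
    also have "\<dots> = (\<Sum>p\<in>UNIV. (if p = i then z $ k $ j * cnj (z $ l $ i) else 0) -
        (if p = j then z $ k $ i * cnj (z $ l $ j) else 0))"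
      unfolding zJ by (intro sum.cong) (auto simp: left_diff_distrib)
    finally show ?thesis by (simp add: sum_subtractf)
  qed
  have "Y \<in> imaginary_tangent"
  proof (rule imaginary_tangentI)
    have "imat Y = x + cadj (conj_mat x)"
    proof (rule matrix_eqI)
      show "imat Y $ k $ l = (x + cadj (conj_mat x)) $ k $ l" for k l
        by (simp add: imat_def cscale_def cmat_def cadj_def conj_mat_def x Y_def complex_eq_iff algebra_simps)
    qed
    then show "imat Y \<in> tangent"
      using \<open>x \<in> tangent\<close> by (simp add: tangent_add tangent_cadj tangent_conj)
    show "Y $ k $ l = Y $ l $ k" for k l
      by (simp add: Y_def algebra_simps)
    show "Y $ k $ l = 0" if "k \<notin> I" for k l
      using unitary_row_zero[OF U that] by (simp add: Y_def)
  qed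
  have tr: "(\<Sum>k\<in>UNIV. Y $ k $ k) = 0"
  proof -
    have "(\<Sum>k\<in>UNIV. cnj (z $ k $ i) * z $ k $ j) = (cadj z ** z) $ i $ j"
      by (simp add: mat_entries)
    also have "\<dots> = 0" using ij by (simp add: unitary_onD[OF U] proj_def)
    finally have "Im (\<Sum>k\<in>UNIV. cnj (z $ k $ i) * z $ k $ j) = 0" by simp
    then have "(\<Sum>k\<in>UNIV. 4 * Im (cnj (z $ k $ i) * z $ k $ j)) = 0"
      by (simp add: sum_distrib_left[symmetric] del: times_complex.sel)
    then show ?thesis by (simp add: Y_def algebra_simps)
  qed
  have "Y $ k0 $ l0 \<noteq> 0" using nz by (simp add: Y_def)
  then have kl: "k0 \<in> I" "l0 \<in> I" using imaginary_tangentD(2,3)[OF \<open>Y \<in> imaginary_tangent\<close>] by blast+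
  show ?thesis
  proof (cases "k0 = l0")
    case True
    show ?thesis
    proof (rule ccontr)
      assume const: "\<not> ?thesis"
      have "Y $ k $ k = (if k \<in> I then Y $ k0 $ k0 else 0)" for k
      proof (cases "k \<in> I")
        case True
        then have "Y $ k $ k = Y $ k0 $ k0"
          using const \<open>Y \<in> imaginary_tangent\<close> kl by blast
        then show ?thesis using True by simp
      qed (simp add: imaginary_tangentD(2)[OF \<open>Y \<in> imaginary_tangent\<close>])
      then have "(\<Sum>k\<in>UNIV. Y $ k $ k) = (\<Sum>k\<in>UNIV. if k \<in> I then Y $ k0 $ k0 else 0)"
        by (rule sum.cong[OF refl])
      also have "\<dots> = real (card I) * Y $ k0 $ k0"
        by (simp add: sum.If_cases)
      finally show False
        using tr \<open>Y $ k0 $ l0 \<noteq> 0\<close> True kl by (auto simp: card_eq_0_iff)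
    qed
  next
    case False
    \<comment> \<open>a rotation by 45 degrees turns an off-diagonal entry into a difference of diagonal ones\<close>
    define s :: real where "s = 1 / sqrt 2"
    have s: "s * s = 1 / 2" by (simp add: s_def)
    let ?Y = "plane I k0 l0 s (- s) s s ** Y ** plane I k0 l0 s s (- s) s"
    have "?Y \<in> imaginary_tangent"
      by (rule imaginary_tangent_plane_Ad[OF \<open>Y \<in> imaginary_tangent\<close> kl False]) (rule plane_orthogonal[OF kl False], simp_all add: s)
    moreover have "?Y $ k0 $ k0 \<noteq> ?Y $ l0 $ l0"
    proof -
      have "?Y $ k0 $ k0 - ?Y $ l0 $ l0 = - 2 * (s * s) * (Y $ k0 $ l0 + Y $ l0 $ k0)"
        unfolding mult_plane_nth[OF kl False] plane_mult_nth[OF kl False] using False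
        by (simp add: algebra_simps)
      then show ?thesis
        using \<open>Y $ k0 $ l0 \<noteq> 0\<close> imaginary_tangentD(1)[OF \<open>Y \<in> imaginary_tangent\<close>, of l0 k0] by (simp add: s)
    qed
    ultimately show ?thesis using kl by blast
  qed
qed

lemma imaginary_tangent_zero: "0 \<in> imaginary_tangent"
  using imaginary_tangent_proj[of 0] by simp

lemma imaginary_tangent_sum: "(\<And>k. k \<in> S \<Longrightarrow> Y k \<in> imaginary_tangent) \<Longrightarrow> sum Y S \<in> imaginary_tangent"
  by (induction S rule: infinite_finite_induct) (auto simp: imaginary_tangent_zero imaginary_tangent_add)

lemma imaginary_tangent_matrix_unit_diff:
  assumes Y: "Y \<in> imaginary_tangent" and ij: "i \<in> I" "j \<in> I" and ne: "Y $ i $ i \<noteq> Y $ j $ j"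
  shows "\<exists>c. c \<noteq> 0 \<and> c *\<^sub>R (matrix_unit i - matrix_unit j) \<in> imaginary_tangent"
proof -
  have inj: "i \<noteq> j" using ne by auto
  have sY: "Y $ k $ l = 0" if "k \<notin> I \<or> l \<notin> I" for k l
    using imaginary_tangentD(2,3)[OF Y] that by blast
  define c where "c = 2 * (Y $ i $ i - Y $ j $ j)"
  \<comment> \<open>subtracting the transposed coordinates removes all entries outside rows and columns \<open>i\<close>, \<open>j\<close>\<close>
  define Y1 where "Y1 = Y + - (plane I i j 0 1 1 0 ** Y ** plane I i j 0 1 1 0)"
  have Y1: "Y1 \<in> imaginary_tangent"
    unfolding Y1_def by (intro imaginary_tangent_add imaginary_tangent_uminus Y imaginary_tangent_plane_Ad ij inj plane_orthogonal) auto
  have e1: "Y1 $ k $ l = (if k = i \<and> l = i then Y $ i $ i - Y $ j $ j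
      else if k = j \<and> l = j then Y $ j $ j - Y $ i $ i
      else if k = i \<and> l = j \<or> k = j \<and> l = i then 0
      else if k = i then Y $ i $ l - Y $ j $ l else if k = j then Y $ j $ l - Y $ i $ l
      else if l = i then Y $ k $ i - Y $ k $ j else if l = j then Y $ k $ j - Y $ k $ i else 0)" for k l
    unfolding Y1_def vector_add_component vector_uminus_component
      mult_plane_nth[OF ij inj] plane_mult_nth[OF ij inj]
    using inj imaginary_tangentD(1)[OF Y, of i j]
    by (cases "k = i"; cases "k = j"; cases "l = i"; cases "l = j"; cases "k \<in> I"; cases "l \<in> I")
      (simp_all add: sY)
  \<comment> \<open>averaging over a change of sign removes the off-diagonal ones among the rest\<close>
  define Y2 where "Y2 = Y1 + plane I i j (-1) 0 0 (-1) ** Y1 ** plane I i j (-1) 0 0 (-1)"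
  have Y2: "Y2 \<in> imaginary_tangent"
    unfolding Y2_def by (intro imaginary_tangent_add Y1 imaginary_tangent_plane_Ad ij inj plane_orthogonal) auto
  have "Y2 $ k $ l = (c *\<^sub>R (matrix_unit i - matrix_unit j)) $ k $ l" for k l
    unfolding Y2_def vector_add_component vector_scaleR_component vector_minus_component
      mult_plane_nth[OF ij inj] plane_mult_nth[OF ij inj] e1 matrix_unit_def diag_def vec_lambda_beta c_def
    using inj ij
    by (cases "k = i"; cases "k = j"; cases "l = i"; cases "l = j"; cases "k = l"; cases "k \<in> I"; cases "l \<in> I")
      (simp_all add: sY)
  then have "Y2 = c *\<^sub>R (matrix_unit i - matrix_unit j)"
    by (rule matrix_eqI)
  then show ?thesis using Y2 ne by (intro exI[of _ c]) (auto simp: c_def)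
qed

lemma imaginary_tangent_swap_diag:
  assumes "diag d \<in> imaginary_tangent" and ij: "i \<in> I" "j \<in> I" "i \<noteq> j"
  shows "diag (d(i := d j, j := d i)) \<in> imaginary_tangent"
proof -
  have "plane I i j 0 1 1 0 ** diag d ** plane I i j 0 1 1 0 \<in> imaginary_tangent"
    by (intro imaginary_tangent_plane_Ad ij plane_orthogonal assms) auto
  moreover have "(plane I i j 0 1 1 0 ** diag d ** plane I i j 0 1 1 0) $ k $ l
      = diag (d(i := d j, j := d i)) $ k $ l" for k l
    unfolding mult_plane_nth[OF ij] plane_mult_nth[OF ij] unfolding diag_def vec_lambda_beta
    using ij imaginary_tangentD(2)[OF assms(1), of k k, unfolded diag_def]
    by (cases "k = i"; cases "k = j"; cases "l = i"; cases "l = j"; cases "k = l"; cases "k \<in> I"; cases "l \<in> I") simp_all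
  ultimately show ?thesis by (metis matrix_eqI)
qed

text \<open>
  The differences \<open>matrix_unit i - matrix_unit k\<close> for all \<open>k\<close>, together with the scalars, add up to
  a multiple of \<open>matrix_unit i\<close>.
\<close>

lemma imaginary_tangent_matrix_unit:
  assumes Y: "Y \<in> imaginary_tangent" and ij: "i \<in> I" "j \<in> I" and ne: "Y $ i $ i \<noteq> Y $ j $ j"
  shows "\<exists>c. c \<noteq> 0 \<and> (\<forall>k\<in>I. c *\<^sub>R matrix_unit k \<in> imaginary_tangent)"
proof -
  have inj: "i \<noteq> j" using ne by auto
  obtain c where c: "c \<noteq> 0" "c *\<^sub>R (matrix_unit i - matrix_unit j) \<in> imaginary_tangent"
    using imaginary_tangent_matrix_unit_diff[OF assms] by blast
  have k: "c *\<^sub>R (matrix_unit i - matrix_unit k) \<in> imaginary_tangent" if "k \<in> I" for k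
  proof (cases "k = i \<or> k = j")
    case True
    then show ?thesis using c imaginary_tangent_zero by auto
  next
    case False
    define d where "d = (\<lambda>k. c * ((if k = i then 1 else 0) - (if k = j then 1 else (0::real))))"
    have "diag d \<in> imaginary_tangent" using c(2) by (simp only: matrix_unit_diff_diag d_def)
    then have "diag (d(j := d k, k := d j)) \<in> imaginary_tangent"
      using False ij that by (intro imaginary_tangent_swap_diag) auto
    moreover have "d(j := d k, k := d j) = (\<lambda>l. c * ((if l = i then 1 else 0) - (if l = k then 1 else 0)))"
      using False inj by (auto simp: d_def)
    ultimately show ?thesis by (simp only: matrix_unit_diff_diag)
  qed
  define n where "n = real (card I)"
  have n: "n > 0" using ij by (auto simp: n_def card_gt_0_iff)
  have "(\<Sum>k\<in>I. c *\<^sub>R (matrix_unit i - matrix_unit k)) + c *\<^sub>R proj I \<in> imaginary_tangent"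
    by (intro imaginary_tangent_add imaginary_tangent_sum imaginary_tangent_proj k)
  moreover have "(\<Sum>k\<in>I. c *\<^sub>R (matrix_unit i - matrix_unit k)) + c *\<^sub>R proj I = (c * n) *\<^sub>R matrix_unit i"
  proof (rule matrix_eqI)
    fix k l
    have "(\<Sum>m\<in>I. matrix_unit m $ k $ l) = (proj I $ k $ l :: real)"
      by (cases "k = l") (simp_all add: matrix_unit_def diag_def proj_def)
    then show "((\<Sum>k\<in>I. c *\<^sub>R (matrix_unit i - matrix_unit k)) + c *\<^sub>R proj I) $ k $ l = ((c * n) *\<^sub>R matrix_unit i) $ k $ l"
      by (simp add: sum_subtractf right_diff_distrib sum_distrib_left[symmetric] n_def)
  qed
  ultimately have ei: "(c * n) *\<^sub>R matrix_unit i \<in> imaginary_tangent" by simp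
  have matrix_unit_diag: "r *\<^sub>R matrix_unit k = diag (\<lambda>l. r * (if l = k then 1 else 0))" for r k
    by (rule matrix_eqI) (simp add: matrix_unit_def diag_def)
  have "(c * n) *\<^sub>R matrix_unit k \<in> imaginary_tangent" if k: "k \<in> I" for k
  proof (cases "k = i")
    case False
    define d where "d = (\<lambda>l. c * n * (if l = i then 1 else (0::real)))"
    have "diag d \<in> imaginary_tangent" using ei by (simp only: matrix_unit_diag d_def)
    then have "diag (d(i := d k, k := d i)) \<in> imaginary_tangent"
      using False ij k by (intro imaginary_tangent_swap_diag) auto
    moreover have "d(i := d k, k := d i) = (\<lambda>l. c * n * (if l = k then 1 else 0))"
      using False by (auto simp: d_def)
    ultimately show ?thesis by (simp only: matrix_unit_diag)
  qed (use ei in simp)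
  then show ?thesis using c n by (intro exI[of _ "c * n"]) auto
qed

text \<open>
  Exponentiation. If \<open>n * (h n - 1)\<close> tends to the tangent direction, the same holds for
  \<open>phase_at I i (c / n)\<close> in place of \<open>h n\<close>, so the powers \<open>h n ^ m\<close> with \<open>m / n \<longlonglongrightarrow> t\<close> tend to
  the phase with angle \<open>c * t\<close>.
\<close>

lemma phase_at_mem:
  assumes i: "i \<in> I" and c: "c \<noteq> 0" "c *\<^sub>R matrix_unit i \<in> imaginary_tangent"
  shows "phase_at I i \<theta> \<in> H"
proof -
  obtain h where h: "\<And>n. h n \<in> H" "(\<lambda>n. real n *\<^sub>R (h n - proj I)) \<longlonglongrightarrow> imat (c *\<^sub>R matrix_unit i)"
    using imaginary_tangentD(4)[OF c(2)] by (auto simp: tangent_def)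
  define D where "D \<theta> = phase_at I i \<theta>" for \<theta>
  have "((\<lambda>z. exp (\<i> * of_real c * z)) has_field_derivative \<i> * of_real c) (at 0)"
    by (auto intro!: derivative_eq_intros)
  note d = derivative_along_inverses[OF this]
  then have d: "(\<lambda>n. of_nat n * (cis (c * inverse (real n)) - 1)) \<longlonglongrightarrow> \<i> * of_real c"
    by (simp add: cis_conv_exp mult.assoc)
  have "(\<lambda>n. real n *\<^sub>R (D (c * inverse (real n)) - proj I)) \<longlonglongrightarrow> imat (c *\<^sub>R matrix_unit i)"
  proof (rule tendsto_matrixI)
    fix k l
    show "(\<lambda>n. (real n *\<^sub>R (D (c * inverse (real n)) - proj I)) $ k $ l) \<longlonglongrightarrow> imat (c *\<^sub>R matrix_unit i) $ k $ l"
      unfolding D_def phase_at_def diag_def matrix_unit_def cscale_def proj_def imat_def cmat_def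
        vector_scaleR_component vector_minus_component vec_lambda_beta
      using d i by (cases "k = l"; cases "k \<in> I"; cases "k = i") (simp_all add: scaleR_conv_of_real)
  qed
  then have diff: "(\<lambda>n. real n *\<^sub>R (h n - proj I) - real n *\<^sub>R (D (c * inverse (real n)) - proj I)) \<longlonglongrightarrow>
      imat (c *\<^sub>R matrix_unit i) - imat (c *\<^sub>R matrix_unit i)"
    by (intro tendsto_diff h)
  then have small: "(\<lambda>n. real n * norm (h n - D (c * inverse (real n)))) \<longlonglongrightarrow> 0"
  proof -
    have "real n *\<^sub>R (h n - proj I) - real n *\<^sub>R (D (c * inverse (real n)) - proj I) =
        real n *\<^sub>R (h n - D (c * inverse (real n)))" for n
      by (simp add: scaleR_diff_right)
    then show ?thesis using tendsto_norm[OF diff] by simp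
  qed
  have pos: "D (c * t) \<in> H" if t: "t \<ge> 0" for t
  proof -
    define m where "m n = nat \<lfloor>real n * t\<rfloor>" for n
    have m: "real (m n) \<le> real n * t" "real n * t - 1 \<le> real (m n)" for n
      using t by (auto simp: m_def)
    have ratio: "(\<lambda>n. real (m n) * inverse (real n)) \<longlonglongrightarrow> t"
    proof (rule tendsto_sandwich)
      show "\<forall>\<^sub>F n in sequentially. t - inverse (real n) \<le> real (m n) * inverse (real n)"
        using eventually_gt_at_top[of "0::nat"]
      proof eventually_elim
        case (elim n)
        have "(real n * t - 1) * inverse (real n) \<le> real (m n) * inverse (real n)"
          using m by (intro mult_right_mono) auto
        moreover have "real n * t * inverse (real n) = t" using elim by (simp add: field_simps)
        ultimately show ?case by (simp add: left_diff_distrib)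
      qed
      show "\<forall>\<^sub>F n in sequentially. real (m n) * inverse (real n) \<le> t"
        using eventually_gt_at_top[of "0::nat"]
      proof eventually_elim
        case (elim n)
        have "real (m n) * inverse (real n) \<le> (real n * t) * inverse (real n)"
          using m by (intro mult_right_mono) auto
        moreover have "real n * t * inverse (real n) = t" using elim by (simp add: field_simps)
        ultimately show ?case by simp
      qed
      have "(\<lambda>n. t - inverse (real n)) \<longlonglongrightarrow> t - 0"
        by (intro tendsto_diff tendsto_const lim_inverse_n)
      then show "(\<lambda>n. t - inverse (real n)) \<longlonglongrightarrow> t" by simp
    qed simp
    have "(\<lambda>n. D (real (m n) * (c * inverse (real n)))) \<longlonglongrightarrow> D (c * t)"
    proof (rule tendsto_matrixI)
      fix k l
      have "(\<lambda>n. cis (real (m n) * (c * inverse (real n)))) \<longlonglongrightarrow> cis (c * t)"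
        using tendsto_mult_left[OF ratio, of c] by (intro tendsto_cis) (simp add: mult_ac)
      then show "(\<lambda>n. D (real (m n) * (c * inverse (real n))) $ k $ l) \<longlonglongrightarrow> D (c * t) $ k $ l"
        by (simp add: D_def phase_at_def diag_def)
    qed
    moreover have "(\<lambda>n. mpow I (h n) (m n) - D (real (m n) * (c * inverse (real n)))) \<longlonglongrightarrow> 0"
    proof (rule Lim_null_comparison)
      show "(\<lambda>n. t * (real n * norm (h n - D (c * inverse (real n))))) \<longlonglongrightarrow> 0"
        using tendsto_mult_left[OF small, of t] by simp
      have "norm (mpow I (h n) (m n) - D (real (m n) * (c * inverse (real n)))) \<le>
          t * (real n * norm (h n - D (c * inverse (real n))))" for n
      proof -
        have "norm (mpow I (h n) (m n) - D (real (m n) * (c * inverse (real n)))) \<le>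
            real (m n) * norm (h n - D (c * inverse (real n)))"
          using norm_mpow_diff[OF unitary[OF h(1)] phase_at_unitary, of n "m n" i "c * inverse (real n)"]
          by (simp add: D_def mpow_phase_at)
        also have "\<dots> \<le> (real n * t) * norm (h n - D (c * inverse (real n)))"
          using m by (intro mult_right_mono) auto
        finally show ?thesis by (simp add: mult_ac)
      qed
      then show "\<forall>\<^sub>F n in sequentially. norm (mpow I (h n) (m n) - D (real (m n) * (c * inverse (real n)))) \<le>
          t * (real n * norm (h n - D (c * inverse (real n))))"
        by simp
    qed
    ultimately have "(\<lambda>n. mpow I (h n) (m n)) \<longlonglongrightarrow> D (c * t)"
      by (rule Lim_transform)
    then show ?thesis
      by (rule closed_sequentially[OF closed, of "\<lambda>n. mpow I (h n) (m n)", rotated]) (rule mpow_mem[OF h(1)])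
  qed
  show ?thesis
  proof (cases "\<theta> / c \<ge> 0")
    case True
    then show ?thesis using pos[of "\<theta> / c"] c by (simp add: D_def)
  next
    case False
    then have "D (- \<theta>) \<in> H" using pos[of "- \<theta> / c"] c by simp
    then show ?thesis using cadj_mem[of "D (- \<theta>)"] by (simp add: D_def cadj_phase_at)
  qed
qed

text \<open>
  The orthogonal group and the diagonal phases generate the unitary group. Among all products
  \<open>m = h z k\<close> with group elements \<open>h\<close>, \<open>k\<close>, take one with the largest real part of a weighted trace.
  Rotating from both sides shows that the off-diagonal entries of \<open>m\<close> have real part zero. Conjugation
  by phases preserves maximality, so they vanish. Multiplication by phases shows that the diagonal
  entries are one. Hence \<open>m\<close> is the unit.
\<close>

lemma unitary_mem:
  assumes phases: "\<And>i \<theta>. i \<in> I \<Longrightarrow> phase_at I i \<theta> \<in> H" and z: "z \<in> unitary_on I"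
  shows "z \<in> H"
proof -
  obtain f :: "'n \<Rightarrow> nat" where f: "inj f"
    using finite_imp_inj_to_nat_seg[OF finite[of "UNIV :: 'n set"]] by auto
  \<comment> \<open>the weights must be distinct and positive for \<open>re_zero\<close> below\<close>
  define w where "w i = real (f i) + 1" for i
  have w_pos: "w i > 0" for i by (simp add: w_def)
  have w_inj: "w i \<noteq> w j" if "i \<noteq> j" for i j
    using that injD[OF f] by (auto simp: w_def)
  define \<phi> where "\<phi> m = (\<Sum>i\<in>UNIV. w i * Re (m $ i $ i))" for m :: "complex^'n^'n"
  have "continuous_on (H \<times> H) (\<lambda>(h, k). \<phi> (h ** z ** k))"
    unfolding \<phi>_def case_prod_beta matrix_matrix_mult_def vec_lambda_beta
    by (intro continuous_intros)
  moreover have "Topological_Spaces.compact (H \<times> H)"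
    by (intro compact_Times compact)
  moreover have "H \<times> H \<noteq> {}" using proj_mem by auto
  ultimately obtain hk where hk: "hk \<in> H \<times> H"
    "\<And>hk'. hk' \<in> H \<times> H \<Longrightarrow> (case hk' of (h, k) \<Rightarrow> \<phi> (h ** z ** k)) \<le> (case hk of (h, k) \<Rightarrow> \<phi> (h ** z ** k))"
    using continuous_attains_sup[of "H \<times> H" "\<lambda>(h, k). \<phi> (h ** z ** k)"] by blast
  obtain h k where [simp]: "hk = (h, k)" by (cases hk)
  have h: "h \<in> H" and k: "k \<in> H" using hk(1) by auto
  define m where "m = h ** z ** k"
  have mU: "m \<in> unitary_on I"
    unfolding m_def by (intro unitary_mult unitary h k z)
  have max: "\<phi> (h' ** m ** k') \<le> \<phi> m" if "h' \<in> H" "k' \<in> H" for h' k'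
  proof -
    have "h' ** m ** k' = (h' ** h) ** z ** (k ** k')"
      by (simp add: m_def matrix_mul_assoc)
    then show ?thesis
      using hk(2)[of "(h' ** h, k ** k')"] mult that h k by (simp add: m_def)
  qed
  have re_zero: "Re (y $ i $ j) = 0"
    if yU: "y \<in> unitary_on I" and y: "\<And>h' k'. h' \<in> H \<Longrightarrow> k' \<in> H \<Longrightarrow> \<phi> (h' ** y ** k') \<le> \<phi> y"
      and ij: "i \<in> I" "j \<in> I" "i \<noteq> j" for y i j
  proof -
    let ?r = "\<lambda>\<theta>. plane I i j (complex_of_real (cos \<theta>)) (- complex_of_real (sin \<theta>)) (complex_of_real (sin \<theta>)) (complex_of_real (cos \<theta>))"
    have r: "?r \<theta> \<in> H" for \<theta>
      using orthogonal[OF rotation_orthogonal[OF ij, of \<theta>]] by (simp add: cmat_plane)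
    have zero: "y $ l $ l = 0" if "l \<notin> I" for l
      using unitary_row_zero[OF yU that] .
    have "\<phi> (?r \<theta> ** y) - \<phi> y = (w i * Re (y $ i $ i) + w j * Re (y $ j $ j)) * (cos \<theta> - 1)
        + (w j * Re (y $ i $ j) - w i * Re (y $ j $ i)) * sin \<theta>" for \<theta>
    proof -
      have "\<phi> (?r \<theta> ** y) - \<phi> y = (\<Sum>l\<in>UNIV. w l * (Re ((?r \<theta> ** y) $ l $ l) - Re (y $ l $ l)))"
        by (simp add: \<phi>_def sum_subtractf right_diff_distrib)
      also have "\<dots> = (\<Sum>l\<in>UNIV. (if l = i then w i * (cos \<theta> * Re (y $ i $ i) - sin \<theta> * Re (y $ j $ i) - Re (y $ i $ i)) else 0)
          + (if l = j then w j * (sin \<theta> * Re (y $ i $ j) + cos \<theta> * Re (y $ j $ j) - Re (y $ j $ j)) else 0))"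
        unfolding plane_mult_nth[OF ij] using ij zero by (intro sum.cong) auto
      finally show ?thesis by (simp add: sum.distrib algebra_simps)
    qed
    moreover have "\<phi> (?r \<theta> ** y) - \<phi> y \<le> 0" for \<theta>
      using y[OF r[of \<theta>] proj_mem] by (simp add: unitary_proj[OF unitary_mult[OF unitary[OF r] yU]])
    ultimately have left: "w j * Re (y $ i $ j) - w i * Re (y $ j $ i) = 0"
      by (intro sine_term_zero_at_max[of "w i * Re (y $ i $ i) + w j * Re (y $ j $ j)"]) simp
    have "\<phi> (y ** ?r \<theta>) - \<phi> y = (w i * Re (y $ i $ i) + w j * Re (y $ j $ j)) * (cos \<theta> - 1)
        + (w i * Re (y $ i $ j) - w j * Re (y $ j $ i)) * sin \<theta>" for \<theta>
    proof -
      have "\<phi> (y ** ?r \<theta>) - \<phi> y = (\<Sum>l\<in>UNIV. w l * (Re ((y ** ?r \<theta>) $ l $ l) - Re (y $ l $ l)))"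
        by (simp add: \<phi>_def sum_subtractf right_diff_distrib)
      also have "\<dots> = (\<Sum>l\<in>UNIV. (if l = i then w i * (Re (y $ i $ i) * cos \<theta> + Re (y $ i $ j) * sin \<theta> - Re (y $ i $ i)) else 0)
          + (if l = j then w j * (- Re (y $ j $ i) * sin \<theta> + Re (y $ j $ j) * cos \<theta> - Re (y $ j $ j)) else 0))"
        unfolding mult_plane_nth[OF ij] using ij zero by (intro sum.cong) auto
      finally show ?thesis by (simp add: sum.distrib algebra_simps)
    qed
    moreover have "\<phi> (y ** ?r \<theta>) - \<phi> y \<le> 0" for \<theta>
      using y[OF proj_mem r[of \<theta>]] by (simp add: unitary_proj[OF yU])
    ultimately have right: "w i * Re (y $ i $ j) - w j * Re (y $ j $ i) = 0"
      by (intro sine_term_zero_at_max[of "w i * Re (y $ i $ i) + w j * Re (y $ j $ j)"]) simp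
    have "w j * (w j * Re (y $ i $ j)) = w i * (w j * Re (y $ j $ i))"
      using left by (simp add: algebra_simps)
    also have "\<dots> = w i * (w i * Re (y $ i $ j))" using right by simp
    finally have "(w j - w i) * ((w j + w i) * Re (y $ i $ j)) = 0"
      by (simp add: algebra_simps)
    then show ?thesis
      using w_inj[OF ij(3)] w_pos[of i] w_pos[of j] by simp
  qed
  have off: "m $ i $ j = 0" if ij: "i \<in> I" "j \<in> I" "i \<noteq> j" for i j
  proof -
    have "Re (cis \<theta> * m $ i $ j) = 0" for \<theta>
    proof -
      let ?p = "phase_at I i \<theta>"
      define y where "y = ?p ** m ** cadj ?p"
      have p: "?p \<in> H" "cadj ?p \<in> H" using phases[OF ij(1)] cadj_mem by auto
      have e: "y $ k $ l = (if k \<in> I then if k = i then cis \<theta> else 1 else 0) * m $ k $ l *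
          (if l \<in> I then if l = i then cis (- \<theta>) else 1 else 0)" for k l
        unfolding y_def cadj_phase_at unfolding phase_at_def mult_diag_nth diag_mult_nth ..
      have "\<phi> y = \<phi> m"
        unfolding \<phi>_def
      proof (intro sum.cong refl)
        fix l
        have c: "cis \<theta> * x * cis (- \<theta>) = x" for x
          by (simp add: mult.commute[of "cis \<theta>"] mult.assoc cis_mult)
        show "w l * Re (y $ l $ l) = w l * Re (m $ l $ l)"
          unfolding e using unitary_row_zero[OF mU, of l l] c
          by (cases "l \<in> I"; cases "l = i") (simp_all only: if_True if_False refl mult_1 mult_1_right mult_zero_left mult_zero_right not_False_eq_True simp_thms)
      qed
      moreover have "\<phi> (h' ** y ** k') \<le> \<phi> m" if "h' \<in> H" "k' \<in> H" for h' k'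
        using max[OF mult[OF that(1) p(1)] mult[OF p(2) that(2)]] by (simp add: y_def matrix_mul_assoc)
      moreover have "y \<in> unitary_on I"
        unfolding y_def by (intro unitary_mult unitary p mU)
      ultimately have "Re (y $ i $ j) = 0"
        using re_zero[OF _ _ ij, of y] by simp
      then show ?thesis unfolding e using ij by simp
    qed
    from this[of 0] this[of "pi / 2"] show ?thesis
      by (simp add: complex_eq_iff cis.simps)
  qed
  have "m $ i $ j = proj I $ i $ j" for i j
  proof (cases "i \<in> I \<and> j \<in> I")
    case False
    then show ?thesis
      using unitary_row_zero[OF mU] unitary_col_zero[OF mU] by (auto simp: proj_def)
  next
    case I: True
    show ?thesis
    proof (cases "i = j")
      case False
      then show ?thesis using off I by (simp add: proj_def)
    next
      case [simp]: True
      have "(\<Sum>k\<in>UNIV. m $ i $ k * cnj (m $ i $ k)) = (m ** cadj m) $ i $ i"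
        by (simp add: mat_entries)
      also have "\<dots> = 1" using I by (simp add: unitary_onD[OF mU] proj_def)
      also have "(\<Sum>k\<in>UNIV. m $ i $ k * cnj (m $ i $ k)) = (\<Sum>k\<in>UNIV. if k = i then m $ i $ i * cnj (m $ i $ i) else 0)"
      proof (intro sum.cong refl)
        fix k
        show "m $ i $ k * cnj (m $ i $ k) = (if k = i then m $ i $ i * cnj (m $ i $ i) else 0)"
          using off[of i k] I unitary_col_zero[OF mU, of k i] by (cases "k \<in> I") auto
      qed
      finally have "complex_of_real ((cmod (m $ i $ i))\<^sup>2) = 1"
        by (simp add: complex_norm_square del: of_real_power)
      then have "(cmod (m $ i $ i))\<^sup>2 = 1"
        by (metis of_real_eq_1_iff)
      then have one: "cmod (m $ i $ i) = 1"
        using norm_ge_zero[of "m $ i $ i"] power2_eq_1_iff[of "cmod (m $ i $ i)"] by linarith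
      have le: "Re (cis \<theta> * m $ i $ i) \<le> Re (m $ i $ i)" for \<theta>
      proof -
        have "phase_at I i \<theta> ** m ** proj I = phase_at I i \<theta> ** m"
          by (rule unitary_proj[OF unitary_mult[OF phase_at_unitary mU]])
        then have "\<phi> (phase_at I i \<theta> ** m) \<le> \<phi> m"
          using max[OF phases[of i \<theta>] proj_mem] I by simp
        moreover have "\<phi> (phase_at I i \<theta> ** m) - \<phi> m = (\<Sum>l\<in>UNIV. w l * (Re ((phase_at I i \<theta> ** m) $ l $ l) - Re (m $ l $ l)))"
          by (simp add: \<phi>_def sum_subtractf right_diff_distrib)
        moreover have "\<dots> = (\<Sum>l\<in>UNIV. if l = i then w i * (Re (cis \<theta> * m $ i $ i) - Re (m $ i $ i)) else 0)"
          unfolding phase_at_def diag_mult_nth using I unitary_row_zero[OF mU]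
          by (intro sum.cong) auto
        ultimately have "w i * (Re (cis \<theta> * m $ i $ i) - Re (m $ i $ i)) \<le> 0"
          by simp
        then show ?thesis using w_pos[of i] by (simp add: mult_le_0_iff)
      qed
      have "cis (- Arg (m $ i $ i)) * m $ i $ i = 1"
      proof -
        have "m $ i $ i = cis (Arg (m $ i $ i))"
          using rcis_cmod_Arg[of "m $ i $ i"] one by (simp add: rcis_def)
        then have "cis (- Arg (m $ i $ i)) * m $ i $ i = cis (- Arg (m $ i $ i)) * cis (Arg (m $ i $ i))"
          by simp
        then show ?thesis by (simp add: cis_mult)
      qed
      then have "1 \<le> Re (m $ i $ i)"
        using le[of "- Arg (m $ i $ i)"] by simp
      moreover have "(Re (m $ i $ i))\<^sup>2 + (Im (m $ i $ i))\<^sup>2 = 1"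
        using one by (simp add: cmod_power2[symmetric])
      moreover have "Re (m $ i $ i) \<le> 1"
        using complex_Re_le_cmod[of "m $ i $ i"] one by simp
      ultimately have "m $ i $ i = 1"
        by (simp add: complex_eq_iff)
      then show ?thesis using I by (simp add: proj_def)
    qed
  qed
  then have "m = proj I" by (rule matrix_eqI)
  have "cadj h ** m ** cadj k = (cadj h ** h) ** z ** (k ** cadj k)"
    by (simp add: m_def matrix_mul_assoc)
  also have "\<dots> = z"
    by (simp add: unitary_onD[OF unitary[OF h]] unitary_onD[OF unitary[OF k]] unitary_proj[OF z])
  finally show ?thesis
    using mult[OF mult[OF cadj_mem[OF h] proj_mem] cadj_mem[OF k]] \<open>m = proj I\<close> by simp
qed

text \<open>
  An infinitesimal version of the fact that the projective orthogonal group is maximal in the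
  projective unitary group.
\<close>

theorem nonreal_imp_full:
  assumes z: "z \<in> H" and nonreal: "z $ a $ b * cnj (z $ c $ d) \<noteq> z $ c $ d * cnj (z $ a $ b)"
  shows "H = unitary_on I"
proof -
  obtain Y i j where Y: "Y \<in> imaginary_tangent" "i \<in> I" "j \<in> I" "Y $ i $ i \<noteq> Y $ j $ j"
    using imaginary_tangent_nonscalar[OF assms] by blast
  obtain e where "e \<noteq> 0" "\<And>k. k \<in> I \<Longrightarrow> e *\<^sub>R matrix_unit k \<in> imaginary_tangent"
    using imaginary_tangent_matrix_unit[OF Y] by blast
  then have "phase_at I k \<theta> \<in> H" if "k \<in> I" for k \<theta>
    using phase_at_mem that by blast
  then show ?thesis
    using unitary_mem unitary by blast
qed

end

section \<open>Half-commuting coordinates and the spectrum of the even part\<close>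

text \<open>
  The adjoint makes one definition serve two purposes: for self-adjoint elements of a C*-algebra these
  are the generators of the even part, and for a complex matrix the values of a character on them.
\<close>

definition pair_products :: "('x \<Rightarrow> 'a::cstar_algebra) \<Rightarrow> 'x \<times> 'x \<Rightarrow> 'a"
  where "pair_products a = (\<lambda>(x, y). a x * adj (a y))"

lemma free_eval_intertwine:
  fixes a b :: "'x \<Rightarrow> 'a::cstar_algebra"
  assumes "\<And>x. c * a x = b x * c" "\<And>x. c * adj (a x) = adj (b x) * c"
  shows "c * free_eval a p = free_eval b p * c"
proof (induction p rule: free_eval_induct)
  case (gen x p)
  have *: "c * (l * free_eval a p) = (l' * free_eval b p) * c" if "c * l = l' * c" for l l'
    using that gen by (metis mult.assoc)
  show ?case
    unfolding free_eval_mult free_eval_gen free_eval_star using assms by (intro conjI *)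
qed (auto simp: free_eval_const mult_scaleC_left mult_scaleC_right free_eval_add algebra_simps)

lemma complex_cstar_simps [simp]:
  "adj (z :: complex) = cnj z" "scaleC c (z :: complex) = c * z"
  by (simp_all add: adj_complex_def scaleC_complex_def)

text \<open>
  The relations of the half-liberated orthogonal quantum group on the index set \<open>I\<close>.
\<close>

locale half_liberated =
  fixes I :: "'n::finite set" and v :: "'a::cstar_algebra^'n^'n"
  assumes selfadj: "adj (v $ i $ j) = v $ i $ j"
    and rows: "v ** transpose v = proj I"
    and columns: "transpose v ** v = proj I"
    and support: "i \<notin> I \<or> j \<notin> I \<Longrightarrow> v $ i $ j = 0"
    and half: "entry v a * entry v b * entry v c = entry v c * entry v b * entry v a"
begin

abbreviation "e \<equiv> entry v"
abbreviation "ev \<equiv> free_eval (pair_products e)"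

lemma e_selfadj [simp]: "adj (e a) = e a"
  by (cases a) (simp add: entry_def selfadj)

lemma e_zero: "fst a \<notin> I \<or> snd a \<notin> I \<Longrightarrow> e a = 0"
  using support by (cases a) (auto simp: entry_def)

lemma e_rows: "(\<Sum>k\<in>UNIV. e (i, k) * e (j, k)) = (if i = j \<and> i \<in> I then 1 else 0)"
proof -
  have "(\<Sum>k\<in>UNIV. e (i, k) * e (j, k)) = (v ** transpose v) $ i $ j"
    by (simp add: matrix_matrix_mult_def transpose_def entry_def)
  then show ?thesis by (simp add: rows proj_def)
qed

lemma e_columns: "(\<Sum>k\<in>UNIV. e (k, i) * e (k, j)) = (if i = j \<and> i \<in> I then 1 else 0)"
proof -
  have "(\<Sum>k\<in>UNIV. e (k, i) * e (k, j)) = (transpose v ** v) $ i $ j"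
    by (simp add: matrix_matrix_mult_def transpose_def entry_def)
  then show ?thesis by (simp add: columns proj_def)
qed

lemma e_pairs_commute: "e a * e b * (e c * e d) = e c * e d * (e a * e b)"
proof -
  have "e a * e b * (e c * e d) = (e a * e b * e c) * e d" by (simp add: mult.assoc)
  also have "\<dots> = e c * (e b * e a * e d)" by (subst half[of a b c]) (simp only: mult.assoc)
  also have "\<dots> = e c * (e d * e a * e b)" by (simp only: half[of b a d])
  also have "\<dots> = e c * e d * (e a * e b)" by (simp only: mult.assoc)
  finally show ?thesis .
qed

sublocale even: commutative_star_subalgebra "range ev"
  by (rule commutative_star_subalgebra_range)
    (simp_all add: pair_products_def case_prod_unfold adj_mult e_pairs_commute)

text \<open>
  The matrices \<open>z\<close> for which \<open>v a * v b \<mapsto> z a * cnj (z b)\<close> extends to a character of the even part.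
\<close>

definition spectrum :: "(complex^'n^'n) set"
  where "spectrum = {z \<in> unitary_on I. \<forall>q. cmod (free_eval (pair_products (entry z)) q) \<le> norm (ev q)}"

lemma spectrum_unitary: "z \<in> spectrum \<Longrightarrow> z \<in> unitary_on I"
  by (simp add: spectrum_def)

lemma spectrum_bound: "z \<in> spectrum \<Longrightarrow> cmod (free_eval (pair_products (entry z)) q) \<le> norm (ev q)"
  by (simp add: spectrum_def)

lemma pair_mem: "e a * e b \<in> range ev"
proof -
  have "e a * e b = ev (gen (a, b))"
    by (simp add: free_eval_gen pair_products_def)
  then show ?thesis by blast
qed

text \<open>
  Half-commutation gives \<open>t a b * t c d = t a d * t c b\<close> for the values \<open>t a b\<close> of the character, so
  that \<open>t\<close> is a hermitian matrix of rank one. It is positive because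
  \<open>t c c = (\<Sum>k. t c c * t (i, k) (i, k)) = (\<Sum>k. \<bar>t c (i, k)\<bar>\<^sup>2)\<close>, where \<open>i\<close> is the row index of \<open>c\<close>.
\<close>

lemma character_point:
  assumes \<phi>: "even.character \<phi>"
  obtains z where "z \<in> unitary_on I" "\<And>a b. \<phi> (e a * e b) = entry z a * cnj (entry z b)"
proof -
  define t where "t a b = \<phi> (e a * e b)" for a b
  have t_swap: "t a b * t c d = t a d * t c b" for a b c d
  proof -
    have "e a * e b * (e c * e d) = e a * e d * (e c * e b)"
      using half[of b c d] by (simp add: mult.assoc)
    then show ?thesis
      unfolding t_def using even.character_mult[OF \<phi> pair_mem pair_mem] by metis
  qed
  have t_cnj: "cnj (t a b) = t b a" for a b
    using even.character_adj[OF \<phi> pair_mem, of a b] by (simp add: t_def adj_mult)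
  have \<phi>_sum: "\<phi> (\<Sum>k\<in>S. x k) = (\<Sum>k\<in>S. \<phi> (x k))" if "\<And>k. x k \<in> range ev" for S :: "'n set" and x
  proof -
    have "(\<Sum>k\<in>S. x k) \<in> range ev \<and> \<phi> (\<Sum>k\<in>S. x k) = (\<Sum>k\<in>S. \<phi> (x k))"
    proof (induction S rule: infinite_finite_induct)
      case empty
      have "\<phi> (scaleC 0 1) = 0"
        using even.character_scaleC[OF \<phi> even.one_mem, of 0] by simp
      moreover have "0 \<in> range ev"
        using even.scaleC_mem[OF even.one_mem, of 0] by simp
      ultimately show ?case by simp
    qed (use even.character_add[OF \<phi>] even.add_mem that in auto)
    then show ?thesis ..
  qed
  have \<phi>_delta: "\<phi> (if P then 1 else 0) = (if P then 1 else 0)" for P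
    using even.character_one[OF \<phi>] \<phi>_sum[of "\<lambda>_. 1" "{}"] even.one_mem by simp
  have t_rows: "(\<Sum>k\<in>UNIV. t (i, k) (j, k)) = (if i = j \<and> i \<in> I then 1 else 0)" for i j
    unfolding t_def using \<phi>_sum[of "\<lambda>k. e (i, k) * e (j, k)" UNIV] pair_mem e_rows \<phi>_delta by simp
  have t_columns: "(\<Sum>k\<in>UNIV. t (k, i) (k, j)) = (if i = j \<and> i \<in> I then 1 else 0)" for i j
    unfolding t_def using \<phi>_sum[of "\<lambda>k. e (k, i) * e (k, j)" UNIV] pair_mem e_columns \<phi>_delta by simp
  \<comment> \<open>a matrix with \<open>t_swap\<close> and \<open>t_cnj\<close> has rank at most one\<close>
  obtain f where f: "\<And>a b. t a b = f a * cnj (f b)"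
  proof (cases "\<forall>c. t c c = 0")
    case True
    have "t a b = 0" for a b
    proof -
      have "t a b * cnj (t a b) = 0" using t_swap[of a b b a] True by (simp add: t_cnj)
      then show ?thesis by simp
    qed
    then show thesis using that[of "\<lambda>_. 0"] by simp
  next
    case False
    then obtain i j where c: "t (i, j) (i, j) \<noteq> 0" by (metis surj_pair)
    let ?c = "(i, j)"
    have "i \<in> I"
    proof (rule ccontr)
      assume "i \<notin> I"
      then have "e ?c = 0" by (simp add: e_zero)
      then show False using c even.character_scaleC[OF \<phi> even.one_mem, of 0] by (simp add: t_def)
    qed
    have "t ?c ?c = t ?c ?c * (\<Sum>k\<in>UNIV. t (i, k) (i, k))"
      using \<open>i \<in> I\<close> by (simp add: t_rows)
    also have "\<dots> = (\<Sum>k\<in>UNIV. t ?c (i, k) * cnj (t ?c (i, k)))"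
      unfolding sum_distrib_left t_cnj using t_swap[of ?c ?c "(i, _)" "(i, _)"] by (intro sum.cong refl)
    also have "\<dots> = of_real (\<Sum>k\<in>UNIV. (cmod (t ?c (i, k)))\<^sup>2)"
      by (simp only: complex_norm_square of_real_sum)
    finally have tc: "t ?c ?c = of_real (\<Sum>k\<in>UNIV. (cmod (t ?c (i, k)))\<^sup>2)" .
    define r where "r = (\<Sum>k\<in>UNIV. (cmod (t ?c (i, k)))\<^sup>2)"
    have "r \<ge> 0" by (simp add: r_def sum_nonneg)
    moreover have r: "t ?c ?c = of_real r" using tc by (simp only: r_def)
    ultimately have r0: "r > 0" using c by (cases "r = 0") auto
    have "t a b = (t a ?c / of_real (sqrt r)) * cnj (t b ?c / of_real (sqrt r))" for a b
    proof -
      have "(t a ?c / of_real (sqrt r)) * cnj (t b ?c / of_real (sqrt r)) = t a ?c * t ?c b / of_real (sqrt r * sqrt r)"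
        by (simp add: t_cnj del: real_sqrt_mult_self)
      also have "t a ?c * t ?c b = t a b * of_real r"
        using t_swap[of a ?c ?c b] r by simp
      also have "complex_of_real (sqrt r * sqrt r) = of_real r"
        using r0 by simp
      finally show ?thesis using r0 by simp
    qed
    then show thesis by (rule that)
  qed
  define z :: "complex^'n^'n" where "z = (\<chi> i j. f (i, j))"
  have z: "entry z = f" by (auto simp: entry_def z_def)
  have "z \<in> unitary_on I"
    unfolding unitary_on_def
  proof (intro CollectI conjI matrix_eqI)
    fix i j
    have "(z ** cadj z) $ i $ j = (\<Sum>k\<in>UNIV. t (i, k) (j, k))"
      by (simp add: mat_entries z_def f)
    then show "(z ** cadj z) $ i $ j = proj I $ i $ j" by (simp add: t_rows proj_def)
    have "(cadj z ** z) $ i $ j = (\<Sum>k\<in>UNIV. t (k, j) (k, i))"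
      by (simp add: mat_entries z_def f mult.commute)
    then show "(cadj z ** z) $ i $ j = proj I $ i $ j" by (auto simp: t_columns proj_def)
  qed
  then show thesis using that[of z] f by (simp add: z t_def)
qed

lemma character_spectrum:
  assumes \<phi>: "even.character \<phi>"
  obtains z where "z \<in> spectrum" "\<And>q. \<phi> (ev q) = free_eval (pair_products (entry z)) q"
proof -
  obtain z where z: "z \<in> unitary_on I" "\<And>a b. \<phi> (e a * e b) = entry z a * cnj (entry z b)"
    using character_point[OF \<phi>] by blast
  have "(\<lambda>x. \<phi> (pair_products e x)) = pair_products (entry z)"
    using z by (auto simp: pair_products_def)
  moreover have "pair_products e x \<in> range ev" for x
    by (metis free_eval_gen rangeI)
  ultimately have q: "\<phi> (ev q) = free_eval (pair_products (entry z)) q" for q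
    using even.character_free_eval(1)[OF \<phi>, of "pair_products e" q] by simp
  then have "z \<in> spectrum"
    using z even.character_le_norm[OF \<phi>] by (auto simp: spectrum_def) (metis rangeI)
  from this q show thesis by (rule that)
qed

lemma norm_attained:
  obtains z where "z \<in> spectrum" "norm (ev q) = cmod (free_eval (pair_products (entry z)) q)"
proof -
  obtain \<phi> where "even.character \<phi>" "cmod (\<phi> (ev q)) = norm (ev q)"
    using even.character_attains_norm[of "ev q"] by blast
  then show thesis
    using character_spectrum[of \<phi>] that by metis
qed

lemma spectrum_closed: "closed spectrum"
proof -
  have c: "continuous_on UNIV (\<lambda>z :: complex^'n^'n. free_eval (pair_products (entry z)) q)" for q
  proof (induction q rule: free_eval_induct)
    case (gen x p)
    have "continuous_on UNIV (\<lambda>z :: complex^'n^'n. pair_products (entry z) x)"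
      "continuous_on UNIV (\<lambda>z :: complex^'n^'n. cnj (pair_products (entry z) x))"
      unfolding pair_products_def entry_def case_prod_unfold complex_cstar_simps
      by (intro continuous_intros)+
    then show ?case
      unfolding free_eval_mult free_eval_gen free_eval_star complex_cstar_simps
      using gen by (intro conjI continuous_on_mult)
  qed (simp_all add: free_eval_const free_eval_add continuous_on_add)
  have "closed {z. cmod (free_eval (pair_products (entry z)) q) \<le> norm (ev q)}" for q
    by (intro closed_Collect_le continuous_intros c)
  moreover have "closed (unitary_on I)"
  proof -
    have "unitary_on I = {z. (\<forall>i j. (\<Sum>k\<in>UNIV. z $ i $ k * cnj (z $ j $ k)) = proj I $ i $ j) \<and>
        (\<forall>i j. (\<Sum>k\<in>UNIV. cnj (z $ k $ i) * z $ k $ j) = proj I $ i $ j)}"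
      by (auto simp: unitary_on_def vec_eq_iff matrix_matrix_mult_def cadj_def)
    also have "closed \<dots>"
      by (intro closed_Collect_conj closed_Collect_all closed_Collect_eq continuous_intros)
    finally show ?thesis .
  qed
  ultimately have "closed (unitary_on I \<inter> (\<Inter>q. {z. cmod (free_eval (pair_products (entry z)) q) \<le> norm (ev q)}))"
    by (intro closed_Int closed_INT) auto
  also have "unitary_on I \<inter> (\<Inter>q. {z. cmod (free_eval (pair_products (entry z)) q) \<le> norm (ev q)}) = spectrum"
    by (auto simp: spectrum_def)
  finally show ?thesis .
qed

lemma spectrum_phase:
  assumes "cmod c = 1" "z \<in> spectrum"
  shows "cscale c z \<in> spectrum"
proof -
  have cc: "c * cnj c = 1" using assms(1) complex_norm_square[of c] by simp
  have "c * x * cnj (c * y) = (c * cnj c) * (x * cnj y)" for x y by simp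
  then have c: "c * x * cnj (c * y) = x * cnj y" for x y using cc by simp
  then have "pair_products (entry (cscale c z)) = pair_products (entry z)"
    by (auto simp: pair_products_def entry_def cscale_def)
  moreover have "cscale c z \<in> unitary_on I"
  proof -
    have "cscale c z ** cadj (cscale c z) = z ** cadj z"
      by (rule matrix_eqI) (simp only: mat_entries vec_lambda_beta c)
    moreover have c': "cnj (c * x) * (c * y) = cnj x * y" for x y
      using c[of y x] by (simp add: mult.commute)
    have "cadj (cscale c z) ** cscale c z = cadj z ** z"
      by (rule matrix_eqI) (simp only: mat_entries vec_lambda_beta c')
    ultimately show ?thesis using spectrum_unitary[OF assms(2)] by (simp add: unitary_on_def)
  qed
  ultimately show ?thesis using assms(2) by (simp add: spectrum_def)
qed

definition swapped :: "('n \<times> 'n) \<times> ('n \<times> 'n) \<Rightarrow> 'a"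
  where "swapped = (\<lambda>(x, y). pair_products e (y, x))"

lemma e_intertwines: "e c * ev p = free_eval swapped p * e c"
  by (rule free_eval_intertwine) (simp_all add: pair_products_def swapped_def case_prod_unfold adj_mult half mult.assoc[symmetric])

lemma swapped_substitute: "free_eval swapped p = ev (substitute (\<lambda>(x, y). gen (y, x)) p)"
proof -
  have "(\<lambda>x. ev ((\<lambda>(x, y). gen (y, x)) x)) = swapped"
    by (auto simp: swapped_def free_eval_gen)
  then show ?thesis by (simp add: free_eval_substitute)
qed

text \<open>
  \<open>\<Sum>k. e (i, k) * x * e (i, k)\<close> turns \<open>x = ev q\<close> into the polynomial with swapped factors. The
  obvious bound of this map depends on the number of indices; the power trick improves it to one.
\<close>

lemma norm_swapped_le: "norm (free_eval swapped q) \<le> norm (ev q)"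
proof (cases "I = {}")
  case True
  then have "swapped = pair_products e"
    using e_zero by (auto simp: swapped_def pair_products_def)
  then show ?thesis by simp
next
  case False
  then obtain i where i: "i \<in> I" by blast
  show ?thesis
  proof (rule norm_le_by_power_trick)
    fix p
    have "free_eval swapped p = free_eval swapped p * (\<Sum>k\<in>UNIV. e (i, k) * e (i, k))"
      using i by (simp add: e_rows)
    also have "\<dots> = (\<Sum>k\<in>UNIV. e (i, k) * ev p * e (i, k))"
      by (simp add: sum_distrib_left mult.assoc[symmetric] e_intertwines)
    also have "norm \<dots> \<le> (\<Sum>k\<in>UNIV. norm (e (i, k)) * norm (ev p) * norm (e (i, k)))"
      by (intro sum_norm_le order_trans[OF norm_mult_ineq] mult_right_mono norm_mult_ineq norm_ge_zero)
    also have "\<dots> = (\<Sum>k\<in>UNIV. norm (e (i, k)) * norm (e (i, k))) * norm (ev p)"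
      by (simp add: sum_distrib_left sum_distrib_right mult_ac)
    finally show "norm (free_eval swapped p) \<le> (\<Sum>k\<in>UNIV. norm (e (i, k)) * norm (e (i, k))) * norm (ev p)" .
  qed
qed

lemma spectrum_conj:
  assumes z: "z \<in> spectrum"
  shows "conj_mat z \<in> spectrum"
proof -
  let ?s = "substitute (\<lambda>(x, y). gen (y, x))"
  have "pair_products (entry (conj_mat z)) = (\<lambda>x. free_eval (pair_products (entry z)) ((\<lambda>(x, y). gen (y, x)) x))"
    by (auto simp: pair_products_def entry_def conj_mat_def free_eval_gen mult.commute)
  then have "free_eval (pair_products (entry (conj_mat z))) q = free_eval (pair_products (entry z)) (?s q)" for q
    by (simp add: free_eval_substitute)
  then have "cmod (free_eval (pair_products (entry (conj_mat z))) q) \<le> norm (ev q)" for q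
    using spectrum_bound[OF z, of "?s q"] norm_swapped_le[of q] by (simp add: swapped_substitute)
  moreover have "conj_mat z \<in> unitary_on I"
  proof -
    have "conj_mat z ** cadj (conj_mat z) = conj_mat (z ** cadj z)"
      "cadj (conj_mat z) ** conj_mat z = conj_mat (cadj z ** z)"
      unfolding conj_mat_mult by (simp_all add: cadj_def conj_mat_def)
    moreover have "conj_mat (proj I) = (proj I :: complex^'n^'n)"
      by (rule matrix_eqI) (auto simp: mat_entries)
    ultimately show ?thesis using spectrum_unitary[OF z] by (simp add: unitary_on_def)
  qed
  ultimately show ?thesis by (simp add: spectrum_def)
qed

lemma commute_if_spectrum_real:
  assumes "\<And>z a b. z \<in> spectrum \<Longrightarrow> entry z a * cnj (entry z b) = entry z b * cnj (entry z a)"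
  shows "e a * e b = e b * e a"
proof -
  let ?q = "gen (a, b) - gen (b, a)"
  obtain z where z: "z \<in> spectrum" "norm (ev ?q) = cmod (free_eval (pair_products (entry z)) ?q)"
    using norm_attained by blast
  then have "norm (ev ?q) = 0"
    using assms[OF z(1)] by (simp add: free_eval_diff free_eval_gen pair_products_def)
  then show ?thesis
    by (simp add: free_eval_diff free_eval_gen pair_products_def)
qed

end

text \<open>
  The norm is attained at a character, which takes real values on the self-adjoint \<open>v i j\<close> and so is
  given by an orthogonal matrix.
\<close>

lemma half_liberated_commuting_norm:
  fixes v :: "'a::cstar_algebra^'n::finite^'n"
  assumes "half_liberated I v" and comm: "\<And>a b. entry v a * entry v b = entry v b * entry v a"
  obtains g where "g \<in> orthogonal_on I" "norm (free_eval (entry v) p) = cmod (free_eval (entry (cmat g)) p)"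
proof -
  interpret half_liberated I v by fact
  interpret A: commutative_star_subalgebra "range (free_eval e)"
    by (rule commutative_star_subalgebra_range) (simp_all add: comm)
  obtain \<phi> where \<phi>: "A.character \<phi>" "cmod (\<phi> (free_eval e p)) = norm (free_eval e p)"
    using A.character_attains_norm[of "free_eval e p"] by blast
  have mem: "e a \<in> range (free_eval e)" for a
    by (metis free_eval_gen rangeI)
  define g :: "real^'n^'n" where "g = (\<chi> i j. Re (\<phi> (e (i, j))))"
  have real: "\<phi> (e a) = of_real (Re (\<phi> (e a)))" for a
    using A.character_adj[OF \<phi>(1) mem, of a] by (simp add: complex_eq_iff)
  have \<phi>g: "(\<lambda>a. \<phi> (e a)) = entry (cmat g)"
    using real by (auto simp: entry_def cmat_def g_def)
  have ev: "\<phi> (free_eval e q) = free_eval (entry (cmat g)) q" for q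
    using A.character_free_eval(1)[OF \<phi>(1), of e q] mem by (simp add: \<phi>g)
  have delta: "\<phi> (if P then 1 else 0) = (if P then 1 else 0)" for P
    using ev[of 0] A.character_one[OF \<phi>(1)] by (simp add: free_eval_zero)
  have of_real_if: "(if P then 1 else 0 :: complex) = of_real (if P then 1 else 0)" for P
    by simp
  have "of_real (\<Sum>k\<in>UNIV. g $ i $ k * g $ j $ k) = (of_real (if i = j \<and> i \<in> I then 1 else 0) :: complex)" for i j
  proof -
    have "of_real (\<Sum>k\<in>UNIV. g $ i $ k * g $ j $ k) = free_eval (entry (cmat g)) (\<Sum>k\<in>UNIV. gen (i, k) * gen (j, k))"
      by (simp add: free_eval_sum free_eval_mult free_eval_gen entry_def cmat_def)
    also have "\<dots> = \<phi> (\<Sum>k\<in>UNIV. e (i, k) * e (j, k))"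
      unfolding ev[symmetric] by (simp add: free_eval_sum free_eval_mult free_eval_gen)
    finally show ?thesis unfolding e_rows delta of_real_if .
  qed
  then have r: "(\<Sum>k\<in>UNIV. g $ i $ k * g $ j $ k) = (if i = j \<and> i \<in> I then 1 else 0)" for i j
    using of_real_eq_iff by blast
  have "of_real (\<Sum>k\<in>UNIV. g $ k $ i * g $ k $ j) = (of_real (if i = j \<and> i \<in> I then 1 else 0) :: complex)" for i j
  proof -
    have "of_real (\<Sum>k\<in>UNIV. g $ k $ i * g $ k $ j) = free_eval (entry (cmat g)) (\<Sum>k\<in>UNIV. gen (k, i) * gen (k, j))"
      by (simp add: free_eval_sum free_eval_mult free_eval_gen entry_def cmat_def)
    also have "\<dots> = \<phi> (\<Sum>k\<in>UNIV. e (k, i) * e (k, j))"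
      unfolding ev[symmetric] by (simp add: free_eval_sum free_eval_mult free_eval_gen)
    finally show ?thesis unfolding e_columns delta of_real_if .
  qed
  then have c: "(\<Sum>k\<in>UNIV. g $ k $ i * g $ k $ j) = (if i = j \<and> i \<in> I then 1 else 0)" for i j
    using of_real_eq_iff by blast
  have "g \<in> orthogonal_on I"
    unfolding orthogonal_on_def
    by (intro CollectI conjI matrix_eqI)
      (simp_all add: matrix_matrix_mult_def transpose_def proj_def r c)
  then show thesis using that \<phi>(2) ev by simp
qed

section \<open>Peak functions and the spectrum of the tensor square\<close>

text \<open>
  On unitary matrices this is at most one, and one only if \<open>y\<close> agrees with \<open>z\<close> up to a phase,
  that is, if both define the same character. It is the Cauchy-Schwarz inequality for the trace.
\<close>

definition peak_value :: "'n set \<Rightarrow> complex^'n::finite^'n \<Rightarrow> complex^'n^'n \<Rightarrow> real"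
  where "peak_value I z y = (cmod (\<Sum>a\<in>UNIV. cnj (entry z a) * entry y a) / real (card I))\<^sup>2"

definition peak :: "'n set \<Rightarrow> complex^'n::finite^'n \<Rightarrow> (('n \<times> 'n) \<times> ('n \<times> 'n)) free_star_algebra"
  where "peak I z = const (of_real (1 / (real (card I))\<^sup>2)) *
    (\<Sum>a\<in>UNIV. \<Sum>b\<in>UNIV. const (cnj (entry z a) * entry z b) * gen (a, b))"

lemma free_eval_peak:
  "free_eval (pair_products (entry y)) (peak I z) = of_real (peak_value I z y)"
proof -
  define s where "s = (\<Sum>a\<in>UNIV. cnj (entry z a) * entry y a)"
  have "free_eval (pair_products (entry y)) (peak I z) =
      of_real (1 / (real (card I))\<^sup>2) * (\<Sum>a\<in>UNIV. \<Sum>b\<in>UNIV. cnj (entry z a) * entry z b * (entry y a * cnj (entry y b)))"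
    by (simp add: peak_def free_eval_const_mult free_eval_sum free_eval_gen pair_products_def)
  also have "(\<Sum>a\<in>UNIV. \<Sum>b\<in>UNIV. cnj (entry z a) * entry z b * (entry y a * cnj (entry y b))) = s * cnj s"
    by (simp add: s_def sum_product mult_ac)
  also have "s * cnj s = of_real ((cmod s)\<^sup>2)"
    by (rule complex_norm_square[symmetric])
  finally show ?thesis
    by (simp add: peak_value_def s_def power_divide)
qed

lemma unitary_square_sum:
  assumes "z \<in> unitary_on I"
  shows "(\<Sum>a\<in>UNIV. entry z a * cnj (entry z a)) = of_nat (card I)"
proof -
  have "(\<Sum>a\<in>UNIV. entry z a * cnj (entry z a)) = (\<Sum>i\<in>UNIV. \<Sum>k\<in>UNIV. z $ i $ k * cnj (z $ i $ k))"
    by (simp add: entry_def sum.cartesian_product case_prod_unfold)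
  also have "\<dots> = (\<Sum>i\<in>UNIV. (z ** cadj z) $ i $ i)"
    by (simp add: mat_entries)
  also have "\<dots> = (\<Sum>i\<in>UNIV. if i \<in> I then 1 else 0)"
    by (simp add: unitary_onD[OF assms] proj_def)
  finally show ?thesis by (simp add: sum.If_cases)
qed

lemma
  assumes y: "y \<in> unitary_on I" and z: "z \<in> unitary_on I" and ne: "I \<noteq> {}"
  shows peak_value_le: "peak_value I z y \<le> 1"
    and peak_value_eq_1: "peak_value I z y = 1 \<Longrightarrow> entry y a * cnj (entry y b) = entry z a * cnj (entry z b)"
proof -
  define N where "N = real (card I)"
  have N: "N > 0" using ne by (simp add: N_def card_gt_0_iff)
  define s where "s = (\<Sum>a\<in>UNIV. cnj (entry z a) * entry y a)"
  define c where "c = s / of_real N"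
  have sN: "s = c * of_real N" using N by (simp add: c_def)
  have cnj_s: "(\<Sum>a\<in>UNIV. entry z a * cnj (entry y a)) = cnj s"
    by (simp add: s_def)
  have "complex_of_real (\<Sum>a\<in>UNIV. (cmod (entry y a - c * entry z a))\<^sup>2) =
      (\<Sum>a\<in>UNIV. (entry y a - c * entry z a) * cnj (entry y a - c * entry z a))"
    by (simp only: of_real_sum complex_norm_square)
  also have "\<dots> = (\<Sum>a\<in>UNIV. entry y a * cnj (entry y a)) - c * (\<Sum>a\<in>UNIV. entry z a * cnj (entry y a))
      - cnj c * (\<Sum>a\<in>UNIV. cnj (entry z a) * entry y a) + c * cnj c * (\<Sum>a\<in>UNIV. entry z a * cnj (entry z a))"
    by (simp add: sum_distrib_left sum_subtractf sum.distrib algebra_simps)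
  also have "\<dots> = of_real N - c * cnj s - cnj c * s + c * cnj c * of_real N"
    unfolding unitary_square_sum[OF y] unitary_square_sum[OF z] cnj_s s_def[symmetric] N_def by simp
  also have "\<dots> = of_real N * (1 - c * cnj c)"
    by (simp add: sN algebra_simps)
  also have "\<dots> = of_real (N * (1 - (cmod c)\<^sup>2))"
    by (simp add: complex_norm_square del: of_real_power)
  finally have eq: "(\<Sum>a\<in>UNIV. (cmod (entry y a - c * entry z a))\<^sup>2) = N * (1 - (cmod c)\<^sup>2)"
    using of_real_eq_iff by blast
  have pv: "peak_value I z y = (cmod c)\<^sup>2"
    using N by (simp add: peak_value_def c_def s_def N_def norm_divide)
  have "0 \<le> N * (1 - (cmod c)\<^sup>2)"
    unfolding eq[symmetric] by (intro sum_nonneg) simp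
  then show "peak_value I z y \<le> 1"
    using N pv by (simp add: zero_le_mult_iff)
  assume "peak_value I z y = 1"
  then have c1: "(cmod c)\<^sup>2 = 1" using pv by simp
  then have "(\<Sum>a\<in>UNIV. (cmod (entry y a - c * entry z a))\<^sup>2) = 0" using eq by simp
  then have "entry y a = c * entry z a" for a
    by (cases a) (simp add: sum_nonneg_eq_0_iff)
  moreover have "c * cnj c = 1"
    using c1 by (simp add: complex_norm_square[symmetric] del: of_real_power)
  moreover have "c * entry z a * cnj (c * entry z b) = (c * cnj c) * (entry z a * cnj (entry z b))"
    by simp
  ultimately show "entry y a * cnj (entry y b) = entry z a * cnj (entry z b)"
    by simp
qed

lemma peak_value_self:
  assumes "z \<in> unitary_on I" and ne: "I \<noteq> {}"
  shows "peak_value I z z = 1"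
proof -
  have "(\<Sum>a\<in>UNIV. cnj (entry z a) * entry z a) = of_nat (card I)"
    using unitary_square_sum[OF assms(1)] by (simp add: mult.commute)
  then show ?thesis using ne by (simp add: peak_value_def)
qed

lemma peak_value_nonneg: "0 \<le> peak_value I z y"
  by (simp add: peak_value_def)

text \<open>
  The Bernstein polynomials of a continuous function \<open>f\<close> serve as a functional calculus: applied to an
  element of the even part with spectrum in the unit interval, they converge to \<open>f\<close> of that element.
\<close>

definition bernstein :: "(real \<Rightarrow> real) \<Rightarrow> nat \<Rightarrow> 'x free_star_algebra \<Rightarrow> 'x free_star_algebra"
  where "bernstein f n p = (\<Sum>k\<le>n. const (of_real (f (real k / real n) * real (n choose k))) * (p ^ k * (1 - p) ^ (n - k)))"

lemma free_eval_bernstein: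
  fixes y :: "'x \<Rightarrow> complex"
  assumes "free_eval y p = of_real t"
  shows "free_eval y (bernstein f n p) = of_real (\<Sum>k\<le>n. f (real k / real n) * Bernstein n k t)"
  by (simp add: bernstein_def free_eval_sum free_eval_const free_eval_mult free_eval_power
      free_eval_diff free_eval_one assms)
    (simp add: Bernstein_def mult_ac)

text \<open>
  The index set is nonempty, so that \<open>peak\<close> has the value one at its centre.
\<close>

locale tensor_square = half_liberated I v for I :: "'n::finite set" and v :: "'a::cstar_algebra^'n^'n" +
  fixes \<iota>\<^sub>1 \<iota>\<^sub>2 :: "'a \<Rightarrow> 't::cstar_algebra"
  assumes hom1: "cstar_hom \<iota>\<^sub>1" and hom2: "cstar_hom \<iota>\<^sub>2"
    and commuting: "\<iota>\<^sub>1 x * \<iota>\<^sub>2 y = \<iota>\<^sub>2 y * \<iota>\<^sub>1 x"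
    and no_zero_divisors: "\<iota>\<^sub>1 x * \<iota>\<^sub>2 y = 0 \<Longrightarrow> x = 0 \<or> y = 0"
    and nonempty: "I \<noteq> {}"
begin

text \<open>
  The two copies of the even part generate a commutative algebra, to which the results on characters
  apply.
\<close>

definition joint :: "(('n \<times> 'n) \<times> ('n \<times> 'n)) + (('n \<times> 'n) \<times> ('n \<times> 'n)) \<Rightarrow> 't"
  where "joint = case_sum (\<lambda>x. \<iota>\<^sub>1 (pair_products e x)) (\<lambda>x. \<iota>\<^sub>2 (pair_products e x))"

lemma pair_products_mem: "pair_products e x \<in> range ev"
  by (metis free_eval_gen rangeI)

lemma joint_commute: "joint x * joint y = joint y * joint x" "joint x * adj (joint y) = adj (joint y) * joint x"
proof -
  have i1: "\<iota>\<^sub>1 a * \<iota>\<^sub>1 b = \<iota>\<^sub>1 b * \<iota>\<^sub>1 a" if "a \<in> range ev" "b \<in> range ev" for a b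
    using even.commute[OF that] by (simp add: cstar_hom_mult[OF hom1, symmetric])
  have i2: "\<iota>\<^sub>2 a * \<iota>\<^sub>2 b = \<iota>\<^sub>2 b * \<iota>\<^sub>2 a" if "a \<in> range ev" "b \<in> range ev" for a b
    using even.commute[OF that] by (simp add: cstar_hom_mult[OF hom2, symmetric])
  let ?W = "\<iota>\<^sub>1 ` range ev \<union> \<iota>\<^sub>2 ` range ev"
  have W: "w * w' = w' * w" if w: "w \<in> ?W" "w' \<in> ?W" for w w'
  proof -
    from w consider a b where "w = \<iota>\<^sub>1 a" "w' = \<iota>\<^sub>1 b" "a \<in> range ev" "b \<in> range ev"
      | a b where "w = \<iota>\<^sub>2 a" "w' = \<iota>\<^sub>2 b" "a \<in> range ev" "b \<in> range ev"
      | a b where "w = \<iota>\<^sub>1 a" "w' = \<iota>\<^sub>2 b" | a b where "w = \<iota>\<^sub>2 a" "w' = \<iota>\<^sub>1 b"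
      by blast
    then show ?thesis
    proof cases
      case 1
      then show ?thesis by (simp add: i1)
    next
      case 2
      then show ?thesis by (simp add: i2)
    qed (simp_all add: commuting)
  qed
  have mem: "joint x \<in> ?W" for x
    using pair_products_mem by (cases x) (auto simp: joint_def)
  have adj_W: "adj w \<in> ?W" if "w \<in> ?W" for w
    using that even.adj_mem
    by (elim UnE imageE) (simp_all add: cstar_hom_adj[OF hom1, symmetric] cstar_hom_adj[OF hom2, symmetric])
  show "joint x * joint y = joint y * joint x"
    by (rule W[OF mem mem])
  show "joint x * adj (joint y) = adj (joint y) * joint x"
    by (rule W[OF mem adj_W[OF mem]])
qed

sublocale joint: commutative_star_subalgebra "range (free_eval joint)"
  by (rule commutative_star_subalgebra_range) (rule joint_commute)+

lemma \<iota>\<^sub>1_ev: "\<iota>\<^sub>1 (ev q) = free_eval joint (substitute (\<lambda>x. gen (Inl x)) q)"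
  by (simp add: cstar_hom_free_eval[OF hom1] free_eval_substitute free_eval_gen joint_def)

lemma \<iota>\<^sub>2_ev: "\<iota>\<^sub>2 (ev q) = free_eval joint (substitute (\<lambda>x. gen (Inr x)) q)"
  by (simp add: cstar_hom_free_eval[OF hom2] free_eval_substitute free_eval_gen joint_def)

lemma \<iota>\<^sub>1_mem: "x \<in> range ev \<Longrightarrow> \<iota>\<^sub>1 x \<in> range (free_eval joint)"
  using \<iota>\<^sub>1_ev by auto

lemma \<iota>\<^sub>2_mem: "x \<in> range ev \<Longrightarrow> \<iota>\<^sub>2 x \<in> range (free_eval joint)"
  using \<iota>\<^sub>2_ev by auto

lemma joint_character_restrict:
  assumes \<psi>: "joint.character \<psi>" and hom: "cstar_hom \<iota>"
    and mem: "\<And>x. x \<in> range ev \<Longrightarrow> \<iota> x \<in> range (free_eval joint)"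
  shows "even.character (\<lambda>x. \<psi> (\<iota> x))"
  unfolding even.character_def
proof (intro conjI ballI allI)
  show "\<psi> (\<iota> 1) = 1"
    by (simp add: cstar_hom_one[OF hom] joint.character_one[OF \<psi>])
  fix x c assume x: "x \<in> range ev"
  show "\<psi> (\<iota> (scaleC c x)) = c * \<psi> (\<iota> x)"
    by (simp add: cstar_hom_scaleC[OF hom] joint.character_scaleC[OF \<psi> mem[OF x]])
  show "\<psi> (\<iota> (adj x)) = cnj (\<psi> (\<iota> x))"
    by (simp add: cstar_hom_adj[OF hom] joint.character_adj[OF \<psi> mem[OF x]])
  show "cmod (\<psi> (\<iota> x)) \<le> norm x"
    using joint.character_le_norm[OF \<psi> mem[OF x]] cstar_hom_contractive[OF hom, of x] by linarith
  fix y assume y: "y \<in> range ev"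
  show "\<psi> (\<iota> (x + y)) = \<psi> (\<iota> x) + \<psi> (\<iota> y)"
    by (simp add: cstar_hom_add[OF hom] joint.character_add[OF \<psi> mem[OF x] mem[OF y]])
  show "\<psi> (\<iota> (x * y)) = \<psi> (\<iota> x) * \<psi> (\<iota> y)"
    by (simp add: cstar_hom_mult[OF hom] joint.character_mult[OF \<psi> mem[OF x] mem[OF y]])
qed

lemma joint_character_points:
  assumes \<psi>: "joint.character \<psi>"
  shows "\<exists>y\<in>spectrum. \<exists>y'\<in>spectrum.
    (\<forall>q. \<psi> (\<iota>\<^sub>1 (ev q)) = free_eval (pair_products (entry y)) q) \<and>
    (\<forall>q. \<psi> (\<iota>\<^sub>2 (ev q)) = free_eval (pair_products (entry y')) q)"
proof -
  have "\<exists>y\<in>spectrum. \<forall>q. \<phi> (ev q) = free_eval (pair_products (entry y)) q"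
    if "even.character \<phi>" for \<phi>
    by (rule character_spectrum[OF that]) blast
  from this[OF joint_character_restrict[OF \<psi> hom1 \<iota>\<^sub>1_mem]]
    this[OF joint_character_restrict[OF \<psi> hom2 \<iota>\<^sub>2_mem]]
  show ?thesis by blast
qed

lemma bernstein_convergent:
  assumes f: "continuous_on {0..1} f" and z: "z \<in> unitary_on I"
  shows "convergent (\<lambda>n. ev (bernstein f n (peak I z)))"
proof -
  have "Cauchy (\<lambda>n. ev (bernstein f n (peak I z)))"
  proof (rule metric_CauchyI)
    fix \<epsilon> :: real assume "\<epsilon> > 0"
    then obtain N where N: "\<And>n x. N \<le> n \<Longrightarrow> x \<in> {0..1} \<Longrightarrow>
        \<bar>f x - (\<Sum>k\<le>n. f (real k / real n) * Bernstein n k x)\<bar> < \<epsilon> / 2"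
      using Bernstein_Weierstrass[OF f, of "\<epsilon> / 2"] by auto
    have "dist (ev (bernstein f m (peak I z))) (ev (bernstein f n (peak I z))) < \<epsilon>"
      if mn: "m \<ge> N" "n \<ge> N" for m n
    proof -
      let ?q = "bernstein f m (peak I z) - bernstein f n (peak I z)"
      obtain y where y: "y \<in> spectrum" "norm (ev ?q) = cmod (free_eval (pair_products (entry y)) ?q)"
        using norm_attained by blast
      define t where "t = peak_value I z y"
      have t: "t \<in> {0..1}"
        using peak_value_le[OF spectrum_unitary[OF y(1)] z nonempty] by (simp add: t_def peak_value_nonneg)
      have "norm (ev ?q) = \<bar>(\<Sum>k\<le>m. f (real k / real m) * Bernstein m k t) - (\<Sum>k\<le>n. f (real k / real n) * Bernstein n k t)\<bar>"
      proof -
        have "free_eval (pair_products (entry y)) ?q = of_real ((\<Sum>k\<le>m. f (real k / real m) * Bernstein m k t) -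
            (\<Sum>k\<le>n. f (real k / real n) * Bernstein n k t))"
          unfolding free_eval_diff free_eval_bernstein[OF free_eval_peak] t_def by (simp only: of_real_diff)
        then show ?thesis unfolding y(2) by (simp only: norm_of_real)
      qed
      also have "\<dots> < \<epsilon>" using N[OF mn(1) t] N[OF mn(2) t] by linarith
      finally show ?thesis by (simp add: dist_norm free_eval_diff)
    qed
    then show "\<exists>M. \<forall>m\<ge>M. \<forall>n\<ge>M. dist (ev (bernstein f m (peak I z))) (ev (bernstein f n (peak I z))) < \<epsilon>"
      by blast
  qed
  then show ?thesis by (rule Cauchy_convergent)
qed

lemma bernstein_limit_nonzero:
  assumes f: "continuous_on {0..1} f" "f 1 \<noteq> 0" and z: "z \<in> spectrum"
    and lim: "(\<lambda>n. ev (bernstein f n (peak I z))) \<longlonglongrightarrow> l"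
  shows "l \<noteq> 0"
proof
  assume "l = 0"
  then have "(\<lambda>n. norm (ev (bernstein f n (peak I z)))) \<longlonglongrightarrow> 0"
    using tendsto_norm[OF lim] by simp
  then have "\<forall>\<^sub>F n in sequentially. norm (ev (bernstein f n (peak I z))) < \<bar>f 1\<bar> / 2"
    by (rule order_tendstoD(2)) (use f(2) in simp)
  then obtain M where M: "\<And>n. n \<ge> M \<Longrightarrow> norm (ev (bernstein f n (peak I z))) < \<bar>f 1\<bar> / 2"
    unfolding eventually_sequentially by blast
  obtain N where N: "\<And>n x. N \<le> n \<Longrightarrow> x \<in> {0..1} \<Longrightarrow>
      \<bar>f x - (\<Sum>k\<le>n. f (real k / real n) * Bernstein n k x)\<bar> < \<bar>f 1\<bar> / 2"
    using Bernstein_Weierstrass[OF f(1), of "\<bar>f 1\<bar> / 2"] f(2) by auto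
  define n where "n = max M N"
  have n: "n \<ge> N" "norm (ev (bernstein f n (peak I z))) < \<bar>f 1\<bar> / 2"
    using M[of n] by (simp_all add: n_def)
  have "\<bar>\<Sum>k\<le>n. f (real k / real n) * Bernstein n k 1\<bar> \<le> norm (ev (bernstein f n (peak I z)))"
    using spectrum_bound[OF z, of "bernstein f n (peak I z)"]
    unfolding free_eval_bernstein[OF free_eval_peak] peak_value_self[OF spectrum_unitary[OF z] nonempty]
    by (simp only: norm_of_real)
  moreover have "\<bar>f 1 - (\<Sum>k\<le>n. f (real k / real n) * Bernstein n k 1)\<bar> < \<bar>f 1\<bar> / 2"
    using N[of n 1] n(1) by simp
  ultimately show False using n(2) by linarith
qed

text \<open>
  Let \<open>c\<close> be the norm of the tensor product of the two peak elements. If \<open>c < 1\<close>, a continuous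
  function \<open>f\<close> vanishing on \<open>[0, sqrt c]\<close> kills one of the two factors at every character, so that the
  tensor product of the two elements obtained by applying \<open>f\<close> is zero although neither of them is.
  Hence \<open>c = 1\<close>, and the character at which the norm is attained has the value one on both factors.
\<close>

lemma joint_peak:
  assumes z: "z \<in> spectrum" and z': "z' \<in> spectrum"
  obtains \<psi> where "joint.character \<psi>" "\<psi> (\<iota>\<^sub>1 (ev (peak I z))) = 1" "\<psi> (\<iota>\<^sub>2 (ev (peak I z'))) = 1"
proof -
  note U = spectrum_unitary[OF z] spectrum_unitary[OF z']
  define x where "x = \<iota>\<^sub>1 (ev (peak I z)) * \<iota>\<^sub>2 (ev (peak I z'))"
  define c where "c = norm x"
  have x_mem: "\<iota>\<^sub>1 (ev p) * \<iota>\<^sub>2 (ev q) \<in> range (free_eval joint)" for p q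
    by (intro joint.mult_mem \<iota>\<^sub>1_mem \<iota>\<^sub>2_mem rangeI)
  have xm: "x \<in> range (free_eval joint)"
    unfolding x_def by (rule x_mem)
  have point_values: "\<exists>s\<in>{0..1}. \<exists>t\<in>{0..1}. s * t \<le> c \<and> \<psi> (\<iota>\<^sub>1 (ev (peak I z))) = of_real s \<and>
      \<psi> (\<iota>\<^sub>2 (ev (peak I z'))) = of_real t \<and>
      (\<forall>f n. \<psi> (\<iota>\<^sub>1 (ev (bernstein f n (peak I z)))) = of_real (\<Sum>k\<le>n. f (real k / real n) * Bernstein n k s)) \<and>
      (\<forall>f n. \<psi> (\<iota>\<^sub>2 (ev (bernstein f n (peak I z')))) = of_real (\<Sum>k\<le>n. f (real k / real n) * Bernstein n k t))"
    if \<psi>: "joint.character \<psi>" for \<psi>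
  proof -
    obtain y y' where y0: "y \<in> spectrum" "y' \<in> spectrum"
      "\<forall>q. \<psi> (\<iota>\<^sub>1 (ev q)) = free_eval (pair_products (entry y)) q"
      "\<forall>q. \<psi> (\<iota>\<^sub>2 (ev q)) = free_eval (pair_products (entry y')) q"
      using joint_character_points[OF \<psi>] by blast
    note y = y0(1,2) y0(3,4)[rule_format]
    define s t where "s = peak_value I z y" and "t = peak_value I z' y'"
    have st: "s \<in> {0..1}" "t \<in> {0..1}"
      using peak_value_le[OF spectrum_unitary[OF y(1)] U(1) nonempty]
        peak_value_le[OF spectrum_unitary[OF y(2)] U(2) nonempty]
      by (auto simp: s_def t_def peak_value_nonneg)
    have v: "\<psi> (\<iota>\<^sub>1 (ev (peak I z))) = of_real s" "\<psi> (\<iota>\<^sub>2 (ev (peak I z'))) = of_real t"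
      by (simp_all add: y(3,4) free_eval_peak s_def t_def)
    have "\<psi> x = of_real (s * t)"
      unfolding x_def using joint.character_mult[OF \<psi> \<iota>\<^sub>1_mem \<iota>\<^sub>2_mem, OF rangeI rangeI] v by simp
    then have "s * t \<le> c"
      using joint.character_le_norm[OF \<psi> xm] st unfolding c_def by (simp add: abs_mult norm_mult)
    have b: "\<psi> (\<iota>\<^sub>1 (ev (bernstein f n (peak I z)))) = of_real (\<Sum>k\<le>n. f (real k / real n) * Bernstein n k s)"
      "\<psi> (\<iota>\<^sub>2 (ev (bernstein f n (peak I z')))) = of_real (\<Sum>k\<le>n. f (real k / real n) * Bernstein n k t)" for f n
      unfolding y(3,4) s_def t_def by (rule free_eval_bernstein[OF free_eval_peak])+
    show ?thesis
      by (rule bexI[OF _ st(1)], rule bexI[OF _ st(2)], intro conjI allI) (fact | rule v b)+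
  qed
  obtain \<psi> where \<psi>: "joint.character \<psi>" "cmod (\<psi> x) = norm x"
    by (rule joint.character_attains_norm[OF xm])
  obtain s t where st: "s \<in> {0..1}" "t \<in> {0..1}" "s * t \<le> c" "\<psi> (\<iota>\<^sub>1 (ev (peak I z))) = of_real s"
      "\<psi> (\<iota>\<^sub>2 (ev (peak I z'))) = of_real t"
    using point_values[OF \<psi>(1)] by blast
  have "\<psi> x = of_real (s * t)"
    unfolding x_def using joint.character_mult[OF \<psi>(1) \<iota>\<^sub>1_mem \<iota>\<^sub>2_mem, OF rangeI rangeI] st by simp
  then have c: "c = s * t" using \<psi>(2) st by (simp add: c_def abs_mult norm_mult)
  have "\<not> c < 1"
  proof
    assume "c < 1"
    \<comment> \<open>\<open>f\<close> is chosen so that \<open>f s * f t = 0\<close> whenever \<open>s * t \<le> c\<close>, although \<open>f 1 \<noteq> 0\<close>\<close>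
    define r where "r = sqrt c"
    have r: "0 \<le> r" "r < 1" "r * r = c"
      using \<open>c < 1\<close> by (auto simp: r_def c_def)
    define f where "f t = max 0 (t - r)" for t :: real
    have f: "continuous_on {0..1} f" "f 1 \<noteq> 0"
      using r by (auto simp: f_def intro!: continuous_intros)
    obtain l where l: "(\<lambda>n. ev (bernstein f n (peak I z))) \<longlonglongrightarrow> l"
      using bernstein_convergent[OF f(1) U(1)] by (auto simp: convergent_def)
    obtain l' where l': "(\<lambda>n. ev (bernstein f n (peak I z'))) \<longlonglongrightarrow> l'"
      using bernstein_convergent[OF f(1) U(2)] by (auto simp: convergent_def)
    define g where "g = (\<lambda>n. \<iota>\<^sub>1 (ev (bernstein f n (peak I z))) * \<iota>\<^sub>2 (ev (bernstein f n (peak I z'))))"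
    have "g \<longlonglongrightarrow> \<iota>\<^sub>1 l * \<iota>\<^sub>2 l'"
      unfolding g_def by (rule tendsto_mult[OF cstar_hom_tendsto[OF hom1 l] cstar_hom_tendsto[OF hom2 l']])
    moreover have "g \<longlonglongrightarrow> 0"
    proof (rule LIMSEQ_I)
      fix \<epsilon> :: real assume "\<epsilon> > 0"
      define \<delta> where "\<delta> = min 1 (\<epsilon> / 2)"
      have \<delta>: "0 < \<delta>" "\<delta> \<le> 1" "2 * \<delta> \<le> \<epsilon>" using \<open>\<epsilon> > 0\<close> by (auto simp: \<delta>_def)
      obtain N where N: "\<And>n x. N \<le> n \<Longrightarrow> x \<in> {0..1} \<Longrightarrow>
          \<bar>f x - (\<Sum>k\<le>n. f (real k / real n) * Bernstein n k x)\<bar> < \<delta>"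
        using Bernstein_Weierstrass[OF f(1) \<delta>(1)] by blast
      have "norm (g n) < \<epsilon>" if n: "n \<ge> N" for n
      proof -
        obtain \<psi> where \<psi>: "joint.character \<psi>" "cmod (\<psi> (g n)) = norm (g n)"
          by (rule joint.character_attains_norm[of "g n"]) (auto simp only: g_def x_mem)
        let ?P = "\<lambda>s. \<Sum>k\<le>n. f (real k / real n) * Bernstein n k s"
        obtain s t where st: "s \<in> {0..1}" "t \<in> {0..1}" "s * t \<le> c"
          "\<psi> (\<iota>\<^sub>1 (ev (bernstein f n (peak I z)))) = of_real (?P s)"
          "\<psi> (\<iota>\<^sub>2 (ev (bernstein f n (peak I z')))) = of_real (?P t)"
          using point_values[OF \<psi>(1)] by blast
        have "\<psi> (g n) = of_real (?P s * ?P t)"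
          unfolding g_def using joint.character_mult[OF \<psi>(1) \<iota>\<^sub>1_mem \<iota>\<^sub>2_mem, OF rangeI rangeI] st by simp
        then have gn: "norm (g n) = \<bar>?P s\<bar> * \<bar>?P t\<bar>"
          using \<psi>(2) by (simp only: norm_of_real abs_mult)
        have bnd: "\<bar>?P u\<bar> \<le> 2" if "u \<in> {0..1}" for u
        proof -
          have "\<bar>f u\<bar> \<le> 1" using that r by (auto simp: f_def)
          then show ?thesis using N[OF n that] \<delta> by linarith
        qed
        have small: "\<bar>?P u\<bar> < \<delta>" if "u \<in> {0..1}" "u \<le> r" for u
          using N[OF n that(1)] that(2) by (simp add: f_def)
        have "s \<le> r \<or> t \<le> r"
        proof (rule ccontr)
          assume "\<not> ?thesis"
          then have "r * r < s * t" using r by (intro mult_strict_mono') auto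
          then show False using st r by simp
        qed
        then have "\<bar>?P s\<bar> * \<bar>?P t\<bar> < \<delta> * 2"
        proof
          assume "s \<le> r"
          then have "\<bar>?P s\<bar> * \<bar>?P t\<bar> \<le> \<bar>?P s\<bar> * 2" "\<bar>?P s\<bar> < \<delta>"
            using small[OF st(1)] bnd[OF st(2)] by (auto intro: mult_left_mono)
          then show ?thesis by linarith
        next
          assume "t \<le> r"
          then have "\<bar>?P s\<bar> * \<bar>?P t\<bar> \<le> 2 * \<bar>?P t\<bar>" "\<bar>?P t\<bar> < \<delta>"
            using small[OF st(2)] bnd[OF st(1)] by (auto intro: mult_right_mono)
          then show ?thesis by linarith
        qed
        then show ?thesis using gn \<delta> by linarith
      qed
      then show "\<exists>no. \<forall>n\<ge>no. norm (g n - 0) < \<epsilon>" by auto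
    qed
    ultimately have "\<iota>\<^sub>1 l * \<iota>\<^sub>2 l' = 0" by (rule LIMSEQ_unique)
    then show False
      using no_zero_divisors bernstein_limit_nonzero[OF f z l] bernstein_limit_nonzero[OF f z' l'] by blast
  qed
  then have "1 \<le> s * t" using c by simp
  moreover have "s * t \<le> s" "s * t \<le> t"
    using st by (auto intro: mult_left_le mult_left_le_one_le)
  ultimately have "s = 1" "t = 1" using st by auto
  then show thesis using that[OF \<psi>(1)] st by simp
qed

text \<open>
  The character of \<open>joint_peak\<close> restricts to \<open>z\<close> and \<open>z'\<close> on the two factors, because a peak
  determines its point.
\<close>

lemma joint_spectrum_full:
  assumes z: "z \<in> spectrum" and z': "z' \<in> spectrum"
  shows "cmod (free_eval (case_sum (pair_products (entry z)) (pair_products (entry z'))) r) \<le> norm (free_eval joint r)"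
proof -
  obtain \<psi> where \<psi>: "joint.character \<psi>" "\<psi> (\<iota>\<^sub>1 (ev (peak I z))) = 1" "\<psi> (\<iota>\<^sub>2 (ev (peak I z'))) = 1"
    using joint_peak[OF assms] by blast
  obtain y y' where y0: "y \<in> spectrum" "y' \<in> spectrum"
    "\<forall>q. \<psi> (\<iota>\<^sub>1 (ev q)) = free_eval (pair_products (entry y)) q"
    "\<forall>q. \<psi> (\<iota>\<^sub>2 (ev q)) = free_eval (pair_products (entry y')) q"
    using joint_character_points[OF \<psi>(1)] by blast
  note y = y0(1,2) y0(3,4)[rule_format]
  have "peak_value I z y = 1" "peak_value I z' y' = 1"
    using \<psi>(2,3) unfolding y(3,4) free_eval_peak by (simp_all only: of_real_eq_1_iff)
  then have pp: "pair_products (entry y) = pair_products (entry z)" "pair_products (entry y') = pair_products (entry z')"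
    using peak_value_eq_1[OF spectrum_unitary[OF y(1)] spectrum_unitary[OF z] nonempty]
      peak_value_eq_1[OF spectrum_unitary[OF y(2)] spectrum_unitary[OF z'] nonempty]
    by (auto simp: pair_products_def)
  have letter: "\<psi> (joint x) = case_sum (pair_products (entry z)) (pair_products (entry z')) x" for x
    using y(3,4)[of "gen _"] by (cases x) (simp_all add: joint_def free_eval_gen pp)
  have "joint x \<in> range (free_eval joint)" for x
    by (metis free_eval_gen rangeI)
  then have "\<psi> (free_eval joint r) = free_eval (case_sum (pair_products (entry z)) (pair_products (entry z'))) r"
    using joint.character_free_eval(1)[OF \<psi>(1), of joint r] by (simp add: letter)
  then show ?thesis
    using joint.character_le_norm[OF \<psi>(1), of "free_eval joint r"] by simp
qed

end

section \<open>Even and odd parts, and the two possible spectra\<close>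

text \<open>
  \<open>p = q\<^sub>0 + (\<Sum>x. x * q x)\<close> modulo self-adjointness of the letters, where \<open>q\<^sub>0\<close> and all \<open>q x\<close> are
  polynomials in pairs of letters. As a relation between free polynomials the splitting holds in all
  algebras at once.
\<close>

inductive even_odd_split :: "'x::finite free_star_algebra \<Rightarrow>
    ('x \<times> 'x) free_star_algebra \<Rightarrow> ('x \<Rightarrow> ('x \<times> 'x) free_star_algebra) \<Rightarrow> bool" where
  const: "even_odd_split (const c) (const c) (\<lambda>_. 0)"
| add: "even_odd_split p q\<^sub>0 q \<Longrightarrow> even_odd_split p' q\<^sub>0' q' \<Longrightarrow>
    even_odd_split (p + p') (q\<^sub>0 + q\<^sub>0') (\<lambda>x. q x + q' x)"
| letter: "l = gen y \<or> l = free_star (gen y) \<Longrightarrow> even_odd_split p q\<^sub>0 q \<Longrightarrow>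
    even_odd_split (l * p) (\<Sum>x\<in>UNIV. gen (y, x) * q x) (\<lambda>x. if x = y then q\<^sub>0 else 0)"

lemma even_odd_split_exists: "\<exists>q\<^sub>0 q. even_odd_split p q\<^sub>0 q"
  by (induction p rule: free_eval_induct) (blast intro: even_odd_split.intros)+

lemma free_eval_even_odd_split:
  assumes "even_odd_split p q\<^sub>0 q" and sa: "\<And>x. adj (a x) = a x"
  shows "free_eval a p = free_eval (pair_products a) q\<^sub>0 +
    (\<Sum>x\<in>UNIV. a x * free_eval (pair_products a) (q x))"
  using assms(1)
proof induction
  case (const c)
  then show ?case by (simp add: free_eval_const free_eval_zero)
next
  case (add p q\<^sub>0 q p' q\<^sub>0' q')
  then show ?case by (simp add: free_eval_add distrib_left sum.distrib)
next
  case (letter l y p q\<^sub>0 q)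
  have l: "free_eval a l = a y"
    using letter(1) by (auto simp: free_eval_gen free_eval_star sa)
  have odd: "(\<Sum>x\<in>UNIV. a x * free_eval (pair_products a) (if x = y then q\<^sub>0 else 0)) =
      (\<Sum>x\<in>UNIV. if x = y then a y * free_eval (pair_products a) q\<^sub>0 else 0)"
    by (intro sum.cong) (auto simp: free_eval_zero)
  have even: "free_eval (pair_products a) (\<Sum>x\<in>UNIV. gen (y, x) * q x) =
      a y * (\<Sum>x\<in>UNIV. a x * free_eval (pair_products a) (q x))"
    by (simp add: free_eval_sum free_eval_mult free_eval_gen pair_products_def sa sum_distrib_left mult.assoc)
  show ?case
    unfolding odd even by (simp add: letter.IH free_eval_mult l distrib_left)
qed

lemma entry_cmat: "entry (cmat g) (i, j) = of_real (g $ i $ j)"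
  by (simp add: entry_def cmat_def)

lemma cnj_entry_cmat: "cnj (entry (cmat g) a) = entry (cmat g) a"
  by (cases a) (simp add: entry_cmat)

text \<open>
  The phase is that of any nonzero entry.
\<close>

lemma real_up_to_phase:
  fixes z :: "complex^'n::finite^'n"
  assumes z: "z \<in> unitary_on I"
    and real: "\<And>a b. entry z a * cnj (entry z b) = entry z b * cnj (entry z a)"
  obtains g where "g \<in> orthogonal_on I" "pair_products (entry (cmat g)) = pair_products (entry z)"
proof -
  obtain c where c: "\<And>a. entry z a * cnj c = of_real (Re (entry z a * cnj c))"
    "c * cnj c = 1 \<or> (\<forall>a. entry z a = 0)"
  proof (cases "\<forall>a. entry z a = 0")
    case True
    then show thesis using that[of 0] by simp
  next
    case False
    then obtain b where b: "entry z b \<noteq> 0" by blast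
    have real_if: "w = of_real (Re w)" if "cnj w = w" for w
      using that by (simp add: complex_eq_iff)
    let ?c = "entry z b / of_real (cmod (entry z b))"
    have "entry z a * cnj ?c = of_real (Re (entry z a * cnj ?c))" for a
    proof -
      have "cnj (entry z a * cnj ?c) = entry z a * cnj ?c"
        using real[of b a] by (simp add: mult.commute)
      then show ?thesis by (rule real_if)
    qed
    moreover have "?c * cnj ?c = 1"
      using b complex_norm_square[of "entry z b"] by (simp add: power2_eq_square)
    ultimately show thesis using that by blast
  qed
  define g :: "real^'n^'n" where "g = (\<chi> i j. Re (entry z (i, j) * cnj c))"
  have g: "entry (cmat g) a = entry z a * cnj c" for a
    using c(1)[of a] by (cases a) (simp add: entry_cmat g_def)
  have gg: "entry (cmat g) a * cnj (entry (cmat g) b) = entry z a * cnj (entry z b)" for a b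
  proof -
    have "entry (cmat g) a * cnj (entry (cmat g) b) = (c * cnj c) * (entry z a * cnj (entry z b))"
      by (simp add: g)
    then show ?thesis using c(2) by (cases a; cases b) auto
  qed
  have "cmat g \<in> unitary_on I"
  proof -
    have gg': "cmat g $ i $ k * cnj (cmat g $ j $ l) = z $ i $ k * cnj (z $ j $ l)" for i j k l
      using gg[of "(i, k)" "(j, l)"] by (simp add: entry_def)
    have "cmat g ** cadj (cmat g) = z ** cadj z"
      by (rule matrix_eqI) (simp only: matrix_matrix_mult_def cadj_def vec_lambda_beta gg')
    moreover have "cadj (cmat g) ** cmat g = cadj z ** z"
      by (rule matrix_eqI) (simp only: matrix_matrix_mult_def cadj_def vec_lambda_beta mult.commute[of "cnj _"] gg')
    ultimately show ?thesis using z by (simp add: unitary_on_def)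
  qed
  moreover have inj: "A = B" if "cmat A = cmat B" for A B :: "real^'n^'n"
    using that by (simp add: cmat_def vec_eq_iff)
  ultimately have "g \<in> orthogonal_on I"
    using cmat_proj[of I] unfolding unitary_on_def orthogonal_on_def cadj_cmat
    by (intro CollectI conjI inj) (simp_all add: cmat_mult cadj_cmat[symmetric])
  moreover have "pair_products (entry (cmat g)) = pair_products (entry z)"
    using gg by (auto simp: pair_products_def)
  ultimately show thesis by (rule that)
qed

locale half_liberated_quantum_group = tensor_square I v \<iota>\<^sub>1 \<iota>\<^sub>2
  for I :: "'n::finite set" and v :: "'a::cstar_algebra^'n^'n" and \<iota>\<^sub>1 \<iota>\<^sub>2 :: "'a \<Rightarrow> 't::cstar_algebra" +
  fixes \<Delta> :: "'a \<Rightarrow> 't"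
  assumes \<Delta>: "cstar_hom \<Delta>"
    and comultiplication: "\<Delta> (v $ i $ j) = (\<Sum>k\<in>UNIV. \<iota>\<^sub>1 (v $ i $ k) * \<iota>\<^sub>2 (v $ k $ j))"
    and contains_classical: "g \<in> orthogonal_on I \<Longrightarrow> cmod (free_eval (entry (cmat g)) p) \<le> norm (free_eval (entry v) p)"
begin

text \<open>
  In the products \<open>\<Delta> (v i j) * \<Delta> (v k l)\<close> the letters of each tensor factor occur in pairs, so \<open>\<Delta>\<close>
  maps the even part into the algebra generated by \<open>joint\<close>. There the pair \<open>(z, z')\<close> defines a
  character, and composing it with \<open>\<Delta>\<close> gives \<open>z ** z'\<close>.
\<close>

lemma spectrum_mult:
  assumes z: "z \<in> spectrum" and z': "z' \<in> spectrum"
  shows "z ** z' \<in> spectrum"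
proof -
  define \<sigma> :: "('n \<times> 'n) \<times> ('n \<times> 'n) \<Rightarrow> _" where "\<sigma> = (\<lambda>((i, j), (k, l)). \<Sum>m\<in>UNIV. \<Sum>n\<in>UNIV.
    gen (Inl ((i, m), (k, n)) :: (('n \<times> 'n) \<times> ('n \<times> 'n)) + (('n \<times> 'n) \<times> ('n \<times> 'n))) * gen (Inr ((m, j), (n, l))))"
  have 1: "free_eval joint (\<sigma> x) = \<Delta> (pair_products e x)" for x
  proof -
    obtain i j k l where x: "x = ((i, j), (k, l))" by (metis surj_pair)
    have \<iota>: "adj (\<iota>\<^sub>1 (v $ i $ j)) = \<iota>\<^sub>1 (v $ i $ j)" "adj (\<iota>\<^sub>2 (v $ i $ j)) = \<iota>\<^sub>2 (v $ i $ j)" for i j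
      using cstar_hom_adj[OF hom1] cstar_hom_adj[OF hom2] selfadj by metis+
    have "\<Delta> (pair_products e x) = (\<Sum>m\<in>UNIV. \<iota>\<^sub>1 (v $ i $ m) * \<iota>\<^sub>2 (v $ m $ j)) * adj (\<Sum>n\<in>UNIV. \<iota>\<^sub>1 (v $ k $ n) * \<iota>\<^sub>2 (v $ n $ l))"
      by (simp add: x pair_products_def entry_def cstar_hom_mult[OF \<Delta>] cstar_hom_adj[OF \<Delta>] comultiplication del: e_selfadj)
    also have "\<dots> = (\<Sum>m\<in>UNIV. \<Sum>n\<in>UNIV. (\<iota>\<^sub>1 (v $ i $ m) * \<iota>\<^sub>2 (v $ m $ j)) * (\<iota>\<^sub>2 (v $ n $ l) * \<iota>\<^sub>1 (v $ k $ n)))"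
      by (simp add: adj_sum adj_mult sum_product \<iota>)
    also have "\<dots> = (\<Sum>m\<in>UNIV. \<Sum>n\<in>UNIV. \<iota>\<^sub>1 (v $ i $ m * v $ k $ n) * \<iota>\<^sub>2 (v $ m $ j * v $ n $ l))"
    proof (intro sum.cong refl)
      fix m n
      have "(\<iota>\<^sub>1 (v $ i $ m) * \<iota>\<^sub>2 (v $ m $ j)) * (\<iota>\<^sub>2 (v $ n $ l) * \<iota>\<^sub>1 (v $ k $ n)) =
          \<iota>\<^sub>1 (v $ i $ m) * (\<iota>\<^sub>2 (v $ m $ j * v $ n $ l) * \<iota>\<^sub>1 (v $ k $ n))"
        by (simp only: cstar_hom_mult[OF hom2] mult.assoc)
      also have "\<dots> = \<iota>\<^sub>1 (v $ i $ m) * (\<iota>\<^sub>1 (v $ k $ n) * \<iota>\<^sub>2 (v $ m $ j * v $ n $ l))"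
        by (simp only: commuting)
      finally show "(\<iota>\<^sub>1 (v $ i $ m) * \<iota>\<^sub>2 (v $ m $ j)) * (\<iota>\<^sub>2 (v $ n $ l) * \<iota>\<^sub>1 (v $ k $ n)) =
          \<iota>\<^sub>1 (v $ i $ m * v $ k $ n) * \<iota>\<^sub>2 (v $ m $ j * v $ n $ l)"
        by (simp only: cstar_hom_mult[OF hom1] mult.assoc)
    qed
    finally show ?thesis
      by (simp add: x \<sigma>_def free_eval_sum free_eval_mult free_eval_gen joint_def pair_products_def)
        (simp add: entry_def)
  qed
  have 2: "free_eval (case_sum (pair_products (entry z)) (pair_products (entry z'))) (\<sigma> x) =
      pair_products (entry (z ** z')) x" for x
  proof -
    obtain i j k l where x: "x = ((i, j), (k, l))" by (metis surj_pair)
    show ?thesis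
      by (simp add: x \<sigma>_def free_eval_sum free_eval_mult free_eval_gen pair_products_def entry_def
          matrix_matrix_mult_def sum_product mult_ac)
  qed
  have "cmod (free_eval (pair_products (entry (z ** z'))) q) \<le> norm (ev q)" for q
  proof -
    have "free_eval (pair_products (entry (z ** z'))) q =
        free_eval (case_sum (pair_products (entry z)) (pair_products (entry z'))) (substitute \<sigma> q)"
      by (simp add: free_eval_substitute 2)
    then have "cmod (free_eval (pair_products (entry (z ** z'))) q) \<le> norm (free_eval joint (substitute \<sigma> q))"
      using joint_spectrum_full[OF z z'] by simp
    also have "free_eval joint (substitute \<sigma> q) = \<Delta> (ev q)"
      by (simp add: free_eval_substitute 1 cstar_hom_free_eval[OF \<Delta>])
    finally show ?thesis using cstar_hom_contractive[OF \<Delta>, of "ev q"] by linarith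
  qed
  then show ?thesis
    using unitary_mult[OF spectrum_unitary[OF z] spectrum_unitary[OF z']] by (simp add: spectrum_def)
qed

lemma spectrum_orthogonal:
  assumes g: "g \<in> orthogonal_on I"
  shows "cmat g \<in> spectrum"
proof -
  define \<sigma> :: "('n \<times> 'n) \<times> ('n \<times> 'n) \<Rightarrow> ('n \<times> 'n) free_star_algebra" where "\<sigma> = (\<lambda>(a, b). gen a * free_star (gen b))"
  have \<sigma>: "free_eval a (\<sigma> x) = pair_products a x" for a :: "'n \<times> 'n \<Rightarrow> 'c::cstar_algebra" and x
    by (cases x) (simp add: \<sigma>_def pair_products_def free_eval_mult free_eval_star free_eval_gen)
  have s: "free_eval (pair_products a) q = free_eval a (substitute \<sigma> q)" for a :: "'n \<times> 'n \<Rightarrow> 'c::cstar_algebra" and q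
    by (simp add: free_eval_substitute \<sigma>)
  show ?thesis
    using contains_classical[OF g] cmat_unitary[OF g] by (simp add: spectrum_def s)
qed

sublocale group: conjugation_invariant_group I spectrum
  by unfold_locales
    (auto intro: spectrum_unitary spectrum_closed spectrum_mult spectrum_conj spectrum_orthogonal spectrum_phase)

text \<open>
  Let \<open>G\<close> be the peak element of a point \<open>z\<close> and \<open>G'\<close> its swapped version. For odd \<open>x\<close> one has
  \<open>x * G = G' * x\<close>, so that \<open>G ^ n * x * G ^ n = (G * G') ^ n * x\<close> tends to zero when \<open>z\<close> is not real
  up to a phase, whereas multiplication by \<open>G ^ n\<close> does not change the value of the even part at \<open>z\<close>.
\<close>

lemma even_part_le:
  assumes full: "spectrum = unitary_on I"
    and split: "even_odd_split p q\<^sub>0 q"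
  shows "norm (ev q\<^sub>0) \<le> norm (free_eval e p)"
proof -
  obtain z where z: "z \<in> spectrum" "norm (ev q\<^sub>0) = cmod (free_eval (pair_products (entry z)) q\<^sub>0)"
    using norm_attained by blast
  have zU: "z \<in> unitary_on I" by (rule spectrum_unitary[OF z(1)])
  show ?thesis
  proof (cases "\<forall>a b. entry z a * cnj (entry z b) = entry z b * cnj (entry z a)")
    case True
    then obtain g where g: "g \<in> orthogonal_on I" "pair_products (entry (cmat g)) = pair_products (entry z)"
      using real_up_to_phase[OF zU] by metis
    have mg: "- g \<in> orthogonal_on I"
    proof -
      have "(- g) ** transpose (- g) = g ** transpose g" "transpose (- g) ** (- g) = transpose g ** g"
        by (auto intro!: matrix_eqI simp: matrix_matrix_mult_def transpose_def)
      then show ?thesis using g(1) by (simp add: orthogonal_on_def)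
    qed
    \<comment> \<open>at a real point, averaging over \<open>g\<close> and \<open>- g\<close> removes the odd part\<close>
    let ?c = "entry (cmat g)" and ?d = "entry (cmat (- g))"
    have d: "?d a = - ?c a" for a by (cases a) (simp add: entry_cmat)
    have dd: "pair_products ?d = pair_products ?c" by (auto simp: pair_products_def d)
    have "free_eval ?c p = free_eval (pair_products ?c) q\<^sub>0 + (\<Sum>x\<in>UNIV. ?c x * free_eval (pair_products ?c) (q x))"
      by (rule free_eval_even_odd_split[OF split]) (simp add: cnj_entry_cmat)
    moreover have "free_eval ?d p = free_eval (pair_products ?c) q\<^sub>0 - (\<Sum>x\<in>UNIV. ?c x * free_eval (pair_products ?c) (q x))"
      using free_eval_even_odd_split[OF split, of ?d] by (simp add: cnj_entry_cmat dd d sum_negf)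
    ultimately have "free_eval ?c p + free_eval ?d p = 2 * free_eval (pair_products ?c) q\<^sub>0" by simp
    then have "2 * norm (ev q\<^sub>0) = cmod (free_eval ?c p + free_eval ?d p)"
      by (simp add: z(2) g(2) norm_mult)
    also have "\<dots> \<le> cmod (free_eval ?c p) + cmod (free_eval ?d p)" by (rule norm_triangle_ineq)
    finally show ?thesis
      using contains_classical[OF g(1), of p] contains_classical[OF mg, of p] by linarith
  next
    case False
    then obtain a b where nonreal: "entry z a * cnj (entry z b) \<noteq> entry z b * cnj (entry z a)" by blast
    define G G' where "G = ev (peak I z)" and "G' = free_eval swapped (peak I z)"
    define x where "x = (\<Sum>x\<in>UNIV. e x * ev (q x))"
    have p: "free_eval e p = ev q\<^sub>0 + x"
      unfolding x_def by (rule free_eval_even_odd_split[OF split]) simp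
    have G'_ev: "G' = ev (substitute (\<lambda>(x, y). gen (y, x)) (peak I z))"
      by (simp add: G'_def swapped_substitute)
    have mem: "G \<in> range ev" "G' \<in> range ev" by (auto simp: G_def G'_ev)
    have xG: "x * G = G' * x"
    proof -
      have "e a * ev q * G = G' * (e a * ev q)" for a q
      proof -
        have "e a * ev q * G = e a * (G * ev q)"
          using even.commute[OF mem(1), of "ev q"] by (simp add: mult.assoc)
        also have "\<dots> = G' * (e a * ev q)"
          using e_intertwines[of a "peak I z"] by (simp add: G_def G'_def mult.assoc[symmetric])
        finally show ?thesis .
      qed
      then show ?thesis by (simp add: x_def sum_distrib_left sum_distrib_right)
    qed
    have xGn: "x * G ^ n = G' ^ n * x" for n
    proof (induction n)
      case (Suc n)
      have "x * G ^ Suc n = (x * G ^ n) * G"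
        by (simp only: power_Suc2 mult.assoc)
      also have "\<dots> = G' ^ n * (x * G)"
        by (simp only: Suc mult.assoc)
      also have "\<dots> = G' ^ Suc n * x"
        by (simp only: xG power_Suc2 mult.assoc)
      finally show ?case .
    qed simp
    have GG': "G ^ n * G' ^ n = (G * G') ^ n" for n
    proof (induction n)
      case (Suc n)
      have "G ^ Suc n * G' ^ Suc n = G * (G ^ n * G') * G' ^ n"
        by (simp add: mult.assoc)
      also have "G ^ n * G' = G' * G ^ n"
        by (rule power_commuting_commutes) (rule even.commute[OF mem])
      finally show ?case by (simp add: mult.assoc Suc[symmetric])
    qed simp
    \<comment> \<open>\<open>G\<close> and \<open>G'\<close> peak at the different points \<open>z\<close> and \<open>conj_mat z\<close>\<close>
    have small: "norm (G * G') < 1"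
    proof -
      let ?r = "peak I z * substitute (\<lambda>(x, y). gen (y, x)) (peak I z)"
      have GG: "G * G' = ev ?r" by (simp add: G_def G'_ev free_eval_mult)
      obtain y where y: "y \<in> spectrum" "norm (ev ?r) = cmod (free_eval (pair_products (entry y)) ?r)"
        using norm_attained by blast
      have yU: "y \<in> unitary_on I" "conj_mat y \<in> unitary_on I"
        using y(1) spectrum_conj spectrum_unitary by blast+
      have "free_eval (pair_products (entry y)) (substitute (\<lambda>(x, y). gen (y, x)) (peak I z)) =
          free_eval (pair_products (entry (conj_mat y))) (peak I z)"
      proof -
        have "(\<lambda>x. free_eval (pair_products (entry y)) ((\<lambda>(x, y). gen (y, x)) x)) = pair_products (entry (conj_mat y))"
          by (auto simp: pair_products_def entry_def conj_mat_def free_eval_gen mult.commute)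
        then show ?thesis by (simp add: free_eval_substitute)
      qed
      then have n: "norm (ev ?r) = peak_value I z y * peak_value I z (conj_mat y)"
        unfolding y(2) unfolding free_eval_mult free_eval_peak
        by (simp add: free_eval_peak norm_mult peak_value_nonneg)
      have le: "peak_value I z y \<le> 1" "peak_value I z (conj_mat y) \<le> 1"
        using peak_value_le[OF yU(1) zU nonempty] peak_value_le[OF yU(2) zU nonempty] by auto
      have "\<not> (peak_value I z y = 1 \<and> peak_value I z (conj_mat y) = 1)"
      proof
        assume one: "peak_value I z y = 1 \<and> peak_value I z (conj_mat y) = 1"
        have "entry z a * cnj (entry z b) = entry (conj_mat y) a * cnj (entry (conj_mat y) b)"
          using peak_value_eq_1[OF yU(2) zU nonempty] one by simp
        also have "\<dots> = entry y b * cnj (entry y a)"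
          by (cases a; cases b) (simp add: entry_def conj_mat_def)
        also have "\<dots> = entry z b * cnj (entry z a)"
          using peak_value_eq_1[OF yU(1) zU nonempty] one by simp
        finally show False using nonreal by simp
      qed
      moreover have "peak_value I z y * peak_value I z (conj_mat y) \<le> peak_value I z y"
        "peak_value I z y * peak_value I z (conj_mat y) \<le> peak_value I z (conj_mat y)"
        using le by (auto intro: mult_left_le mult_left_le_one_le peak_value_nonneg)
      ultimately show ?thesis
        unfolding GG n using le by linarith
    qed
    have G1: "norm G \<le> 1"
    proof -
      obtain y where y: "y \<in> spectrum" "norm (ev (peak I z)) = cmod (free_eval (pair_products (entry y)) (peak I z))"
        using norm_attained by blast
      then show ?thesis
        using peak_value_le[OF spectrum_unitary[OF y(1)] zU nonempty]
        by (simp add: G_def free_eval_peak peak_value_nonneg)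
    qed
    have bound: "norm (ev q\<^sub>0) \<le> norm (free_eval e p) + norm (G * G') ^ n * norm x" for n
    proof -
      have "free_eval (pair_products (entry z)) (peak I z ^ n * q\<^sub>0 * peak I z ^ n) =
          free_eval (pair_products (entry z)) q\<^sub>0"
        by (simp add: free_eval_mult free_eval_power free_eval_peak peak_value_self[OF zU nonempty])
      then have "norm (ev q\<^sub>0) \<le> norm (G ^ n * ev q\<^sub>0 * G ^ n)"
        using spectrum_bound[OF z(1), of "peak I z ^ n * q\<^sub>0 * peak I z ^ n"]
        by (simp only: z(2) free_eval_mult[of "pair_products e"] free_eval_power[of "pair_products e"] G_def)
      also have "G ^ n * ev q\<^sub>0 * G ^ n = G ^ n * free_eval e p * G ^ n - (G * G') ^ n * x"
        unfolding p GG'[symmetric] by (simp add: distrib_left distrib_right mult.assoc xGn)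
      also have "norm \<dots> \<le> norm (G ^ n * free_eval e p * G ^ n) + norm ((G * G') ^ n * x)"
        by (rule norm_triangle_ineq4)
      also have "norm (G ^ n * free_eval e p * G ^ n) \<le> 1 * norm (free_eval e p) * 1"
      proof -
        have Gn: "norm (G ^ n) \<le> 1"
          using norm_power_ineq[of G n] power_le_one[OF norm_ge_zero G1, of n] by linarith
        have "norm (G ^ n * free_eval e p * G ^ n) \<le> norm (G ^ n) * norm (free_eval e p) * norm (G ^ n)"
          by (intro order_trans[OF norm_mult_ineq] mult_right_mono norm_mult_ineq norm_ge_zero)
        also have "\<dots> \<le> 1 * norm (free_eval e p) * 1"
          using Gn by (intro mult_mono) auto
        finally show ?thesis .
      qed
      also have "norm ((G * G') ^ n * x) \<le> norm (G * G') ^ n * norm x"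
        by (intro order_trans[OF norm_mult_ineq] mult_right_mono norm_power_ineq norm_ge_zero)
      finally show ?thesis by simp
    qed
    have "(\<lambda>n. norm (free_eval e p) + norm (G * G') ^ n * norm x) \<longlonglongrightarrow> norm (free_eval e p) + 0 * norm x"
      using small by (intro tendsto_intros LIMSEQ_power_zero) simp
    then show ?thesis
      using LIMSEQ_le_const[of _ "norm (free_eval e p)" "norm (ev q\<^sub>0)"] bound by simp
  qed
qed

text \<open>
  The even part \<open>E\<close> of a polynomial in \<open>w\<close> is bounded through \<open>even_part_le\<close>, since the spectrum for
  \<open>w\<close> cannot exceed the unitary group. The odd part is the sum over \<open>k\<close> of \<open>w i k\<close> times the even
  part of \<open>w i k\<close> times the polynomial, by the orthogonality of the row \<open>i\<close>.
\<close>

theorem full_spectrum_norm_le: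
  fixes w :: "'b::cstar_algebra^'n^'n"
  assumes full: "spectrum = unitary_on I" and w: "half_liberated I w"
  shows "norm (free_eval (entry w) p) \<le> norm (free_eval e p)"
proof -
  interpret W: half_liberated I w by (rule w)
  have even_le: "norm (W.ev q) \<le> norm (ev q)" for q
  proof -
    obtain z where z: "z \<in> W.spectrum" "norm (W.ev q) = cmod (free_eval (pair_products (entry z)) q)"
      using W.norm_attained by blast
    then have "z \<in> spectrum" using W.spectrum_unitary full by blast
    then show ?thesis using spectrum_bound z(2) by simp
  qed
  obtain i where i: "i \<in> I" using nonempty by blast
  define C where "C = 1 + (\<Sum>k\<in>UNIV. norm (entry w (i, k)) * norm (e (i, k)))"
  show ?thesis
  proof (rule norm_le_by_power_trick)
    fix p :: "('n \<times> 'n) free_star_algebra"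
    obtain q\<^sub>0 q where s: "even_odd_split p q\<^sub>0 q"
      using even_odd_split_exists by blast
    have E: "norm (W.ev q\<^sub>0) \<le> norm (free_eval e p)"
      using even_le[of q\<^sub>0] even_part_le[OF full s] by linarith
    define O' where "O' = (\<Sum>x\<in>UNIV. entry w x * W.ev (q x))"
    \<comment> \<open>\<open>r k\<close> is the even part of \<open>gen (i, k) * p\<close>, which is \<open>w i k\<close> times the odd part of \<open>p\<close>\<close>
    define r where "r k = (\<Sum>x\<in>UNIV. gen ((i, k), x) * q x)" for k
    have r: "norm (W.ev (r k)) \<le> norm (e (i, k)) * norm (free_eval e p)" for k
    proof -
      have "norm (W.ev (r k)) \<le> norm (ev (r k))" by (rule even_le)
      also have "\<dots> \<le> norm (free_eval e (gen (i, k) * p))"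
        unfolding r_def by (rule even_part_le[OF full even_odd_split.letter[OF disjI1[OF refl] s]])
      also have "\<dots> \<le> norm (e (i, k)) * norm (free_eval e p)"
        unfolding free_eval_mult free_eval_gen by (rule norm_mult_ineq)
      finally show ?thesis .
    qed
    have "O' = (\<Sum>k\<in>UNIV. entry w (i, k) * entry w (i, k)) * O'"
      using i by (simp add: W.e_rows)
    also have "\<dots> = (\<Sum>k\<in>UNIV. entry w (i, k) * W.ev (r k))"
    proof -
      have "W.ev (r k) = entry w (i, k) * O'" for k
        by (simp add: O'_def r_def free_eval_sum free_eval_mult free_eval_gen pair_products_def
            sum_distrib_left mult.assoc)
      then show ?thesis by (simp add: sum_distrib_right mult.assoc)
    qed
    also have "norm \<dots> \<le> (\<Sum>k\<in>UNIV. norm (entry w (i, k)) * (norm (e (i, k)) * norm (free_eval e p)))"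
      by (intro sum_norm_le order_trans[OF norm_mult_ineq] mult_left_mono r norm_ge_zero)
    finally have O: "norm O' \<le> (C - 1) * norm (free_eval e p)"
      by (simp add: C_def sum_distrib_right mult.assoc)
    have "free_eval (entry w) p = W.ev q\<^sub>0 + O'"
      unfolding O'_def by (rule free_eval_even_odd_split[OF s]) simp
    then have "norm (free_eval (entry w) p) \<le> norm (W.ev q\<^sub>0) + norm O'"
      by (simp add: norm_triangle_ineq)
    then show "norm (free_eval (entry w) p) \<le> C * norm (free_eval e p)"
      using E O by (simp add: algebra_simps)
  qed
qed

theorem spectrum_dichotomy:
  "spectrum = unitary_on I \<or> (\<forall>a b. e a * e b = e b * e a)"
proof (cases "spectrum = unitary_on I")
  case False
  then have "entry z a * cnj (entry z b) = entry z b * cnj (entry z a)" if "z \<in> spectrum" for z a b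
    using group.nonreal_imp_full[OF that, of "fst a" "snd a" "fst b" "snd b"]
    by (cases a; cases b) (auto simp: entry_def)
  then show ?thesis
    using commute_if_spectrum_real by blast
qed simp

end

section \<open>Quantum groups between the orthogonal group and its half-liberation\<close>

lemma cstar_hom_inj:
  assumes h: "cstar_hom h" and dense: "closure (range (free_eval a)) = UNIV"
    and le: "\<And>p. norm (free_eval a p) \<le> norm (free_eval (\<lambda>x. h (a x)) p)"
  shows "inj h"
proof (rule injI)
  have "closed {x. norm x \<le> norm (h x)}"
    using cstar_hom_continuous[OF h] by (intro closed_Collect_le continuous_intros) auto
  moreover have "range (free_eval a) \<subseteq> {x. norm x \<le> norm (h x)}"
    using le by (auto simp: cstar_hom_free_eval[OF h])
  ultimately have "closure (range (free_eval a)) \<subseteq> {x. norm x \<le> norm (h x)}"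
    by (simp add: closure_minimal)
  then have iso: "norm x \<le> norm (h x)" for x using dense by auto
  fix x y assume "h x = h y"
  then have "norm (h (x - y)) = 0" by (simp add: cstar_hom_diff[OF h])
  then show "x = y" using iso[of "x - y"] by simp
qed

lemma cstar_hom_inv:
  assumes h: "cstar_hom h" and bij: "bij h"
  shows "cstar_hom (inv h)"
proof -
  have 1: "h (inv h x) = x" for x using bij by (simp add: bij_is_surj surj_f_inv_f)
  have 2: "inv h (h x) = x" for x using bij by (simp add: bij_is_inj)
  show ?thesis
    unfolding cstar_hom_def
    by (intro conjI allI)
      (metis 1 2 cstar_hom_add[OF h], metis 1 2 cstar_hom_scaleC[OF h], metis 1 2 cstar_hom_mult[OF h],
       metis 1 2 cstar_hom_adj[OF h], metis 2 cstar_hom_one[OF h])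
qed

lemma entry_pair: "entry v (i, j) = v $ i $ j"
  by (simp add: entry_def)

lemma entry_hom: "(\<And>i j. h (v $ i $ j) = u $ i $ j) \<Longrightarrow> (\<lambda>x. h (entry v x)) = entry u"
  by (auto simp: entry_def)

text \<open>
  The quotient map is isometric on the dense set of polynomials, hence injective, and its inverse is
  the required isomorphism.
\<close>

lemma qequal_from_smaller:
  assumes "qincl v u" and dense: "closure (range (free_eval (entry u))) = UNIV"
    and le: "\<And>p. norm (free_eval (entry u) p) \<le> norm (free_eval (entry v) p)"
  shows "qequal u v"
proof -
  obtain h where h: "cstar_hom h" "surj h" "\<And>i j. h (u $ i $ j) = v $ i $ j"
    using assms(1) by (auto simp: qincl_def)
  have "inj h"
    by (rule cstar_hom_inj[OF h(1) dense]) (simp add: entry_hom[OF h(3)] le)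
  then have bij: "bij h" using h(2) by (simp add: bij_def)
  have "inv h (v $ i $ j) = u $ i $ j" for i j
    using \<open>inj h\<close> by (metis h(3) inv_f_f)
  moreover have "bij (inv h)" using bij by (rule bij_imp_bij_inv)
  ultimately show ?thesis
    unfolding qequal_def using cstar_hom_inv[OF h(1) bij] by blast
qed

lemma qequal_from_larger:
  assumes "qincl u w" and dense: "closure (range (free_eval (entry w))) = UNIV"
    and le: "\<And>p. norm (free_eval (entry w) p) \<le> norm (free_eval (entry u) p)"
  shows "qequal u w"
proof -
  obtain h where h: "cstar_hom h" "surj h" "\<And>i j. h (w $ i $ j) = u $ i $ j"
    using assms(1) by (auto simp: qincl_def)
  have "inj h"
    by (rule cstar_hom_inj[OF h(1) dense]) (simp add: entry_hom[OF h(3)] le)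
  then show ?thesis
    unfolding qequal_def using h by (auto simp: bij_def)
qed

lemma qincl_relations:
  assumes "qincl u w" and "universal_cstar_algebra R (entry w)" and "r \<in> R"
  shows "free_eval (entry u) r = 0"
proof -
  obtain h where h: "cstar_hom h" "\<And>i j. h (w $ i $ j) = u $ i $ j"
    using assms(1) by (auto simp: qincl_def)
  have "free_eval (entry u) r = h (free_eval (entry w) r)"
    by (simp add: cstar_hom_free_eval[OF h(1)] entry_hom[OF h(2)])
  then show ?thesis
    by (simp add: universal_relations[OF assms(2,3)] cstar_hom_zero[OF h(1)])
qed

lemma universal_dense: "universal_cstar_algebra R a \<Longrightarrow> closure (range (free_eval a)) = UNIV"
  by (simp add: universal_cstar_algebra_def Let_def)

lemma qincl_norm_le:
  assumes "qincl v u"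
  shows "norm (free_eval (entry v) p) \<le> norm (free_eval (entry u) p)"
proof -
  obtain h where h: "cstar_hom h" "\<And>i j. h (u $ i $ j) = v $ i $ j"
    using assms by (auto simp: qincl_def)
  have "free_eval (entry v) p = h (free_eval (entry u) p)"
    by (simp add: cstar_hom_free_eval[OF h(1)] entry_hom[OF h(2)])
  then show ?thesis by (simp add: cstar_hom_contractive[OF h(1)])
qed

lemma cstar_hom_apply_bcontfun: "cstar_hom (\<lambda>f :: 'x::metric_space \<Rightarrow>\<^sub>C complex. apply_bcontfun f x)"
  unfolding cstar_hom_def by (simp add: bcontfun_cstar_simps plus_bcontfun.rep_eq)

lemma O_coords_bound:
  assumes "orthogonal_matrix A"
  shows "cmod (free_eval (entry (cmat A)) p) \<le> norm (free_eval (entry O_coords) p)"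
proof -
  have "(\<lambda>x. apply_bcontfun (entry O_coords x) (Orthogonal A)) = entry (cmat A)"
    using assms by (auto simp: entry_def cmat_def apply_O_coords Orthogonal_inverse)
  then have "free_eval (entry (cmat A)) p = apply_bcontfun (free_eval (entry O_coords) p) (Orthogonal A)"
    by (simp add: cstar_hom_free_eval[OF cstar_hom_apply_bcontfun])
  then show ?thesis using norm_bounded by metis
qed

lemma B_coords_bound:
  assumes "orthogonal_matrix A" "\<And>i. (\<Sum>j\<in>UNIV. A $ i $ j) = 1" "\<And>j. (\<Sum>i\<in>UNIV. A $ i $ j) = 1"
  shows "cmod (free_eval (entry (cmat A)) p) \<le> norm (free_eval (entry B_coords) p)"
proof -
  have "(\<lambda>x. apply_bcontfun (entry B_coords x) (Bistochastic A)) = entry (cmat A)"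
    using assms by (auto simp: entry_def cmat_def apply_B_coords Bistochastic_inverse)
  then have "free_eval (entry (cmat A)) p = apply_bcontfun (free_eval (entry B_coords) p) (Bistochastic A)"
    by (simp add: cstar_hom_free_eval[OF cstar_hom_apply_bcontfun])
  then show ?thesis using norm_bounded by metis
qed

lemma min_tensor_product_no_zero_divisors:
  assumes "min_tensor_product \<iota>\<^sub>1 \<iota>\<^sub>2" and zero: "\<iota>\<^sub>1 x * \<iota>\<^sub>2 y = 0"
  shows "x = 0 \<or> y = 0"
proof (cases "x = 0")
  case False
  then have "complex_vector.independent {x}"
    by (simp add: complex_vector.independent_insert)
  moreover have "\<And>S f. finite S \<Longrightarrow> complex_vector.independent S \<Longrightarrow> (\<Sum>a\<in>S. \<iota>\<^sub>1 a * \<iota>\<^sub>2 (f a)) = 0 \<Longrightarrow> \<forall>a\<in>S. f a = 0"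
    using assms(1) unfolding min_tensor_product_def by blast
  from this[of "{x}" "\<lambda>_. y"] show ?thesis
    using zero calculation by simp
qed simp

lemma proj_UNIV: "proj UNIV = mat 1"
  by (rule matrix_eqI) (simp add: proj_def mat_def)

lemma orthogonal_on_UNIV: "orthogonal_on UNIV = {A. orthogonal_matrix A}"
  by (auto simp: orthogonal_on_def orthogonal_matrix_def proj_UNIV)

text \<open>
  The argument at the top of the theory with \<open>v = u\<close>.
\<close>

theorem O_star_maximal:
  fixes w :: "'h::cstar_algebra^'n^'n"
  assumes w: "is_C_O_star w"
  shows "no_proper_intermediate TYPE('g::cstar_algebra) TYPE('t::cstar_algebra)
    (O_coords :: ('n orthogonal_group \<Rightarrow>\<^sub>C complex)^'n^'n) w"
  unfolding no_proper_intermediate_def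
proof (intro allI impI)
  fix u :: "'g^'n^'n" and \<iota>\<^sub>1 \<iota>\<^sub>2 \<Delta> :: "'g \<Rightarrow> 't"
  assume "quantum_subgroup_O_plus u \<iota>\<^sub>1 \<iota>\<^sub>2 \<Delta> \<and>
    qincl (O_coords :: ('n orthogonal_group \<Rightarrow>\<^sub>C complex)^'n^'n) u \<and> qincl u w"
  then have G: "quantum_subgroup_O_plus u \<iota>\<^sub>1 \<iota>\<^sub>2 \<Delta>"
    and lower: "qincl (O_coords :: ('n orthogonal_group \<Rightarrow>\<^sub>C complex)^'n^'n) u" and upper: "qincl u w"
    by auto
  have uw: "universal_cstar_algebra O_star_relations (entry w)"
    using w by (simp add: is_C_O_star_def)
  have hl: "half_liberated UNIV m"
    if rel: "\<And>r. r \<in> O_star_relations \<Longrightarrow> free_eval (entry m) r = 0" for m :: "'c::cstar_algebra^'n^'n"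
  proof
    have "\<forall>r\<in>O_plus_relations. free_eval (entry m) r = 0"
      using rel by (simp add: O_star_relations_def)
    then have m: "(\<forall>i j. adj (m $ i $ j) = m $ i $ j) \<and> orthogonal_matrix m"
      by (rule iffD1[OF O_plus_relations_iff])
    then show "adj (m $ i $ j) = m $ i $ j" "m ** transpose m = proj UNIV" "transpose m ** m = proj UNIV" for i j
      by (auto simp: orthogonal_matrix_def proj_UNIV)
    show "entry m a * entry m b * entry m c = entry m c * entry m b * entry m a" for a b c
    proof -
      have "gen x \<in> entries gen_matrix" for x :: "'n \<times> 'n"
        by (cases x) (auto simp: entries_def gen_matrix_def)
      then have "gen a * gen b * gen c - gen c * gen b * gen a \<in> O_star_relations"
        unfolding O_star_relations_def half_commutation_def by blast
      from rel[OF this] show ?thesis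
        by (simp add: free_eval_diff free_eval_mult free_eval_gen)
    qed
  qed auto
  note hlu = hl[OF qincl_relations[OF upper uw]] and hlw = hl[OF universal_relations[OF uw]]
  have T: "min_tensor_product \<iota>\<^sub>1 \<iota>\<^sub>2" using G by (simp add: quantum_subgroup_O_plus_def)
  interpret U: half_liberated UNIV u by (rule hlu)
  interpret half_liberated_quantum_group UNIV u \<iota>\<^sub>1 \<iota>\<^sub>2 \<Delta>
  proof
    show "cmod (free_eval (entry (cmat g)) p) \<le> norm (free_eval (entry u) p)"
      if "g \<in> orthogonal_on UNIV" for g :: "real^'n^'n" and p
      using O_coords_bound[of g p] qincl_norm_le[OF lower, of p] that by (simp add: orthogonal_on_UNIV)
  qed (use T G min_tensor_product_no_zero_divisors[OF T] in
      \<open>auto simp: min_tensor_product_def quantum_subgroup_O_plus_def\<close>)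
  show "qequal u (O_coords :: ('n orthogonal_group \<Rightarrow>\<^sub>C complex)^'n^'n) \<or> qequal u w"
    using spectrum_dichotomy
  proof
    assume "U.spectrum = unitary_on UNIV"
    then have "qequal u w"
      by (intro qequal_from_larger[OF upper universal_dense[OF uw]] full_spectrum_norm_le hlw)
    then show ?thesis ..
  next
    assume comm: "\<forall>a b. entry u a * entry u b = entry u b * entry u a"
    have "norm (free_eval (entry u) p) \<le> norm (free_eval (entry (O_coords :: ('n orthogonal_group \<Rightarrow>\<^sub>C complex)^'n^'n)) p)" for p
    proof -
      obtain g where "g \<in> orthogonal_on UNIV" "norm (free_eval (entry u) p) = cmod (free_eval (entry (cmat g)) p)"
        using half_liberated_commuting_norm[OF hlu] comm by metis
      then show ?thesis using O_coords_bound[of g p] by (simp add: orthogonal_on_UNIV)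
    qed
    then have "qequal u (O_coords :: ('n orthogonal_group \<Rightarrow>\<^sub>C complex)^'n^'n)"
      using G by (intro qequal_from_smaller[OF lower]) (simp_all add: quantum_subgroup_O_plus_def)
    then show ?thesis ..
  qed
qed

section \<open>Quantum groups between the bistochastic group and its half-liberation\<close>

definition scalar_matrix :: "real^'n^'n \<Rightarrow> 'a::cstar_algebra^'n^'n"
  where "scalar_matrix F = (\<chi> i j. scaleC (of_real (F $ i $ j)) 1)"

definition unit_at :: "'n \<Rightarrow> 'a::zero_neq_one^'n^'n"
  where "unit_at z = (\<chi> i j. if i = z \<and> j = z then 1 else 0)"

definition eval_matrix :: "'a::cstar_algebra^'n^'n \<Rightarrow> ('n \<times> 'n) free_star_algebra^'n^'n \<Rightarrow> 'a^'n^'n"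
  where "eval_matrix u X = (\<chi> i j. free_eval (entry u) (X $ i $ j))"

lemma eval_matrix_mult: "eval_matrix u (X ** Y) = eval_matrix u X ** eval_matrix u Y"
  by (rule matrix_eqI) (simp add: eval_matrix_def matrix_matrix_mult_def free_eval_sum free_eval_mult)

lemma eval_matrix_add: "eval_matrix u (X + Y) = eval_matrix u X + eval_matrix u Y"
  by (rule matrix_eqI) (simp add: eval_matrix_def free_eval_add)

lemma eval_matrix_const: "eval_matrix u (const_matrix F) = scalar_matrix F"
  by (rule matrix_eqI) (simp add: eval_matrix_def const_matrix_def scalar_matrix_def free_eval_const)

lemma eval_matrix_gen: "eval_matrix u gen_matrix = u"
  by (rule matrix_eqI) (simp add: eval_matrix_def gen_matrix_def free_eval_gen entry_def)

lemma eval_matrix_unit_at: "eval_matrix u (unit_at z) = unit_at z"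
  by (rule matrix_eqI) (simp add: eval_matrix_def unit_at_def free_eval_one free_eval_zero)

lemma scalar_matrix_mult: "scalar_matrix (A ** B) = (scalar_matrix A ** scalar_matrix B :: 'a::cstar_algebra^'n^'n)"
proof (rule matrix_eqI)
  fix i j
  have "(\<Sum>k\<in>UNIV. scaleC (of_real (A $ i $ k)) (1::'a) * scaleC (of_real (B $ k $ j)) 1) =
      scaleC (\<Sum>k\<in>UNIV. of_real (A $ i $ k) * of_real (B $ k $ j)) 1"
    by (simp add: mult_scaleC_left scaleC_scaleC complex_vector.scale_sum_left)
  then show "scalar_matrix (A ** B) $ i $ j = (scalar_matrix A ** scalar_matrix B :: 'a^'n^'n) $ i $ j"
    by (simp add: scalar_matrix_def matrix_matrix_mult_def)
qed

lemma scalar_matrix_one: "scalar_matrix (mat 1) = mat 1"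
  by (rule matrix_eqI) (simp add: scalar_matrix_def mat_def scaleC_one)

lemma scalar_matrix_complex: "scalar_matrix F = cmat F"
  by (rule matrix_eqI) (simp add: scalar_matrix_def cmat_def)

lemma transpose_scalar_mult: "transpose (scalar_matrix A ** M) = transpose M ** scalar_matrix (transpose A)"
  by (rule matrix_eqI)
    (simp add: transpose_def scalar_matrix_def matrix_matrix_mult_def mult_scaleC_left mult_scaleC_right)

lemma transpose_mult_scalar: "transpose (M ** scalar_matrix A) = scalar_matrix (transpose A) ** transpose M"
  by (rule matrix_eqI)
    (simp add: transpose_def scalar_matrix_def matrix_matrix_mult_def mult_scaleC_left mult_scaleC_right)

text \<open>
  The orthogonal matrix \<open>F\<close> takes the basis vector \<open>z\<close> to the normalised all-one vector. Conjugation by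
  \<open>F\<close> therefore identifies matrices fixing the all-one vector with matrices supported on the other
  indices: \<open>corner\<close> and \<open>from_corner\<close> are the two directions, on the level of matrices over an
  algebra as well as of polynomials.
\<close>

locale bistochastic_frame =
  fixes z :: "'n::finite" and F :: "real^'n^'n"
  assumes F: "orthogonal_matrix F"
    and Fz: "F *v axis z 1 = (1 / sqrt (real CARD('n))) *\<^sub>R (\<chi> i. 1)"
begin

abbreviation "I \<equiv> UNIV - {z}"

definition conjugated :: "'a::cstar_algebra^'n^'n \<Rightarrow> 'a^'n^'n"
  where "conjugated u = scalar_matrix (transpose F) ** u ** scalar_matrix F"

definition corner :: "'a::cstar_algebra^'n^'n \<Rightarrow> 'a^'n^'n"
  where "corner u = (\<chi> i j. if i \<noteq> z \<and> j \<noteq> z then conjugated u $ i $ j else 0)"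

definition from_corner :: "'a::cstar_algebra^'n^'n \<Rightarrow> 'a^'n^'n"
  where "from_corner v = scalar_matrix F ** (v + unit_at z) ** scalar_matrix (transpose F)"

definition corner_polynomial :: "'n \<times> 'n \<Rightarrow> ('n \<times> 'n) free_star_algebra"
  where "corner_polynomial = (\<lambda>(i, j). if i \<noteq> z \<and> j \<noteq> z then
    (const_matrix (transpose F) ** gen_matrix ** const_matrix F) $ i $ j else 0)"

definition from_corner_polynomial :: "'n \<times> 'n \<Rightarrow> ('n \<times> 'n) free_star_algebra"
  where "from_corner_polynomial = entry (const_matrix F ** (gen_matrix + unit_at z) ** const_matrix (transpose F))"

lemma eval_conjugated: "free_eval (entry u) ((const_matrix (transpose F) ** gen_matrix ** const_matrix F) $ i $ j) = conjugated u $ i $ j"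
proof -
  have "eval_matrix u (const_matrix (transpose F) ** gen_matrix ** const_matrix F) = conjugated u"
    by (simp add: eval_matrix_mult eval_matrix_const eval_matrix_gen conjugated_def)
  then show ?thesis by (simp add: eval_matrix_def vec_eq_iff)
qed

lemma eval_corner: "free_eval (entry u) (corner_polynomial x) = entry (corner u) x"
  by (cases x) (simp add: corner_polynomial_def eval_conjugated corner_def entry_pair free_eval_zero)

lemma eval_from_corner: "free_eval (entry v) (from_corner_polynomial x) = entry (from_corner v) x"
proof -
  have "eval_matrix v (const_matrix F ** (gen_matrix + unit_at z) ** const_matrix (transpose F)) = from_corner v"
    by (simp add: eval_matrix_mult eval_matrix_const eval_matrix_gen eval_matrix_add eval_matrix_unit_at from_corner_def)
  then show ?thesis by (cases x) (simp add: eval_matrix_def vec_eq_iff from_corner_polynomial_def entry_def)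
qed

lemma free_eval_corner: "free_eval (entry (corner u)) p = free_eval (entry u) (substitute corner_polynomial p)"
  by (simp add: free_eval_substitute eval_corner)

lemma free_eval_from_corner: "free_eval (entry (from_corner v)) p = free_eval (entry v) (substitute from_corner_polynomial p)"
  by (simp add: free_eval_substitute eval_from_corner)

lemma FF: "F ** transpose F = mat 1" "transpose F ** F = mat 1"
  using F by (auto simp: orthogonal_matrix_def)

lemma scalar_FF:
  "scalar_matrix F ** scalar_matrix (transpose F) = (mat 1 :: 'a::cstar_algebra^'n^'n)"
  "scalar_matrix (transpose F) ** scalar_matrix F = (mat 1 :: 'a::cstar_algebra^'n^'n)"
  by (simp_all add: scalar_matrix_mult[symmetric] FF scalar_matrix_one)

lemma F_column: "F $ k $ z = 1 / sqrt (real CARD('n))"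
proof -
  have "(F *v axis z 1) $ k = F $ k $ z"
    by (simp add: matrix_vector_mult_def axis_def if_distrib[of "\<lambda>x. _ * x"] cong: if_cong)
  then show ?thesis by (simp add: Fz)
qed

lemma conjugated_inverse: "scalar_matrix F ** conjugated u ** scalar_matrix (transpose F) = u"
proof -
  have "scalar_matrix F ** conjugated u ** scalar_matrix (transpose F) =
      (scalar_matrix F ** scalar_matrix (transpose F)) ** u ** (scalar_matrix F ** scalar_matrix (transpose F))"
    by (simp only: conjugated_def matrix_mul_assoc)
  then show ?thesis by (simp add: scalar_FF)
qed

lemma conjugated_orthogonal:
  assumes "orthogonal_matrix u"
  shows "conjugated u ** transpose (conjugated u) = mat 1" "transpose (conjugated u) ** conjugated u = mat 1"
proof -
  have u: "u ** transpose u = mat 1" "transpose u ** u = mat 1"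
    using assms by (auto simp: orthogonal_matrix_def)
  have t: "transpose (conjugated u) = scalar_matrix (transpose F) ** transpose u ** scalar_matrix F"
    by (simp add: conjugated_def transpose_mult_scalar transpose_scalar_mult matrix_mul_assoc transpose_transpose)
  have "conjugated u ** transpose (conjugated u) =
      scalar_matrix (transpose F) ** (u ** (scalar_matrix F ** scalar_matrix (transpose F)) ** transpose u) ** scalar_matrix F"
    unfolding t unfolding conjugated_def by (simp only: matrix_mul_assoc)
  then show "conjugated u ** transpose (conjugated u) = mat 1"
    by (simp add: scalar_FF u)
  have "transpose (conjugated u) ** conjugated u =
      scalar_matrix (transpose F) ** (transpose u ** (scalar_matrix F ** scalar_matrix (transpose F)) ** u) ** scalar_matrix F"
    unfolding t unfolding conjugated_def by (simp only: matrix_mul_assoc)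
  then show "transpose (conjugated u) ** conjugated u = mat 1"
    by (simp add: scalar_FF u)
qed

text \<open>
  The column is the image of the fixed vector. The row follows from the column by orthogonality.
\<close>

lemma conjugated_fixed:
  assumes "orthogonal_matrix u" and fixed: "\<And>i. (\<Sum>j\<in>UNIV. u $ i $ j) = 1"
  shows "conjugated u $ i $ z = (if i = z then 1 else 0)" "conjugated u $ z $ i = (if i = z then 1 else 0)"
proof -
  have c: "(u ** scalar_matrix F) $ k $ z = scalar_matrix F $ k $ z" for k
  proof -
    have "(u ** scalar_matrix F) $ k $ z = scaleC (of_real (1 / sqrt (real CARD('n)))) (\<Sum>l\<in>UNIV. u $ k $ l)"
      by (simp add: matrix_matrix_mult_def scalar_matrix_def F_column mult_scaleC_right complex_vector.scale_sum_right)
    then show ?thesis by (simp add: fixed scalar_matrix_def F_column)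
  qed
  have col: "conjugated u $ i $ z = (if i = z then 1 else 0)" for i
  proof -
    have "conjugated u $ i $ z = (\<Sum>k\<in>UNIV. scalar_matrix (transpose F) $ i $ k * (u ** scalar_matrix F) $ k $ z)"
      unfolding conjugated_def matrix_mul_assoc[symmetric] by (subst matrix_matrix_mult_def) simp
    also have "\<dots> = (scalar_matrix (transpose F) ** scalar_matrix F) $ i $ z"
      unfolding c by (simp add: matrix_matrix_mult_def)
    finally show ?thesis by (simp add: scalar_FF mat_def)
  qed
  then show "conjugated u $ i $ z = (if i = z then 1 else 0)" .
  have "(\<Sum>k\<in>UNIV. conjugated u $ k $ z * conjugated u $ k $ i) = (transpose (conjugated u) ** conjugated u) $ z $ i"
    by (simp add: matrix_matrix_mult_def transpose_def)
  also have "\<dots> = (if i = z then 1 else 0)"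
    by (simp add: conjugated_orthogonal[OF assms(1)] mat_def)
  also have "(\<Sum>k\<in>UNIV. conjugated u $ k $ z * conjugated u $ k $ i) = (\<Sum>k\<in>UNIV. if k = z then conjugated u $ z $ i else 0)"
    by (intro sum.cong) (auto simp: col)
  finally show "conjugated u $ z $ i = (if i = z then 1 else 0)" by simp
qed

lemma conjugated_eq_corner:
  assumes "orthogonal_matrix u" "\<And>i. (\<Sum>j\<in>UNIV. u $ i $ j) = 1"
  shows "conjugated u = corner u + unit_at z"
  by (rule matrix_eqI) (auto simp: corner_def unit_at_def conjugated_fixed[OF assms])

lemma from_corner_corner:
  assumes "orthogonal_matrix u" "\<And>i. (\<Sum>j\<in>UNIV. u $ i $ j) = 1"
  shows "from_corner (corner u) = u"
  unfolding from_corner_def conjugated_eq_corner[OF assms, symmetric] by (rule conjugated_inverse)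

lemma B_circ_relations_imp:
  fixes u :: "'a::cstar_algebra^'n^'n"
  assumes rel: "\<And>r. r \<in> B_circ_relations z F \<Longrightarrow> free_eval (entry u) r = 0"
  shows "half_liberated I (corner u)" "from_corner (corner u) = u"
    "\<And>i j. adj (u $ i $ j) = u $ i $ j" "orthogonal_matrix u" "\<And>i. (\<Sum>j\<in>UNIV. u $ i $ j) = 1"
proof -
  have "\<forall>r\<in>O_plus_relations. free_eval (entry u) r = 0"
    using rel by (simp add: B_circ_relations_def B_plus_relations_def)
  then have "(\<forall>i j. adj (u $ i $ j) = u $ i $ j) \<and> orthogonal_matrix u"
    by (rule iffD1[OF O_plus_relations_iff])
  then show sa: "\<And>i j. adj (u $ i $ j) = u $ i $ j" and orth: "orthogonal_matrix u" by auto
  show sum: "(\<Sum>j\<in>UNIV. u $ i $ j) = 1" for i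
  proof -
    have "(gen_matrix *v (\<chi> i. 1)) $ i - 1 \<in> B_circ_relations z F"
      by (auto simp: B_circ_relations_def B_plus_relations_def)
    from rel[OF this] show ?thesis
      by (simp add: free_eval_diff free_eval_one matrix_vector_mult_def free_eval_sum free_eval_mult
          gen_matrix_def free_eval_gen entry_def)
  qed
  show "from_corner (corner u) = u"
    by (rule from_corner_corner[OF orth sum])
  note fixed = conjugated_fixed[OF orth sum]
  show "half_liberated I (corner u)"
  proof
    have "adj (conjugated u $ i $ j) = conjugated u $ i $ j" for i j
      by (simp add: conjugated_def matrix_matrix_mult_def scalar_matrix_def adj_sum adj_mult adj_scaleC
          adj_one sa mult_scaleC_left mult_scaleC_right)
    then show "adj (corner u $ i $ j) = corner u $ i $ j" for i j
      by (simp add: corner_def adj_zero)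
    have rows: "(\<Sum>k\<in>UNIV. conjugated u $ i $ k * conjugated u $ j $ k) = (if i = j then 1 else 0)" for i j
      using arg_cong[OF conjugated_orthogonal(1)[OF orth], of "\<lambda>A. A $ i $ j"]
      by (simp add: matrix_matrix_mult_def transpose_def mat_def)
    have cols: "(\<Sum>k\<in>UNIV. conjugated u $ k $ i * conjugated u $ k $ j) = (if i = j then 1 else 0)" for i j
      using arg_cong[OF conjugated_orthogonal(2)[OF orth], of "\<lambda>A. A $ i $ j"]
      by (simp add: matrix_matrix_mult_def transpose_def mat_def)
    show "corner u ** transpose (corner u) = proj I"
    proof (rule matrix_eqI)
      fix i j
      have "(corner u ** transpose (corner u)) $ i $ j =
          (\<Sum>k\<in>UNIV. if i \<noteq> z \<and> j \<noteq> z then conjugated u $ i $ k * conjugated u $ j $ k else 0)"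
        unfolding matrix_matrix_mult_def transpose_def vec_lambda_beta corner_def
        by (intro sum.cong) (auto simp: fixed)
      then show "(corner u ** transpose (corner u)) $ i $ j = proj I $ i $ j"
        by (cases "i \<noteq> z \<and> j \<noteq> z") (auto simp: rows proj_def)
    qed
    show "transpose (corner u) ** corner u = proj I"
    proof (rule matrix_eqI)
      fix i j
      have "(transpose (corner u) ** corner u) $ i $ j =
          (\<Sum>k\<in>UNIV. if i \<noteq> z \<and> j \<noteq> z then conjugated u $ k $ i * conjugated u $ k $ j else 0)"
        unfolding matrix_matrix_mult_def transpose_def vec_lambda_beta corner_def
        by (intro sum.cong) (auto simp: fixed)
      then show "(transpose (corner u) ** corner u) $ i $ j = proj I $ i $ j"
        by (cases "i \<noteq> z \<and> j \<noteq> z") (auto simp: cols proj_def)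
    qed
    show "corner u $ i $ j = 0" if "i \<notin> I \<or> j \<notin> I" for i j
      using that by (auto simp: corner_def)
    show "entry (corner u) a * entry (corner u) b * entry (corner u) c =
        entry (corner u) c * entry (corner u) b * entry (corner u) a" for a b c
    proof (cases "(fst a \<noteq> z \<and> snd a \<noteq> z) \<and> (fst b \<noteq> z \<and> snd b \<noteq> z) \<and> (fst c \<noteq> z \<and> snd c \<noteq> z)")
      case True
      let ?f = "\<lambda>x. (const_matrix (transpose F) ** gen_matrix ** const_matrix F) $ fst x $ snd x"
      have "?f a * ?f b * ?f c - ?f c * ?f b * ?f a \<in> B_circ_relations z F"
        using True unfolding B_circ_relations_def half_commutation_def by blast
      from rel[OF this]
      have "conjugated u $ fst a $ snd a * conjugated u $ fst b $ snd b * conjugated u $ fst c $ snd c =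
          conjugated u $ fst c $ snd c * conjugated u $ fst b $ snd b * conjugated u $ fst a $ snd a"
        by (simp add: free_eval_diff free_eval_mult eval_conjugated)
      then show ?thesis
        using True by (simp add: entry_def corner_def case_prod_unfold)
    next
      case False
      then have "entry (corner u) a = 0 \<or> entry (corner u) b = 0 \<or> entry (corner u) c = 0"
        by (auto simp: entry_def corner_def case_prod_unfold)
      then show ?thesis by auto
    qed
  qed
qed

lemma bistochastic_from_corner:
  assumes g: "g \<in> orthogonal_on I"
  obtains A where "orthogonal_matrix A" "\<And>i. (\<Sum>j\<in>UNIV. A $ i $ j) = 1" "\<And>j. (\<Sum>i\<in>UNIV. A $ i $ j) = 1"
    "corner (cmat A) = cmat g" "from_corner (cmat g) = cmat A"
proof -
  define E :: "real^'n^'n" where "E = unit_at z"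
  define A where "A = F ** (g + E) ** transpose F"
  have zero: "g $ i $ j = 0" if "i = z \<or> j = z" for i j
  proof -
    have "cmat g $ i $ j = 0"
      using unitary_row_zero[OF cmat_unitary[OF g]] unitary_col_zero[OF cmat_unitary[OF g]] that by blast
    then show ?thesis by (simp add: cmat_def)
  qed
  have gE: "(g + E) ** transpose (g + E) = mat 1" "transpose (g + E) ** (g + E) = mat 1"
  proof -
    have "((g + E) ** transpose (g + E)) $ i $ j = (g ** transpose g) $ i $ j + unit_at z $ i $ j" for i j
    proof -
      have "((g + E) ** transpose (g + E)) $ i $ j = (\<Sum>k\<in>UNIV. g $ i $ k * g $ j $ k + (if k = z then unit_at z $ i $ j else 0))"
        unfolding matrix_matrix_mult_def transpose_def vec_lambda_beta E_def unit_at_def vector_add_component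
        by (intro sum.cong) (auto simp: zero)
      then show ?thesis by (simp add: sum.distrib matrix_matrix_mult_def transpose_def)
    qed
    then show "(g + E) ** transpose (g + E) = mat 1"
      using g by (intro matrix_eqI) (auto simp: orthogonal_on_def proj_def unit_at_def mat_def)
    then show "transpose (g + E) ** (g + E) = mat 1"
      by (simp add: matrix_left_right_inverse)
  qed
  have tA: "transpose A = F ** transpose (g + E) ** transpose F"
    by (simp add: A_def matrix_transpose_mul transpose_transpose matrix_mul_assoc)
  have AA: "A ** transpose A = mat 1"
  proof -
    have "A ** transpose A = F ** ((g + E) ** (transpose F ** F) ** transpose (g + E)) ** transpose F"
      unfolding tA unfolding A_def by (simp only: matrix_mul_assoc)
    then show ?thesis by (simp add: FF gE)
  qed
  then have orth: "orthogonal_matrix A"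
    by (simp add: orthogonal_matrix_def matrix_left_right_inverse)
  have Fxi: "(\<Sum>j\<in>UNIV. F $ j $ l) = (if l = z then sqrt (real CARD('n)) else 0)" for l
  proof -
    have "(\<Sum>j\<in>UNIV. F $ j $ l * F $ j $ z) = (transpose F ** F) $ l $ z"
      by (simp add: matrix_matrix_mult_def transpose_def)
    also have "\<dots> = (if l = z then 1 else 0)" by (simp add: FF mat_def)
    finally have "(\<Sum>j\<in>UNIV. F $ j $ l) / sqrt (real CARD('n)) = (if l = z then 1 else 0)"
      by (simp add: F_column sum_divide_distrib)
    moreover have "sqrt (real CARD('n)) \<noteq> 0" by simp
    ultimately show ?thesis by (auto simp: divide_eq_eq)
  qed
  have sums: "(\<Sum>j\<in>UNIV. (F ** M ** transpose F) $ i $ j) = 1"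
    if M: "\<And>k. M $ k $ z = (if k = z then 1 else 0)" for M :: "real^'n^'n" and i
  proof -
    have "(\<Sum>j\<in>UNIV. (F ** M ** transpose F) $ i $ j) = (\<Sum>l\<in>UNIV. (F ** M) $ i $ l * (\<Sum>j\<in>UNIV. F $ j $ l))"
      unfolding matrix_matrix_mult_def[of "F ** M"] transpose_def
      by (simp add: sum_distrib_left) (rule sum.swap)
    also have "\<dots> = (F ** M) $ i $ z * sqrt (real CARD('n))"
      by (simp add: Fxi if_distrib[of "\<lambda>x. _ * x"] cong: if_cong)
    also have "(F ** M) $ i $ z = F $ i $ z"
      by (simp add: matrix_matrix_mult_def M if_distrib[of "\<lambda>x. _ * x"] cong: if_cong)
    finally show ?thesis by (simp add: F_column)
  qed
  have rows: "(\<Sum>j\<in>UNIV. A $ i $ j) = 1" for i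
    unfolding A_def by (rule sums) (simp add: zero E_def unit_at_def)
  have cols: "(\<Sum>i\<in>UNIV. A $ i $ j) = 1" for j
  proof -
    have "(\<Sum>i\<in>UNIV. transpose A $ j $ i) = 1"
      unfolding tA by (rule sums) (simp add: transpose_def zero E_def unit_at_def)
    then show ?thesis by (simp add: transpose_def)
  qed
  have cE: "cmat (g + E) = cmat g + unit_at z"
    by (rule matrix_eqI) (simp add: cmat_def E_def unit_at_def)
  have A_corner: "from_corner (cmat g) = cmat A"
    by (simp add: from_corner_def scalar_matrix_complex A_def cmat_mult cE)
  have "conjugated (cmat A) = cmat g + unit_at z"
  proof -
    have "transpose F ** A ** F = (transpose F ** F) ** (g + E) ** (transpose F ** F)"
      by (simp only: A_def matrix_mul_assoc)
    then have "cmat (transpose F ** A ** F) = cmat (g + E)" by (simp add: FF)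
    then show ?thesis by (simp add: conjugated_def scalar_matrix_complex cmat_mult cE)
  qed
  then have "corner (cmat A) = cmat g"
    by (intro matrix_eqI) (auto simp: corner_def unit_at_def cmat_def zero)
  with orth rows cols A_corner show thesis by (intro that)
qed

lemma corner_bound:
  assumes lower: "qincl (B_coords :: ('n bistochastic_group \<Rightarrow>\<^sub>C complex)^'n^'n) u" and g: "g \<in> orthogonal_on I"
  shows "cmod (free_eval (entry (cmat g)) p) \<le> norm (free_eval (entry (corner u)) p)"
proof -
  obtain A where A: "orthogonal_matrix A" "\<And>i. (\<Sum>j\<in>UNIV. A $ i $ j) = 1" "\<And>j. (\<Sum>i\<in>UNIV. A $ i $ j) = 1"
    "corner (cmat A) = cmat g" "from_corner (cmat g) = cmat A"
    using bistochastic_from_corner[OF g] by blast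
  have "free_eval (entry (cmat g)) p = free_eval (entry (cmat A)) (substitute corner_polynomial p)"
    using free_eval_corner[of "cmat A" p] A(4) by simp
  then show ?thesis
    using B_coords_bound[OF A(1-3), of "substitute corner_polynomial p"]
      qincl_norm_le[OF lower, of "substitute corner_polynomial p"] by (simp add: free_eval_corner)
qed

lemma commuting_bound:
  assumes g: "g \<in> orthogonal_on I"
  shows "cmod (free_eval (entry (cmat g)) (substitute from_corner_polynomial p)) \<le>
    norm (free_eval (entry (B_coords :: ('n bistochastic_group \<Rightarrow>\<^sub>C complex)^'n^'n)) p)"
proof -
  obtain A where A: "orthogonal_matrix A" "\<And>i. (\<Sum>j\<in>UNIV. A $ i $ j) = 1" "\<And>j. (\<Sum>i\<in>UNIV. A $ i $ j) = 1"
    "corner (cmat A) = cmat g" "from_corner (cmat g) = cmat A"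
    using bistochastic_from_corner[OF g] by blast
  then show ?thesis
    using B_coords_bound[OF A(1-3), of p] by (simp add: free_eval_from_corner[symmetric])
qed

lemma comultiplication_conjugated:
  assumes "cstar_hom \<Delta>" "cstar_hom \<iota>\<^sub>1" "cstar_hom \<iota>\<^sub>2"
    and \<Delta>: "\<And>i j. \<Delta> (u $ i $ j) = (\<Sum>k\<in>UNIV. \<iota>\<^sub>1 (u $ i $ k) * \<iota>\<^sub>2 (u $ k $ j))"
  shows "\<Delta> (conjugated u $ i $ j) = (\<Sum>k\<in>UNIV. \<iota>\<^sub>1 (conjugated u $ i $ k) * \<iota>\<^sub>2 (conjugated u $ k $ j))"
proof -
  let ?m = "\<lambda>h A. \<chi> i j. h (A $ i $ j)"
  have hom: "?m h (conjugated u) = conjugated (?m h u)" if h: "cstar_hom h" for h :: "'a \<Rightarrow> 'b"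
    by (rule matrix_eqI)
      (simp add: conjugated_def matrix_matrix_mult_def scalar_matrix_def cstar_hom_sum[OF h] cstar_hom_mult[OF h]
        cstar_hom_scaleC[OF h] cstar_hom_one[OF h])
  have "?m \<Delta> u = ?m \<iota>\<^sub>1 u ** ?m \<iota>\<^sub>2 u"
    by (rule matrix_eqI) (simp add: matrix_matrix_mult_def \<Delta>)
  then have "?m \<Delta> (conjugated u) = conjugated (?m \<iota>\<^sub>1 u ** ?m \<iota>\<^sub>2 u)"
    by (simp add: hom[OF assms(1)])
  also have "\<dots> = scalar_matrix (transpose F) ** ?m \<iota>\<^sub>1 u ** (scalar_matrix F ** scalar_matrix (transpose F)) ** ?m \<iota>\<^sub>2 u ** scalar_matrix F"
    by (simp add: scalar_FF conjugated_def matrix_mul_assoc)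
  also have "\<dots> = conjugated (?m \<iota>\<^sub>1 u) ** conjugated (?m \<iota>\<^sub>2 u)"
    by (simp only: conjugated_def matrix_mul_assoc)
  also have "\<dots> = ?m \<iota>\<^sub>1 (conjugated u) ** ?m \<iota>\<^sub>2 (conjugated u)"
    by (simp only: hom[OF assms(2)] hom[OF assms(3)])
  finally have "?m \<Delta> (conjugated u) $ i $ j = (?m \<iota>\<^sub>1 (conjugated u) ** ?m \<iota>\<^sub>2 (conjugated u)) $ i $ j"
    by simp
  then show ?thesis by (simp add: matrix_matrix_mult_def)
qed

text \<open>
  The argument at the top of the theory applied to the corner. When there is only one index, the
  corner is zero and there is nothing to distinguish the two quantum groups.
\<close>

theorem B_circ_maximal:
  fixes w :: "'k::cstar_algebra^'n^'n"
  assumes w: "is_C_B_circ z F w"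
  shows "no_proper_intermediate TYPE('g::cstar_algebra) TYPE('t::cstar_algebra)
    (B_coords :: ('n bistochastic_group \<Rightarrow>\<^sub>C complex)^'n^'n) w"
  unfolding no_proper_intermediate_def
proof (intro allI impI)
  fix u :: "'g^'n^'n" and \<iota>\<^sub>1 \<iota>\<^sub>2 \<Delta> :: "'g \<Rightarrow> 't"
  let ?B = "B_coords :: ('n bistochastic_group \<Rightarrow>\<^sub>C complex)^'n^'n"
  assume "quantum_subgroup_O_plus u \<iota>\<^sub>1 \<iota>\<^sub>2 \<Delta> \<and> qincl ?B u \<and> qincl u w"
  then have G: "quantum_subgroup_O_plus u \<iota>\<^sub>1 \<iota>\<^sub>2 \<Delta>"
    and lower: "qincl ?B u" and upper: "qincl u w"
    by auto
  have uw: "universal_cstar_algebra (B_circ_relations z F) (entry w)"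
    using w by (simp add: is_C_B_circ_def)
  note U = B_circ_relations_imp[OF qincl_relations[OF upper uw]]
  note W = B_circ_relations_imp[OF universal_relations[OF uw]]
  have T: "min_tensor_product \<iota>\<^sub>1 \<iota>\<^sub>2" using G by (simp add: quantum_subgroup_O_plus_def)
  have homs: "cstar_hom \<Delta>" "cstar_hom \<iota>\<^sub>1" "cstar_hom \<iota>\<^sub>2"
    and \<Delta>: "\<And>i j. \<Delta> (u $ i $ j) = (\<Sum>k\<in>UNIV. \<iota>\<^sub>1 (u $ i $ k) * \<iota>\<^sub>2 (u $ k $ j))"
    using G by (auto simp: quantum_subgroup_O_plus_def min_tensor_product_def)
  have classical: "qequal u ?B"
    if comm: "\<And>a b. entry (corner u) a * entry (corner u) b = entry (corner u) b * entry (corner u) a"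
  proof (rule qequal_from_smaller[OF lower])
    show "closure (range (free_eval (entry u))) = UNIV"
      using G by (simp add: quantum_subgroup_O_plus_def)
    fix p
    obtain g where g: "g \<in> orthogonal_on I" "norm (free_eval (entry (corner u)) (substitute from_corner_polynomial p)) =
        cmod (free_eval (entry (cmat g)) (substitute from_corner_polynomial p))"
      using half_liberated_commuting_norm[OF U(1) comm] by metis
    then show "norm (free_eval (entry u) p) \<le> norm (free_eval (entry ?B) p)"
      using commuting_bound[OF g(1), of p] by (simp add: free_eval_from_corner[symmetric] U(2))
  qed
  show "qequal u ?B \<or> qequal u w"
  proof (cases "I = {}")
    case True
    then have "entry (corner u) a = 0" for a
      by (cases a) (auto simp: entry_def corner_def)
    then show ?thesis using classical by simp
  next
    case False
    interpret C: half_liberated I "corner u" by (rule U(1))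
    interpret Q: half_liberated_quantum_group I "corner u" \<iota>\<^sub>1 \<iota>\<^sub>2 \<Delta>
    proof
      show "\<Delta> (corner u $ i $ j) = (\<Sum>k\<in>UNIV. \<iota>\<^sub>1 (corner u $ i $ k) * \<iota>\<^sub>2 (corner u $ k $ j))" for i j
      proof (cases "i \<noteq> z \<and> j \<noteq> z")
        case True
        have "(\<Sum>k\<in>UNIV. \<iota>\<^sub>1 (conjugated u $ i $ k) * \<iota>\<^sub>2 (conjugated u $ k $ j)) =
            (\<Sum>k\<in>UNIV. \<iota>\<^sub>1 (corner u $ i $ k) * \<iota>\<^sub>2 (corner u $ k $ j))"
          using True conjugated_fixed[OF U(4,5)]
          by (intro sum.cong) (auto simp: corner_def cstar_hom_zero[OF homs(2)])
        then show ?thesis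
          using comultiplication_conjugated[OF homs \<Delta>, of i j] True by (simp add: corner_def)
      next
        case False
        then show ?thesis
          by (auto simp: corner_def cstar_hom_zero homs)
      qed
      show "cmod (free_eval (entry (cmat g)) p) \<le> norm (free_eval (entry (corner u)) p)"
        if "g \<in> orthogonal_on I" for g p
        by (rule corner_bound[OF lower that])
    qed (use T G False homs min_tensor_product_no_zero_divisors[OF T] in
        \<open>auto simp: min_tensor_product_def\<close>)
    show ?thesis
      using Q.spectrum_dichotomy
    proof
      assume full: "C.spectrum = unitary_on I"
      have "qequal u w"
      proof (rule qequal_from_larger[OF upper universal_dense[OF uw]])
        fix p
        show "norm (free_eval (entry w) p) \<le> norm (free_eval (entry u) p)"
          using Q.full_spectrum_norm_le[OF full W(1), of "substitute from_corner_polynomial p"]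
          by (simp add: free_eval_from_corner[symmetric] U(2) W(2))
      qed
      then show ?thesis ..
    next
      assume "\<forall>a b. entry (corner u) a * entry (corner u) b = entry (corner u) b * entry (corner u) a"
      then show ?thesis using classical by blast
    qed
  qed
qed

end

theorem proposition7p3:
  fixes w :: "'h::cstar_algebra^'n^'n" and w' :: "'k::cstar_algebra^'n^'n"
    and z :: 'n and F :: "real^'n^'n"
  shows "(is_C_O_star w \<longrightarrow>
           no_proper_intermediate TYPE('g::cstar_algebra) TYPE('t::cstar_algebra)
             (O_coords :: ('n orthogonal_group \<Rightarrow>\<^sub>C complex)^'n^'n) w) \<and>
         (orthogonal_matrix F \<and> F *v axis z 1 = (1 / sqrt (real CARD('n))) *\<^sub>R (\<chi> i. 1) \<and>
          is_C_B_circ z F w' \<longrightarrow>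
           no_proper_intermediate TYPE('g) TYPE('t)
             (B_coords :: ('n bistochastic_group \<Rightarrow>\<^sub>C complex)^'n^'n) w')"
  by (intro conjI impI)
    (auto intro: O_star_maximal bistochastic_frame.B_circ_maximal bistochastic_frame.intro)

end
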